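(* If $F_2(t_0)<1$ and $F_2$ has the density function $f_2$, then (i) for $n\in\mathbb N$ the limit $\tau_{2,n}^*=\lim_{K\to\infty}\tau_{2,n,K}^*$ a.s. exists and $\tau_{2,n}^*\le t_0$ is an optimal stopping rule in the set $\mathcal T^s\cap\{\tau\ge T_{2,n}\}$; (ii) $E[Z(s,\tau_{2,n}^* )\mid\mathcal F_{s,n}]=\gamma^{s,m}(M_n^s,T_{2,n})$ a.s.
   Context: Fix a horizon $t_0$ (the fixed time of fishing). For $i\in\{1,2\}$ (two fishing places), $\{N_i(t),t\ge0\}$ is a renewal process, $N_i(t)$ being the number of catches during the time $t$ at place $i$; $T_{i,n}$ is the moment of the $n$-th catch at place $i$, with $T_{1,0}=0$ and $T_{2,0}=s$, where $s\ge0$ is the fixed moment at which the place is changed. The random variables $S_{i,n}=T_{i,n}-T_{i,n-1}$ are i.i.d. with continuous distribution function $F_i$, and $\bar F_i=1-F_i$. The weights of the fish caught at place $i$ are i.i.d. random variables $X_{i,1},X_{i,2},\dots$ with continuous distribution function $H_i$, and one fixes $X_{i,0}=0$; $X_i$ denotes a generic weight with distribution function $H_i$. The renewal process is independent of the sequence of weights. The utility functions $g_i:[0,\infty)\to[0,G_i]$ and the cost functions $c_i:[0,t_0]\to[0,C_i]$ are continuous and bounded, $c_i$ is additionally differentiable, and $C=C_1+C_2$. The mass of fish caught up to time $t$ if the change took place at time $s$ is $$M_t^s=\sum_{n=1}^{N_1(s\wedge t)}X_{1,n}+\sum_{n=1}^{N_2((t-s)^+)}X_{2,n},$$ with $M_t=M_t^t$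 and $M_n^s=M^s_{T_{2,n}}$; $m=M_s$ is the mass at the moment of change. Put $w_1(m,t)=g_1(m)-c_1(t)$ and $w_2(m,s,\tilde m,t)=w_1(m,s)+g_2(\tilde m-m)-c_2(t-s)$. The payoff for stopping at time $t$ if the change took place at time $s$ is $$Z(s,t)=\mathbb I_{\{t<s\le t_0\}}w_1(M_t,t)+\mathbb I_{\{s\le t\le t_0\}}w_2(M_s,s,M_t^s,t)-\mathbb I_{\{t_0<t\}}C .$$ $\mathcal F_t=\sigma(X_{1,0},T_{1,0},\dots,X_{1,N_1(t)},T_{1,N_1(t)})$ is the $\sigma$-field generated by all events up to time $t$ if there was no change of place, $\mathcal F_{s,t}=\sigma(\mathcal F_s,X_{2,0},T_{2,0},\dots,X_{2,N_2(t-s)},T_{2,N_2(t-s)})$ is the $\sigma$-field generated by all events up to time $t$ if the change was at time $s$, and $\mathcal F_{s,n}:=\mathcal F_{s,T_{2,n}}$. $\mathcal T^s$ is the set of stopping times with respect to $\{\mathcal F_{s,t},\,0\le s\le t\}$. Optimality refers to maximizing $E[Z(s,\tau)\mid\mathcal F_{s,n}]$. Let $\alpha_2=f_2/\bar F_2$ and $\Delta_2(a)=E[g_2(a+X_2)-g_2(a)]$. Let $B=B([0,\infty)\times[0,t_0]\times[0,t_0])$ be the space of all bounded continuous functions with the norm $\|\delta\|=\sup_{a,b,c}|\delta(a,b,c)|$. Put $$\phi_{2,\delta}(a,b,c,r)=\int_0^r\bar F_2(z)\big\{\alpha_2(z)\big[\Delta_2(a)+E\,\delta(a+X_2,b+z,c-z)\big]-c_2'(b+z)\big\}\,dz,$$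 $$(\Phi_2\delta)(a,b,c)=\max_{0\le r\le c}\phi_{2,\delta}(a,b,c,r).$$ Let $y_{2,0}=0$ and $y_{2,j}=\Phi_2y_{2,j-1}$ for $j\ge1$, and let $r^*_{2,j}(a,b,c)$ be a function attaining this maximum, so that $y_{2,j}(a,b,c)=\phi_{2,y_{2,j-1}}(a,b,c,r^*_{2,j}(a,b,c))$. When $F_2(t_0)<1$, the operator $\Phi_2:B\to B$ is a contraction; $y_2\in B$ denotes its fixed point, $y_2=\Phi_2y_2$, and $\lim_{K\to\infty}\|y_{2,K}-y_2\|=0$. Define $$\gamma^{s,m}(\tilde m,t)=\mathbb I_{\{t\le t_0\}}\big[w_2(m,s,\tilde m,t)+y_2(\tilde m-m,t-s,t_0-t)\big]-C\,\mathbb I_{\{t>t_0\}} .$$ For $n\le K$ put $R^*_{2,i}=r^*_{2,K-i}(M_i^s-M_s,T_{2,i}-s,t_0-T_{2,i})$ for $i=0,1,\dots,K$, with $R^*_{2,K}=0$, then $\eta^s_{n,K}=K\wedge\inf\{i\ge n:R^*_{2,i}<S_{2,i+1}\}$, and $\tau^*_{2,n,K}=T_{2,\eta^s_{n,K}}+R^*_{2,\eta^s_{n,K}}$.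
   Formalization: The bound τ*≤t_0 is claimed only where T_{2,n}≤t_0 (else it contradicts τ≥T_{2,n}); r* is the least maximiser (limits can fail for arbitrary choices) and R* is 0 after t_0; B is restricted to b+c≤t_0, where c_2'(b+z) is defined; the two places are taken independent. *)

theory Defs
  imports "HOL-Probability.Probability"
begin

text \<open>
  The places are numbered 1 and 2. \<open>S i n\<close> and \<open>X i n\<close> (for \<open>n \<ge> 1\<close>) are the waiting time for, and
  the weight of, the \<open>n\<close>-th catch at place \<open>i\<close>; \<open>s\<close> is the moment of the change, \<open>t0\<close> the horizon.
\<close>

definition arrival :: "(nat \<Rightarrow> nat \<Rightarrow> 'a \<Rightarrow> real) \<Rightarrow> real \<Rightarrow> nat \<Rightarrow> nat \<Rightarrow> 'a \<Rightarrow> real" where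
  "arrival S s i n \<omega> = (if i = 2 then s else 0) + (\<Sum>k=1..n. S i k \<omega>)"

definition catches :: "(nat \<Rightarrow> nat \<Rightarrow> 'a \<Rightarrow> real) \<Rightarrow> nat \<Rightarrow> real \<Rightarrow> 'a \<Rightarrow> nat" where
  "catches S i u \<omega> = card {n. 1 \<le> n \<and> (\<Sum>k=1..n. S i k \<omega>) \<le> u}"

text \<open>
  Waiting times and weights at both places are jointly independent: besides the independence of
  catch times and weights at one place, this contains the independence of the two places.
  That waiting times and weights are nonnegative and the counting processes finite is required for
  every \<open>\<omega>\<close>, not only almost surely.
\<close>

locale fishing_model = prob_space M
  for M :: "'a measure" +
  fixes S X :: "nat \<Rightarrow> nat \<Rightarrow> 'a \<Rightarrow> real"
    and F H :: "nat \<Rightarrow> real \<Rightarrow> real"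
    and g :: "nat \<Rightarrow> real \<Rightarrow> real" and G :: "nat \<Rightarrow> real"
    and cost cost' :: "nat \<Rightarrow> real \<Rightarrow> real" and C :: "nat \<Rightarrow> real"
    and t0 :: real
  assumes independent:
      "indep_vars (\<lambda>_. borel) (case_sum (\<lambda>(i, n). S i n) (\<lambda>(i, n). X i n))
         (({1, 2} \<times> {1..}) <+> ({1, 2} \<times> {1..}))"
    and waiting_cdf: "\<And>i n. i \<in> {1, 2} \<Longrightarrow> 1 \<le> n \<Longrightarrow> cdf (distr M borel (S i n)) = F i"
    and F_continuous: "\<And>i. i \<in> {1, 2} \<Longrightarrow> continuous_on UNIV (F i)"
    and weight_cdf: "\<And>i n. i \<in> {1, 2} \<Longrightarrow> 1 \<le> n \<Longrightarrow> cdf (distr M borel (X i n)) = H i"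
    and H_continuous: "\<And>i. i \<in> {1, 2} \<Longrightarrow> continuous_on UNIV (H i)"
    and waiting_nonneg: "\<And>i n \<omega>. i \<in> {1, 2} \<Longrightarrow> 1 \<le> n \<Longrightarrow> \<omega> \<in> space M \<Longrightarrow> 0 \<le> S i n \<omega>"
    and finite_catches:
      "\<And>i u \<omega>. i \<in> {1, 2} \<Longrightarrow> \<omega> \<in> space M \<Longrightarrow> finite {n. 1 \<le> n \<and> (\<Sum>k=1..n. S i k \<omega>) \<le> u}"
    and weight_nonneg: "\<And>i n \<omega>. i \<in> {1, 2} \<Longrightarrow> 1 \<le> n \<Longrightarrow> \<omega> \<in> space M \<Longrightarrow> 0 \<le> X i n \<omega>"
    and weight_0: "\<And>i \<omega>. i \<in> {1, 2} \<Longrightarrow> \<omega> \<in> space M \<Longrightarrow> X i 0 \<omega> = 0"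
    and horizon: "0 \<le> t0"
    and utility_continuous: "\<And>i. i \<in> {1, 2} \<Longrightarrow> continuous_on {0..} (g i)"
    and utility_range: "\<And>i x. i \<in> {1, 2} \<Longrightarrow> 0 \<le> x \<Longrightarrow> g i x \<in> {0..G i}"
    and cost_continuous: "\<And>i. i \<in> {1, 2} \<Longrightarrow> continuous_on {0..t0} (cost i)"
    and cost_range: "\<And>i t. i \<in> {1, 2} \<Longrightarrow> t \<in> {0..t0} \<Longrightarrow> cost i t \<in> {0..C i}"
    and cost_derivative: "\<And>i t. i \<in> {1, 2} \<Longrightarrow> t \<in> {0..t0} \<Longrightarrow>
      (cost i has_real_derivative cost' i t) (at t within {0..t0})"

text \<open>\<open>mass S X s t\<close> is the mass \<open>M\<^sup>s\<^sub>t\<close>; without a change before \<open>t\<close> it is \<open>mass S X t t\<close>.\<close>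

definition mass ::
  "(nat \<Rightarrow> nat \<Rightarrow> 'a \<Rightarrow> real) \<Rightarrow> (nat \<Rightarrow> nat \<Rightarrow> 'a \<Rightarrow> real) \<Rightarrow> real \<Rightarrow> real \<Rightarrow> 'a \<Rightarrow> real" where
  "mass S X s t \<omega> = (\<Sum>n=1..catches S 1 (min s t) \<omega>. X 1 n \<omega>)
     + (\<Sum>n=1..catches S 2 (max 0 (t - s)) \<omega>. X 2 n \<omega>)"

definition w1 :: "(nat \<Rightarrow> real \<Rightarrow> real) \<Rightarrow> (nat \<Rightarrow> real \<Rightarrow> real) \<Rightarrow> real \<Rightarrow> real \<Rightarrow> real" where
  "w1 g cost m t = g 1 m - cost 1 t"

definition w2 ::
  "(nat \<Rightarrow> real \<Rightarrow> real) \<Rightarrow> (nat \<Rightarrow> real \<Rightarrow> real) \<Rightarrow> real \<Rightarrow> real \<Rightarrow> real \<Rightarrow> real \<Rightarrow> real" where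
  "w2 g cost m s m' t = w1 g cost m s + g 2 (m' - m) - cost 2 (t - s)"

definition payoff ::
  "(nat \<Rightarrow> nat \<Rightarrow> 'a \<Rightarrow> real) \<Rightarrow> (nat \<Rightarrow> nat \<Rightarrow> 'a \<Rightarrow> real) \<Rightarrow> (nat \<Rightarrow> real \<Rightarrow> real) \<Rightarrow>
   (nat \<Rightarrow> real \<Rightarrow> real) \<Rightarrow> (nat \<Rightarrow> real) \<Rightarrow> real \<Rightarrow> real \<Rightarrow> real \<Rightarrow> 'a \<Rightarrow> real" where
  "payoff S X g cost C t0 s t \<omega> =
     of_bool (t < s \<and> s \<le> t0) * w1 g cost (mass S X t t \<omega>) t
     + of_bool (s \<le> t \<and> t \<le> t0) * w2 g cost (mass S X s s \<omega>) s (mass S X s t \<omega>) t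
     - of_bool (t0 < t) * (C 1 + C 2)"

text \<open>
  The random-length list \<open>X\<^sub>0, T\<^sub>0, \<dots>, X\<^sub>N, T\<^sub>N\<close>, \<open>N\<close> being the number of catches
  made at place \<open>i\<close> up to time \<open>t\<close>, is encoded by the events
  ``the \<open>n\<close>-th entry is present and lies in \<open>A\<close>''.
\<close>

definition history ::
  "'a set \<Rightarrow> (nat \<Rightarrow> nat \<Rightarrow> 'a \<Rightarrow> real) \<Rightarrow> (nat \<Rightarrow> nat \<Rightarrow> 'a \<Rightarrow> real) \<Rightarrow> real \<Rightarrow> nat \<Rightarrow> real \<Rightarrow> 'a set set" where
  "history \<Omega> S X s i t =
     {{\<omega> \<in> \<Omega>. n \<le> catches S i (t - (if i = 2 then s else 0)) \<omega> \<and> Y \<omega> \<in> A} | n Y A.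
        Y \<in> {X i n, arrival S s i n} \<and> A \<in> sets (borel :: real measure)}"

definition filt1 ::
  "'a set \<Rightarrow> (nat \<Rightarrow> nat \<Rightarrow> 'a \<Rightarrow> real) \<Rightarrow> (nat \<Rightarrow> nat \<Rightarrow> 'a \<Rightarrow> real) \<Rightarrow> real \<Rightarrow> 'a measure" where
  "filt1 \<Omega> S X t = sigma \<Omega> (history \<Omega> S X 0 1 t)"

text \<open>
  \<open>filt2 \<Omega> S X s t\<close> is the sigma-field \<open>\<F>\<^sub>s\<^sub>,\<^sub>t\<close>. It only matters for \<open>s \<le> t\<close>; for
  \<open>t < s\<close> no catch at place 2 is visible yet and the formula yields \<open>\<F>\<^sub>s\<close>, so that
  \<open>filt2 \<Omega> S X s\<close> is a filtration indexed by all reals.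
\<close>

definition filt2 ::
  "'a set \<Rightarrow> (nat \<Rightarrow> nat \<Rightarrow> 'a \<Rightarrow> real) \<Rightarrow> (nat \<Rightarrow> nat \<Rightarrow> 'a \<Rightarrow> real) \<Rightarrow> real \<Rightarrow> real \<Rightarrow> 'a measure" where
  "filt2 \<Omega> S X s t = sigma \<Omega> (sets (filt1 \<Omega> S X s) \<union> history \<Omega> S X s 2 t)"

definition filt2_at ::
  "'a set \<Rightarrow> (nat \<Rightarrow> nat \<Rightarrow> 'a \<Rightarrow> real) \<Rightarrow> (nat \<Rightarrow> nat \<Rightarrow> 'a \<Rightarrow> real) \<Rightarrow> real \<Rightarrow> nat \<Rightarrow> 'a measure" where
  "filt2_at \<Omega> S X s n = filtration.pre_sigma \<Omega> (filt2 \<Omega> S X s) (arrival S s 2 n)"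

text \<open>
  The stopping times are finite; since the payoff is constant after \<open>t0\<close>, admitting the value
  \<open>\<infinity>\<close> would not change anything.
\<close>

definition stopping_rules ::
  "'a set \<Rightarrow> (nat \<Rightarrow> nat \<Rightarrow> 'a \<Rightarrow> real) \<Rightarrow> (nat \<Rightarrow> nat \<Rightarrow> 'a \<Rightarrow> real) \<Rightarrow> real \<Rightarrow> ('a \<Rightarrow> real) set" where
  "stopping_rules \<Omega> S X s =
     {\<tau>. stopping_time (filt2 \<Omega> S X s) \<tau> \<and> (\<forall>\<omega>\<in>\<Omega>. s \<le> \<tau> \<omega>)}"

definition stopping_rules_from ::
  "'a measure \<Rightarrow> (nat \<Rightarrow> nat \<Rightarrow> 'a \<Rightarrow> real) \<Rightarrow> (nat \<Rightarrow> nat \<Rightarrow> 'a \<Rightarrow> real) \<Rightarrow> real \<Rightarrow> nat \<Rightarrow> ('a \<Rightarrow> real) set" where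
  "stopping_rules_from M S X s n =
     stopping_rules (space M) S X s \<inter> {\<tau>. AE \<omega> in M. arrival S s 2 n \<omega> \<le> \<tau> \<omega>}"

text \<open>
  From here on everything concerns place 2: \<open>W\<close> is the generic weight \<open>X\<^sub>2\<close>, and \<open>F\<close>, \<open>f\<close>,
  \<open>g\<close>, \<open>c'\<close> are the distribution function and density of the waiting times, the utility, and the
  derivative of the cost. \<open>c'\<close> is only known to be a derivative, hence possibly not Lebesgue
  integrable; the integral over \<open>{0..r}\<close> is the Henstock-Kurzweil integral, which always exists
  here and agrees with the Lebesgue integral whenever that exists.
\<close>

definition phi ::
  "'a measure \<Rightarrow> ('a \<Rightarrow> real) \<Rightarrow> (real \<Rightarrow> real) \<Rightarrow> (real \<Rightarrow> real) \<Rightarrow> (real \<Rightarrow> real) \<Rightarrow> (real \<Rightarrow> real) \<Rightarrow>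
   (real \<Rightarrow> real \<Rightarrow> real \<Rightarrow> real) \<Rightarrow> real \<Rightarrow> real \<Rightarrow> real \<Rightarrow> real \<Rightarrow> real" where
  "phi M W F f g c' \<delta> a b c r =
     (let \<alpha> = (\<lambda>z. f z / (1 - F z));
          \<Delta> = (\<lambda>a. \<integral>\<omega>. (g (a + W \<omega>) - g a) \<partial>M)
      in integral {0..r} (\<lambda>z. (1 - F z) *
           (\<alpha> z * (\<Delta> a + (\<integral>\<omega>. \<delta> (a + W \<omega>) (b + z) (c - z) \<partial>M)) - c' (b + z))))"

definition Phi ::
  "'a measure \<Rightarrow> ('a \<Rightarrow> real) \<Rightarrow> (real \<Rightarrow> real) \<Rightarrow> (real \<Rightarrow> real) \<Rightarrow> (real \<Rightarrow> real) \<Rightarrow> (real \<Rightarrow> real) \<Rightarrow>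
   (real \<Rightarrow> real \<Rightarrow> real \<Rightarrow> real) \<Rightarrow> real \<Rightarrow> real \<Rightarrow> real \<Rightarrow> real" where
  "Phi M W F f g c' \<delta> a b c = (SUP r\<in>{0..c}. phi M W F f g c' \<delta> a b c r)"

primrec y_iter ::
  "'a measure \<Rightarrow> ('a \<Rightarrow> real) \<Rightarrow> (real \<Rightarrow> real) \<Rightarrow> (real \<Rightarrow> real) \<Rightarrow> (real \<Rightarrow> real) \<Rightarrow> (real \<Rightarrow> real) \<Rightarrow>
   nat \<Rightarrow> real \<Rightarrow> real \<Rightarrow> real \<Rightarrow> real" where
  "y_iter M W F f g c' 0 = (\<lambda>a b c. 0)"
| "y_iter M W F f g c' (Suc j) = Phi M W F f g c' (y_iter M W F f g c' j)"

text \<open>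
  Maximisers need not be unique: if \<open>g\<close> and the cost are constant, every \<open>r \<in> {0..c}\<close> is one, and
  maximisers alternating with \<open>j\<close> between \<open>0\<close> and \<open>c\<close> lead to stopping times
  that do not converge. Ties are broken by taking the least maximiser. Meaningful for \<open>j \<ge> 1\<close>.
\<close>

definition r_star ::
  "'a measure \<Rightarrow> ('a \<Rightarrow> real) \<Rightarrow> (real \<Rightarrow> real) \<Rightarrow> (real \<Rightarrow> real) \<Rightarrow> (real \<Rightarrow> real) \<Rightarrow> (real \<Rightarrow> real) \<Rightarrow>
   nat \<Rightarrow> real \<Rightarrow> real \<Rightarrow> real \<Rightarrow> real" where
  "r_star M W F f g c' j a b c =
     (LEAST r. r \<in> {0..c} \<and>
        phi M W F f g c' (y_iter M W F f g c' (j - 1)) a b c r = y_iter M W F f g c' j a b c)"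

text \<open>
  \<open>a\<close> is a mass, \<open>b\<close> an elapsed time and \<open>c\<close> a remaining time. The formula for \<open>\<Phi>\<^sub>2\<close>
  evaluates \<open>c'\<close> and \<open>\<delta>\<close> at times up to \<open>b + c\<close>, so it makes sense only for \<open>b + c \<le> t0\<close>; this
  part of the box \<open>[0,\<infinity>) \<times> [0,t0] \<times> [0,t0]\<close> is mapped to itself by
  \<open>(a, b, c) \<mapsto> (a + W, b + z, c - z)\<close>, and only it is needed for \<open>b = t - s\<close>, \<open>c = t0 - t\<close>.
\<close>

definition states :: "real \<Rightarrow> (real \<times> real \<times> real) set" where
  "states t0 = {(a, b, c). 0 \<le> a \<and> 0 \<le> b \<and> 0 \<le> c \<and> b + c \<le> t0}"

definition B_space :: "real \<Rightarrow> (real \<Rightarrow> real \<Rightarrow> real \<Rightarrow> real) set" where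
  "B_space t0 = {\<delta>. continuous_on (states t0) (\<lambda>(a, b, c). \<delta> a b c) \<and>
     bounded ((\<lambda>(a, b, c). \<delta> a b c) ` states t0)}"

text \<open>The fixed point is unique on \<open>states t0\<close>; its values elsewhere are irrelevant.\<close>

definition y_fix ::
  "'a measure \<Rightarrow> ('a \<Rightarrow> real) \<Rightarrow> (real \<Rightarrow> real) \<Rightarrow> (real \<Rightarrow> real) \<Rightarrow> (real \<Rightarrow> real) \<Rightarrow> (real \<Rightarrow> real) \<Rightarrow>
   real \<Rightarrow> real \<Rightarrow> real \<Rightarrow> real \<Rightarrow> real" where
  "y_fix M W F f g c' t0 =
     (SOME \<delta>. \<delta> \<in> B_space t0 \<and> (\<forall>(a, b, c)\<in>states t0. \<delta> a b c = Phi M W F f g c' \<delta> a b c))"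

definition gamma ::
  "'a measure \<Rightarrow> (nat \<Rightarrow> nat \<Rightarrow> 'a \<Rightarrow> real) \<Rightarrow> (nat \<Rightarrow> real \<Rightarrow> real) \<Rightarrow> (real \<Rightarrow> real) \<Rightarrow>
   (nat \<Rightarrow> real \<Rightarrow> real) \<Rightarrow> (nat \<Rightarrow> real \<Rightarrow> real) \<Rightarrow> (nat \<Rightarrow> real \<Rightarrow> real) \<Rightarrow> (nat \<Rightarrow> real) \<Rightarrow> real \<Rightarrow>
   real \<Rightarrow> real \<Rightarrow> real \<Rightarrow> real \<Rightarrow> real" where
  "gamma M X F f2 g cost cost' C t0 s m m' t =
     of_bool (t \<le> t0) *
       (w2 g cost m s m' t + y_fix M (X 2 1) (F 2) f2 (g 2) (cost' 2) t0 (m' - m) (t - s) (t0 - t))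
     - (C 1 + C 2) * of_bool (t0 < t)"

text \<open>
  After the horizon the remaining time is negative and there is no maximiser; \<open>R_star\<close> is then \<open>0\<close>.
\<close>

definition R_star ::
  "'a measure \<Rightarrow> (nat \<Rightarrow> nat \<Rightarrow> 'a \<Rightarrow> real) \<Rightarrow> (nat \<Rightarrow> nat \<Rightarrow> 'a \<Rightarrow> real) \<Rightarrow> (nat \<Rightarrow> real \<Rightarrow> real) \<Rightarrow>
   (real \<Rightarrow> real) \<Rightarrow> (nat \<Rightarrow> real \<Rightarrow> real) \<Rightarrow> (nat \<Rightarrow> real \<Rightarrow> real) \<Rightarrow> real \<Rightarrow> real \<Rightarrow>
   nat \<Rightarrow> nat \<Rightarrow> 'a \<Rightarrow> real" where
  "R_star M S X F f2 g cost' t0 s K i \<omega> =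
     (let T = arrival S s 2 i \<omega> in
      if i < K \<and> T \<le> t0
      then r_star M (X 2 1) (F 2) f2 (g 2) (cost' 2) (K - i)
             (mass S X s T \<omega> - mass S X s s \<omega>) (T - s) (t0 - T)
      else 0)"

definition eta ::
  "'a measure \<Rightarrow> (nat \<Rightarrow> nat \<Rightarrow> 'a \<Rightarrow> real) \<Rightarrow> (nat \<Rightarrow> nat \<Rightarrow> 'a \<Rightarrow> real) \<Rightarrow> (nat \<Rightarrow> real \<Rightarrow> real) \<Rightarrow>
   (real \<Rightarrow> real) \<Rightarrow> (nat \<Rightarrow> real \<Rightarrow> real) \<Rightarrow> (nat \<Rightarrow> real \<Rightarrow> real) \<Rightarrow> real \<Rightarrow> real \<Rightarrow>
   nat \<Rightarrow> nat \<Rightarrow> 'a \<Rightarrow> nat" where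
  "eta M S X F f2 g cost' t0 s n K \<omega> =
     (let P = (\<lambda>i. n \<le> i \<and> R_star M S X F f2 g cost' t0 s K i \<omega> < S 2 (i + 1) \<omega>)
      in if \<exists>i. P i then min K (LEAST i. P i) else K)"

definition tau_star ::
  "'a measure \<Rightarrow> (nat \<Rightarrow> nat \<Rightarrow> 'a \<Rightarrow> real) \<Rightarrow> (nat \<Rightarrow> nat \<Rightarrow> 'a \<Rightarrow> real) \<Rightarrow> (nat \<Rightarrow> real \<Rightarrow> real) \<Rightarrow>
   (real \<Rightarrow> real) \<Rightarrow> (nat \<Rightarrow> real \<Rightarrow> real) \<Rightarrow> (nat \<Rightarrow> real \<Rightarrow> real) \<Rightarrow> real \<Rightarrow> real \<Rightarrow>
   nat \<Rightarrow> nat \<Rightarrow> 'a \<Rightarrow> real" where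
  "tau_star M S X F f2 g cost' t0 s n K \<omega> =
     (let i = eta M S X F f2 g cost' t0 s n K \<omega>
      in arrival S s 2 i \<omega> + R_star M S X F f2 g cost' t0 s K i \<omega>)"

end

theory Submission
  imports Defs
begin

text \<open>
  Integrating the cost term by parts turns \<open>phi\<close> into the expected gain of the rule ``wait at most
  \<open>r\<close> for the next catch'', a quantity jointly continuous in the state and in \<open>r\<close>. So \<open>Phi\<close> is a
  contraction of \<open>B_space t0\<close> and the iterates converge to the fixed point from below. Since the gain
  increments are then also smaller than those of the limit, the least maximisers converge.

  Between the \<open>k\<close>-th and the next catch nothing happens, so there a stopping time coincides with a
  random variable \<open>\<rho>\<close> that is measurable with respect to the first \<open>k\<close> catches. The next catch is
  independent of these, so integrating it out gives the expected gain of waiting until \<open>\<rho>\<close>, which is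
  at most the fixed point, with equality for the least maximiser. Telescoping over the catches bounds
  the value of every stopping rule and is an equality for the rule built from the least maximisers.
\<close>

subsection \<open>Integration by parts and maximisers\<close>

text \<open>Three obstacles shape the argument. The catch at which a rule stops depends
  discontinuously on the planned waits, so their convergence carries over to the stopping times only
  where no wait equals the next waiting time. The exceptional event is null because a wait is
  determined by the past and the waiting time has a density. Next, a stopping time may exceed
  \<open>t0\<close>, where the gain formulas say nothing; there the penalty \<open>C 1 + C 2\<close>
  is at least every possible cost and utilities are nonnegative, so stopping at \<open>t0\<close> is
  no worse. Finally, the sigma-field at the \<open>n\<close>-th catch also sees a further catch at
  the same moment, so its events are events of the first \<open>n\<close> catches only where waiting
  times are positive, which is almost surely. Conditioning on the past of later catches is done by
  product measures: all estimates are between integrals over events known at the \<open>n\<close>-th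
  catch, and conditional expectations appear only at the end. The telescoping needs no tail
  estimate, since on each trajectory only finitely many catches precede a finite stopping
  time.\<close>

text \<open>
  \<open>k'\<close> is only a derivative, so the product rule is not available almost everywhere. By the second mean
  value theorem the two sides differ over a short interval by at most the oscillation of \<open>k\<close> times
  the increment of \<open>F\<close>.
\<close>

lemma has_integral_mono_times_derivative:
  fixes F f k k' :: "real \<Rightarrow> real"
  assumes r: "0 \<le> r"
    and f: "f integrable_on {0..r}" "\<And>z. 0 \<le> f z"
    and F: "\<And>u v. 0 \<le> u \<Longrightarrow> u \<le> v \<Longrightarrow> v \<le> r \<Longrightarrow> F v - F u = integral {u..v} f"
    and k: "\<And>z. z \<in> {0..r} \<Longrightarrow> (k has_real_derivative k' z) (at z within {0..r})"
    and fk: "(\<lambda>z. f z * k z) integrable_on {0..r}"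
  shows "((\<lambda>z. F z * k' z) has_integral F r * k r - F 0 * k 0 - integral {0..r} (\<lambda>z. f z * k z)) {0..r}"
proof -
  have mono: "F u \<le> F v" if "0 \<le> u" "u \<le> v" "v \<le> r" for u v
    using F[OF that] integral_nonneg[OF integrable_subinterval_real[OF f(1)], of u v] f(2) that by auto
  have ftc: "(k' has_integral k v - k u) {u..v}" if "0 \<le> u" "u \<le> v" "v \<le> r" for u v
  proof (rule fundamental_theorem_of_calculus)
    show "(k has_vector_derivative k' x) (at x within {u..v})" if "x \<in> {u..v}" for x
      using DERIV_subset[OF k, of x "{u..v}"] that \<open>0 \<le> u\<close> \<open>v \<le> r\<close>
      by (auto simp: has_real_derivative_iff_has_vector_derivative)
  qed (use that in auto)
  have smv: "\<exists>w\<in>{u..v}. ((\<lambda>z. F z * k' z) has_integral F u * (k w - k u) + F v * (k v - k w)) {u..v}"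
    if uv: "0 \<le> u" "u \<le> v" "v \<le> r" for u v
  proof -
    have "k' integrable_on {u..v}" using ftc[OF uv] by blast
    then obtain w where w: "w \<in> {u..v}"
      and "((\<lambda>z. F z * k' z) has_integral F u * integral {u..w} k' + F v * integral {w..v} k') {u..v}"
      using mono uv by (rule_tac second_mean_value_theorem_full[of k' u v F]) auto
    moreover have "integral {u..w} k' = k w - k u" "integral {w..v} k' = k v - k w"
      using w uv ftc by (auto intro!: integral_unique)
    ultimately show ?thesis by auto
  qed
  have int: "(\<lambda>z. F z * k' z) integrable_on {0..r}"
    using smv[of 0 r] r by blast
  \<comment> \<open>\<open>E\<close> is the defect of the formula up to an additive constant; the
    claim is \<open>E r = E 0\<close>.\<close>
  define E where "E v = integral {0..v} (\<lambda>z. F z * k' z) - (F v * k v - integral {0..v} (\<lambda>z. f z * k z))" for v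
  have contk: "continuous_on {0..r} k"
    using k by (meson DERIV_continuous_on)
  have small: "\<bar>E r - E 0\<bar> \<le> 2 * e * (F r - F 0)" if e: "0 < e" for e
  proof -
    \<comment> \<open>The bound adds up over adjacent intervals, so bisection reduces it to short
      ones, on which \<open>k\<close> varies by at most \<open>e\<close> around \<open>k x\<close>.
      The factor 2 collects one \<open>e\<close> from the integral and one from the mean value point
      \<open>w\<close>.\<close>
    define P where "P u v \<longleftrightarrow> (0 \<le> u \<and> u \<le> v \<and> v \<le> r \<longrightarrow> \<bar>E v - E u\<bar> \<le> 2 * e * (F v - F u))" for u v
    have "P 0 r"
    proof (rule Bolzano[OF r])
      fix a b c
      assume "P a b" "P b c" "a \<le> b" "b \<le> c"
      then show "P a c" by (auto simp: P_def algebra_simps)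
    next
      fix x assume "0 \<le> x" "x \<le> r"
      then obtain d where d: "d > 0" "\<And>y. y \<in> {0..r} \<Longrightarrow> dist y x < d \<Longrightarrow> dist (k y) (k x) < e"
        using contk e unfolding continuous_on_iff by (metis atLeastAtMost_iff)
      show "\<exists>d>0. \<forall>u v. u \<le> x \<and> x \<le> v \<and> v - u < d \<longrightarrow> P u v"
        unfolding P_def
      proof (intro exI[of _ d] conjI allI impI d(1))
        fix u v assume *: "u \<le> x \<and> x \<le> v \<and> v - u < d" and **: "0 \<le> u \<and> u \<le> v \<and> v \<le> r"
        then have uv: "0 \<le> u" "u \<le> v" "v \<le> r" by auto
        have kd: "\<bar>k y - k x\<bar> \<le> e" if "y \<in> {u..v}" for y
          using d(2)[of y] that * ** by (force simp: dist_real_def)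
        obtain w where w: "w \<in> {u..v}"
          "((\<lambda>z. F z * k' z) has_integral F u * (k w - k u) + F v * (k v - k w)) {u..v}"
          using smv[OF uv] by auto
        have fi: "f integrable_on {u..v}" "(\<lambda>z. f z * k z) integrable_on {u..v}"
          using integrable_subinterval_real[OF f(1)] integrable_subinterval_real[OF fk] uv by auto
        have "E v - E u = integral {u..v} (\<lambda>z. F z * k' z) - (F v * k v - F u * k u) + integral {u..v} (\<lambda>z. f z * k z)"
          using Henstock_Kurzweil_Integration.integral_combine[of 0 u v "\<lambda>z. F z * k' z"] Henstock_Kurzweil_Integration.integral_combine[of 0 u v "\<lambda>z. f z * k z"]
            uv integrable_subinterval_real[OF int, of 0 v] integrable_subinterval_real[OF fk, of 0 v]
          by (auto simp: E_def)
        also have "\<dots> = integral {u..v} (\<lambda>z. f z * k z) - (F v - F u) * k w"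
          using integral_unique[OF w(2)] by (simp add: algebra_simps)
        also have "\<dots> = integral {u..v} (\<lambda>z. f z * (k z - k x)) - (F v - F u) * (k w - k x)"
          using fi F[OF uv] by (simp add: right_diff_distrib Henstock_Kurzweil_Integration.integral_diff
              algebra_simps integrable_on_mult_left)
        finally have eq: "E v - E u = \<dots>" .
        have "(\<lambda>z. f z * (k z - k x)) integrable_on {u..v}"
          using integrable_diff[OF fi(2) integrable_on_mult_left[OF fi(1), of "k x"]]
          by (simp add: right_diff_distrib)
        then have "norm (integral {u..v} (\<lambda>z. f z * (k z - k x))) \<le> integral {u..v} (\<lambda>z. f z * e)"
          using fi kd f(2) by (intro integral_norm_bound_integral)
            (auto simp: abs_mult intro!: integrable_on_mult_left mult_left_mono)
        also have "\<dots> = e * (F v - F u)" using F[OF uv] by simp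
        finally have 1: "\<bar>integral {u..v} (\<lambda>z. f z * (k z - k x))\<bar> \<le> e * (F v - F u)" by simp
        have 2: "\<bar>(F v - F u) * (k w - k x)\<bar> \<le> (F v - F u) * e"
          unfolding abs_mult using kd[OF w(1)] mono[OF uv] by (auto intro!: mult_left_mono)
        show "\<bar>E v - E u\<bar> \<le> 2 * e * (F v - F u)"
          unfolding eq using 1 2 by (auto simp: algebra_simps)
      qed
    qed
    then show ?thesis using r by (auto simp: P_def)
  qed
  have "E r = E 0"
  proof (rule ccontr)
    assume "E r \<noteq> E 0"
    then have p: "\<bar>E r - E 0\<bar> > 0" by simp
    show False
    proof (cases "F r = F 0")
      case True then show ?thesis using small[of 1] p by auto
    next
      case False
      then have "F r - F 0 > 0" using mono[of 0 r] r by auto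
      \<comment> \<open>With this \<open>e\<close> the bound is half of the quantity it
        bounds.\<close>
      then show ?thesis using small[of "\<bar>E r - E 0\<bar> / (4 * (F r - F 0))"] p by (auto simp: field_simps)
    qed
  qed
  then have "integral {0..r} (\<lambda>z. F z * k' z) = F r * k r - F 0 * k 0 - integral {0..r} (\<lambda>z. f z * k z)"
    by (simp add: E_def)
  then show ?thesis using int integrable_integral by metis
qed

text \<open>Compactness of \<open>K\<close> makes \<open>\<psi> (p, t)\<close> close to
  \<open>\<psi> (x, t)\<close> uniformly in \<open>t\<close> once \<open>p\<close> is near
  \<open>x\<close>, and a supremum moves by no more than the uniform distance.\<close>

lemma continuous_on_SUP_prod:
  fixes \<psi> :: "'a::topological_space \<times> 'b::topological_space \<Rightarrow> real"
  assumes c: "continuous_on (U \<times> K) \<psi>" and K: "compact K" "K \<noteq> {}"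
  shows "continuous_on U (\<lambda>p. SUP t\<in>K. \<psi> (p, t))"
  unfolding continuous_on_def
proof safe
  fix x assume x: "x \<in> U"
  have bdd: "bdd_above ((\<lambda>t. \<psi> (p, t)) ` K)" if "p \<in> U" for p
  proof -
    have "continuous_on K (\<lambda>t. \<psi> (p, t))"
      using that by (intro continuous_on_compose2[OF c]) (auto intro!: continuous_intros)
    then show ?thesis using K by (intro bounded_imp_bdd_above compact_imp_bounded compact_continuous_image)
  qed
  show "((\<lambda>p. SUP t\<in>K. \<psi> (p, t)) \<longlongrightarrow> (SUP t\<in>K. \<psi> (x, t))) (at x within U)"
  proof (rule tendstoI)
    fix e :: real assume e: "e > 0"
    obtain X where X: "x \<in> X" "open X" "\<forall>p\<in>X \<inter> U. \<forall>t\<in>K. dist (\<psi> (p, t)) (\<psi> (x, t)) \<le> e / 2"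
      using continuous_on_prod_compactE[OF c K(1) x, of "e/2"] e by auto
    have le: "(SUP t\<in>K. \<psi> (p, t)) \<le> (SUP t\<in>K. \<psi> (q, t)) + e / 2"
      if "p \<in> U" "q \<in> U" "\<And>t. t \<in> K \<Longrightarrow> \<psi> (p, t) \<le> \<psi> (q, t) + e / 2" for p q
    proof (rule cSUP_least[OF K(2)])
      fix t assume t: "t \<in> K"
      then have "\<psi> (q, t) \<le> (SUP t\<in>K. \<psi> (q, t))" by (intro cSUP_upper bdd that)
      then show "\<psi> (p, t) \<le> (SUP t\<in>K. \<psi> (q, t)) + e / 2" using that(3)[OF t] by linarith
    qed
    have "dist (SUP t\<in>K. \<psi> (p, t)) (SUP t\<in>K. \<psi> (x, t)) < e" if p: "p \<in> X \<inter> U" for p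
    proof -
      have *: "\<bar>\<psi> (p, t) - \<psi> (x, t)\<bar> \<le> e / 2" if "t \<in> K" for t
        using X(3) p that by (auto simp: dist_real_def)
      have "\<psi> (p, t) \<le> \<psi> (x, t) + e / 2" "\<psi> (x, t) \<le> \<psi> (p, t) + e / 2" if "t \<in> K" for t
        using *[OF that] by linarith+
      then show ?thesis using le[of p x] le[of x p] p x e by (auto simp: dist_real_def)
    qed
    then show "\<forall>\<^sub>F p in at x within U. dist (SUP t\<in>K. \<psi> (p, t)) (SUP t\<in>K. \<psi> (x, t)) < e"
      unfolding eventually_at_topological using X(1,2) by blast
  qed
qed

text \<open>The maximisers form a nonempty compact set, so \<open>LEAST\<close> selects one of them
  although the order on the reals is not a well-order. The strict inequality to its left is what
  distinguishes it from the other maximisers in the limit arguments.\<close>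

lemma least_argmax:
  fixes \<psi> :: "real \<Rightarrow> real"
  assumes \<psi>: "continuous_on {0..c} \<psi>" and c: "0 \<le> c"
  defines "r \<equiv> (LEAST r. r \<in> {0..c} \<and> \<psi> r = (SUP r\<in>{0..c}. \<psi> r))"
  shows "r \<in> {0..c}" "\<psi> r = (SUP r\<in>{0..c}. \<psi> r)"
    and "\<And>r'. r' \<in> {0..c} \<Longrightarrow> \<psi> r' \<le> \<psi> r"
    and "\<And>r'. 0 \<le> r' \<Longrightarrow> r' < r \<Longrightarrow> \<psi> r' < \<psi> r"
proof -
  have bdd: "bdd_above (\<psi> ` {0..c})"
    using \<psi> by (intro bounded_imp_bdd_above compact_imp_bounded compact_continuous_image) auto
  have le: "\<psi> x \<le> (SUP r\<in>{0..c}. \<psi> r)" if "x \<in> {0..c}" for x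
    using bdd that by (rule cSUP_upper2) auto
  obtain x where x: "x \<in> {0..c}" "\<And>y. y \<in> {0..c} \<Longrightarrow> \<psi> y \<le> \<psi> x"
    using continuous_attains_sup[OF compact_Icc _ \<psi>] c by auto
  have xs: "\<psi> x = (SUP r\<in>{0..c}. \<psi> r)"
    using x le c by (intro antisym le cSUP_least) auto
  let ?A = "{r \<in> {0..c}. \<psi> r = (SUP r\<in>{0..c}. \<psi> r)}"
  have "closed ?A" by (intro continuous_closed_preimage_constant \<psi>) auto
  then have "compact ?A"
    using compact_Icc[of 0 c] by (simp add: Int_def compact_eq_bounded_closed bounded_subset[OF bounded_closed_interval[of 0 c]] subset_eq)
  then obtain m where m: "m \<in> ?A" "\<And>y. y \<in> ?A \<Longrightarrow> m \<le> y"
    using compact_attains_inf[of ?A] x xs by blast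
  have r: "r = m" unfolding r_def using m by (intro Least_equality) auto
  show "r \<in> {0..c}" "\<psi> r = (SUP r\<in>{0..c}. \<psi> r)" using m r by auto
  then show max: "\<psi> r' \<le> \<psi> r" if "r' \<in> {0..c}" for r' using le that by auto
  show "\<psi> r' < \<psi> r" if r': "0 \<le> r'" "r' < r" for r'
  proof -
    have "r' \<in> {0..c}" using r' \<open>r \<in> {0..c}\<close> by auto
    moreover have "\<psi> r' \<noteq> \<psi> r" using m(2)[of r'] r r' \<open>r' \<in> {0..c}\<close> \<open>\<psi> r = _\<close> by auto
    ultimately show ?thesis using max[of r'] by auto
  qed
qed

text \<open>This expresses the sublevel sets of the least maximiser through two suprema, which
  depend continuously on parameters even when the maximiser does not. Measurability of the limiting
  rule rests on it.\<close>

lemma least_argmax_le_iff: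
  fixes \<psi> :: "real \<Rightarrow> real"
  assumes \<psi>: "continuous_on {0..c} \<psi>" and c: "0 \<le> c" and x: "0 \<le> x"
  shows "(LEAST r. r \<in> {0..c} \<and> \<psi> r = (SUP r\<in>{0..c}. \<psi> r)) \<le> x \<longleftrightarrow>
    (SUP r\<in>{0..c}. \<psi> r) \<le> (SUP r\<in>{0..min x c}. \<psi> r)"
    (is "?r \<le> x \<longleftrightarrow> ?s \<le> ?t")
proof -
  note * = least_argmax[OF \<psi> c]
  have c': "continuous_on {0..min x c} \<psi>" using \<psi> by (rule continuous_on_subset) auto
  note ** = least_argmax[OF c']
  have mc: "0 \<le> min x c" using x c by simp
  note ** = **[OF mc]
  let ?q = "LEAST r. r \<in> {0..min x c} \<and> \<psi> r = ?t"
  show ?thesis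
  proof
    assume "?r \<le> x"
    then show "?s \<le> ?t" using **(2) **(3)[of ?r] *(1,2) by auto
  next
    assume "?s \<le> ?t"
    then have "\<psi> ?r \<le> \<psi> ?q" using *(2) **(2) by simp
    then have "\<not> ?q < ?r" using *(4)[of ?q] **(1) unfolding atLeastAtMost_iff by linarith
    then show "?r \<le> x" using **(1) by auto
  qed
qed

text \<open>Uniform convergence alone could lead to a later one of several maximisers of
  \<open>\<psi>\<close>. By \<open>incr\<close>, a strict gain of \<open>\<psi>' j\<close> beyond
  the least maximiser of \<open>\<psi>\<close> would be a gain of \<open>\<psi>\<close> as well, so
  all approximate maximisers stay to its left. They cannot stay away from it either, because
  \<open>\<psi>\<close> is bounded away from its maximum on every \<open>{0..y}\<close> ending
  before it.\<close>

lemma least_argmax_tendsto: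
  fixes \<psi> :: "real \<Rightarrow> real" and \<psi>' :: "nat \<Rightarrow> real \<Rightarrow> real"
  assumes \<psi>: "continuous_on {0..c} \<psi>" and \<psi>': "\<And>j. continuous_on {0..c} (\<psi>' j)" and c: "0 \<le> c"
    and conv: "uniform_limit {0..c} \<psi>' \<psi> sequentially"
    and incr: "\<And>j u v. 0 \<le> u \<Longrightarrow> u \<le> v \<Longrightarrow> v \<le> c \<Longrightarrow> \<psi>' j v - \<psi>' j u \<le> \<psi> v - \<psi> u"
  shows "(\<lambda>j. LEAST r. r \<in> {0..c} \<and> \<psi>' j r = (SUP r\<in>{0..c}. \<psi>' j r)) \<longlonglongrightarrow>
    (LEAST r. r \<in> {0..c} \<and> \<psi> r = (SUP r\<in>{0..c}. \<psi> r))" (is "?r' \<longlonglongrightarrow> ?r")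
proof (rule order_tendstoI)
  note * = least_argmax[OF \<psi> c] and L = least_argmax[OF \<psi>' c]
  have le: "?r' j \<le> ?r" for j
  proof (rule ccontr)
    assume "\<not> ?r' j \<le> ?r"
    then have "?r < ?r' j" by simp
    then have "\<psi>' j ?r < \<psi>' j (?r' j)" using L(4)[of ?r j] *(1) by auto
    then show False using incr[of ?r "?r' j" j] *(1) *(3)[of "?r' j"] L(1)[of j] \<open>?r < ?r' j\<close> by auto
  qed
  show "\<forall>\<^sub>F j in sequentially. ?r' j < y" if "?r < y" for y
    using le le_less_trans that by (auto intro!: always_eventually)
  fix y assume y: "y < ?r"
  show "\<forall>\<^sub>F j in sequentially. y < ?r' j"
  proof (cases "0 \<le> y")
    case False
    then show ?thesis using L(1) by (intro always_eventually allI) (force intro: less_le_trans[of y 0])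
  next
    case True
    have "continuous_on {0..y} \<psi>" using \<psi> by (rule continuous_on_subset) (use y *(1) in auto)
    then obtain x where x: "x \<in> {0..y}" "\<And>z. z \<in> {0..y} \<Longrightarrow> \<psi> z \<le> \<psi> x"
      using continuous_attains_sup[OF compact_Icc, of 0 y \<psi>] True by auto
    have lt: "\<psi> x < \<psi> ?r" using *(4)[of x] x y by auto
    \<comment> \<open>Errors below half of the gap in both compared values cannot reverse their
      order.\<close>
    have "\<forall>\<^sub>F j in sequentially. \<forall>z\<in>{0..c}. dist (\<psi>' j z) (\<psi> z) < (\<psi> ?r - \<psi> x) / 2"
      using lt by (intro uniform_limitD[OF conv]) auto
    then show ?thesis
    proof eventually_elim
      case (elim j)
      show "y < ?r' j"
      proof (rule ccontr)
        assume "\<not> y < ?r' j"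
        then have i: "?r' j \<in> {0..y}" using L(1)[of j] by auto
        have "\<psi>' j (?r' j) < \<psi> (?r' j) + (\<psi> ?r - \<psi> x) / 2"
          using elim[THEN bspec, OF L(1)[of j]] unfolding dist_real_def by linarith
        also have "\<dots> \<le> \<psi> x + (\<psi> ?r - \<psi> x) / 2" using x(2)[OF i] by simp
        also have "\<dots> = \<psi> ?r - (\<psi> ?r - \<psi> x) / 2" by (simp add: field_simps)
        also have "\<dots> < \<psi>' j ?r" using elim[THEN bspec, OF *(1)] unfolding dist_real_def by linarith
        also have "\<dots> \<le> \<psi>' j (?r' j)" using L(3)[of ?r j] *(1) by auto
        finally show False by simp
      qed
    qed
  qed
qed

subsection \<open>The expected gain from waiting for one catch\<close>

text \<open>Fubini for an independent pair. Independence is required on rectangles only, which lets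
  \<open>X\<close> be the identity into a smaller sigma-field; this is how the past of the catches
  is frozen later.\<close>

lemma (in prob_space) expectation_indep_pair:
  fixes h :: "'b \<times> 'c \<Rightarrow> real"
  assumes X[measurable]: "X \<in> measurable M N1" and Y[measurable]: "Y \<in> measurable M N2"
    and ind: "\<And>A B. A \<in> sets N1 \<Longrightarrow> B \<in> sets N2 \<Longrightarrow>
      prob ((X -` A \<inter> space M) \<inter> (Y -` B \<inter> space M)) = prob (X -` A \<inter> space M) * prob (Y -` B \<inter> space M)"
    and h[measurable]: "h \<in> borel_measurable (N1 \<Otimes>\<^sub>M N2)"
    and bound: "\<And>x y. x \<in> space N1 \<Longrightarrow> y \<in> space N2 \<Longrightarrow> \<bar>h (x, y)\<bar> \<le> B"
  shows "(\<integral>\<omega>. h (X \<omega>, Y \<omega>) \<partial>M) = (\<integral>\<omega>. (\<integral>\<omega>'. h (X \<omega>, Y \<omega>') \<partial>M) \<partial>M)"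
    and "(\<lambda>x. \<integral>\<omega>'. h (x, Y \<omega>') \<partial>M) \<in> borel_measurable N1"
proof -
  interpret D1: prob_space "distr M N1 X" by (rule prob_space_distr) fact
  interpret D2: prob_space "distr M N2 Y" by (rule prob_space_distr) fact
  interpret D: pair_prob_space "distr M N1 X" "distr M N2 Y" ..
  have eq: "distr M N1 X \<Otimes>\<^sub>M distr M N2 Y = distr M (N1 \<Otimes>\<^sub>M N2) (\<lambda>x. (X x, Y x))"
  proof (rule pair_measure_eqI)
    fix A B assume "A \<in> sets (distr M N1 X)" "B \<in> sets (distr M N2 Y)"
    then have [measurable]: "A \<in> sets N1" "B \<in> sets N2" by auto
    have "(\<lambda>x. (X x, Y x)) -` (A \<times> B) \<inter> space M = (X -` A \<inter> space M) \<inter> (Y -` B \<inter> space M)" by auto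
    then show "emeasure (distr M N1 X) A * emeasure (distr M N2 Y) B =
        emeasure (distr M (N1 \<Otimes>\<^sub>M N2) (\<lambda>x. (X x, Y x))) (A \<times> B)"
      using ind[of A B] by (simp add: emeasure_distr emeasure_eq_measure flip: ennreal_mult)
  qed (auto simp: D1.sigma_finite_measure_axioms D2.sigma_finite_measure_axioms cong: sets_pair_measure_cong)
  have int: "integrable (distr M N1 X \<Otimes>\<^sub>M distr M N2 Y) h"
    by (rule D.P.integrable_const_bound[of _ B]) (auto simp: space_pair_measure bound intro!: AE_I2)
  have inner: "(\<integral>y. h (x, y) \<partial>distr M N2 Y) = (\<integral>\<omega>'. h (x, Y \<omega>') \<partial>M)" if "x \<in> space N1" for x
    using that by (intro integral_distr) auto
  have "(\<lambda>x. \<integral>y. h (x, y) \<partial>distr M N2 Y) \<in> borel_measurable N1"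
    by measurable
  then show meas: "(\<lambda>x. \<integral>\<omega>'. h (x, Y \<omega>') \<partial>M) \<in> borel_measurable N1"
    by (subst (asm) measurable_cong[OF inner]) auto
  have "(\<integral>\<omega>. h (X \<omega>, Y \<omega>) \<partial>M) = integral\<^sup>L (distr M (N1 \<Otimes>\<^sub>M N2) (\<lambda>x. (X x, Y x))) h"
    by (subst integral_distr) auto
  also have "\<dots> = (\<integral>x. (\<integral>y. h (x, y) \<partial>distr M N2 Y) \<partial>distr M N1 X)"
    unfolding eq[symmetric] by (rule D.integral_fst'[symmetric, OF int])
  also have "\<dots> = (\<integral>x. (\<integral>\<omega>'. h (x, Y \<omega>') \<partial>M) \<partial>distr M N1 X)"
    by (intro Bochner_Integration.integral_cong refl inner) simp
  also have "\<dots> = (\<integral>\<omega>. (\<integral>\<omega>'. h (X \<omega>, Y \<omega>') \<partial>M) \<partial>M)"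
    using meas by (intro integral_distr) auto
  finally show "(\<integral>\<omega>. h (X \<omega>, Y \<omega>) \<partial>M) = \<dots>" .
qed

definition bounded_continuous3 :: "(real \<Rightarrow> real \<Rightarrow> real \<Rightarrow> real) \<Rightarrow> bool" where
  "bounded_continuous3 \<delta> \<longleftrightarrow>
     continuous_on UNIV (\<lambda>(a, b, c). \<delta> a b c) \<and> (\<exists>B. \<forall>a b c. \<bar>\<delta> a b c\<bar> \<le> B)"

lemma bounded_continuous3_measurable [measurable (raw)]:
  assumes "bounded_continuous3 \<delta>" "u \<in> borel_measurable N" "v \<in> borel_measurable N" "w \<in> borel_measurable N"
  shows "(\<lambda>x. \<delta> (u x) (v x) (w x)) \<in> borel_measurable N"
proof -
  have "(\<lambda>(a, b, c). \<delta> a b c) \<in> borel_measurable borel"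
    using assms(1) by (intro borel_measurable_continuous_onI) (auto simp: bounded_continuous3_def)
  moreover have "(\<lambda>x. (u x, v x, w x)) \<in> borel_measurable N"
    using assms by (intro borel_measurable_Pair)
  ultimately have "(\<lambda>x. (\<lambda>(a, b, c). \<delta> a b c) (u x, v x, w x)) \<in> borel_measurable N"
    by (rule measurable_compose[rotated])
  then show ?thesis by simp
qed

lemma bounded_continuous3_tendsto:
  assumes "bounded_continuous3 \<delta>" "(u \<longlongrightarrow> a) F" "(v \<longlongrightarrow> b) F" "(w \<longlongrightarrow> c) F"
  shows "((\<lambda>x. \<delta> (u x) (v x) (w x)) \<longlongrightarrow> \<delta> a b c) F"
proof -
  have "isCont (\<lambda>(a, b, c). \<delta> a b c) (a, b, c)"
    using assms(1) by (auto simp: bounded_continuous3_def continuous_on_eq_continuous_at)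
  then have "((\<lambda>x. (\<lambda>(a, b, c). \<delta> a b c) (u x, v x, w x)) \<longlongrightarrow> (\<lambda>(a, b, c). \<delta> a b c) (a, b, c)) F"
    by (rule isCont_tendsto_compose) (intro tendsto_intros assms)
  then show ?thesis by simp
qed

text \<open>The operator \<open>Phi\<close> depends on one waiting time and one weight only, so it
  is analysed apart from the sequence of catches.\<close>

locale single_catch = prob_space M for M :: "'a measure" +
  fixes W S :: "'a \<Rightarrow> real" and f F g k k' :: "real \<Rightarrow> real" and t0 :: real
  assumes f_nonneg: "\<And>x. 0 \<le> f x"
    and S_density: "distributed M lborel S (\<lambda>x. ennreal (f x))"
    and S_nonneg: "\<And>\<omega>. \<omega> \<in> space M \<Longrightarrow> 0 \<le> S \<omega>"
    and W_nonneg: "\<And>\<omega>. \<omega> \<in> space M \<Longrightarrow> 0 \<le> W \<omega>"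
    and S_W_indep: "indep_var borel S borel W"
    and F_cdf: "cdf (distr M borel S) = F"
    and F_lt_1: "F t0 < 1"
    and t0_nonneg: "0 \<le> t0"
    and g_cont: "continuous_on {0..} g"
    and g_bounded: "bounded (g ` {0..})"
    and k_deriv: "\<And>t. t \<in> {0..t0} \<Longrightarrow> (k has_real_derivative k' t) (at t within {0..t0})"
begin

lemma S_meas[measurable]: "S \<in> borel_measurable M" and W_meas[measurable]: "W \<in> borel_measurable M"
  using S_W_indep unfolding indep_var_distribution_eq by auto

lemma f_meas[measurable]: "f \<in> borel_measurable borel"
  using distributed_real_measurable[OF _ S_density] f_nonneg by auto

text \<open>Retractions onto the domains extend all functions continuously, hence measurably.\<close>

definition g_ext :: "real \<Rightarrow> real" where "g_ext x = g (max 0 x)"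
definition k_ext :: "real \<Rightarrow> real" where "k_ext t = k (max 0 (min t0 t))"
definition state_ext :: "(real \<Rightarrow> real \<Rightarrow> real \<Rightarrow> real) \<Rightarrow> real \<Rightarrow> real \<Rightarrow> real \<Rightarrow> real" where
  "state_ext \<delta> a b c = \<delta> (max 0 a) (max 0 (min t0 b)) (max 0 (min (t0 - max 0 (min t0 b)) c))"

lemma g_ext_eq: "0 \<le> x \<Longrightarrow> g_ext x = g x" by (simp add: g_ext_def)
lemma k_ext_eq: "0 \<le> t \<Longrightarrow> t \<le> t0 \<Longrightarrow> k_ext t = k t" by (simp add: k_ext_def)
lemma state_ext_eq: "(a, b, c) \<in> states t0 \<Longrightarrow> state_ext \<delta> a b c = \<delta> a b c"
proof -
  assume "(a, b, c) \<in> states t0"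
  then have abc: "0 \<le> a" "0 \<le> b" "0 \<le> c" "b \<le> t0" "c \<le> t0 - b"
    unfolding states_def mem_Collect_eq prod.case by linarith+
  show ?thesis
    unfolding state_ext_def abc[THEN max_absorb2] abc[THEN min_absorb2] ..
qed

lemma continuous_g_ext: "continuous_on UNIV g_ext"
  unfolding g_ext_def by (rule continuous_on_compose2[OF g_cont]) (auto intro!: continuous_intros)

lemma continuous_k: "continuous_on {0..t0} k"
  using k_deriv by (rule DERIV_continuous_on)

lemma continuous_k_ext: "continuous_on UNIV k_ext"
  unfolding k_ext_def using t0_nonneg
  by (intro continuous_on_compose2[OF continuous_k]) (auto intro!: continuous_intros)

lemma g_ext_meas[measurable]: "g_ext \<in> borel_measurable borel"
  and k_ext_meas[measurable]: "k_ext \<in> borel_measurable borel"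
  using continuous_g_ext continuous_k_ext by (auto intro: borel_measurable_continuous_onI)

lemma g_ext_bound: "\<exists>B. \<forall>x. \<bar>g_ext x\<bar> \<le> B"
  using g_bounded by (fastforce simp: bounded_iff g_ext_def)

lemma k_ext_bound: "\<exists>B. \<forall>x. \<bar>k_ext x\<bar> \<le> B"
proof -
  have "bounded (k ` {0..t0})"
    by (intro compact_imp_bounded compact_continuous_image continuous_k) auto
  then show ?thesis using t0_nonneg by (fastforce simp: bounded_iff k_ext_def)
qed

lemma bounded_continuous3_state_ext:
  assumes "\<delta> \<in> B_space t0" shows "bounded_continuous3 (state_ext \<delta>)"
proof -
  \<comment> \<open>The third coordinate is clamped against the already clamped second one; clamping
    each to \<open>{0..t0}\<close> separately could violate \<open>b + c \<le> t0\<close>.\<close>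
  let ?r = "\<lambda>(a :: real, b :: real, c :: real). (max 0 a, max 0 (min t0 b), max 0 (min (t0 - max 0 (min t0 b)) c))"
  have r: "?r p \<in> states t0" for p
    using t0_nonneg by (cases p) (auto simp: states_def max_def min_def)
  have eq: "(\<lambda>(a, b, c). state_ext \<delta> a b c) = (\<lambda>p. (\<lambda>(a, b, c). \<delta> a b c) (?r p))"
    by (auto simp: state_ext_def)
  have cr: "continuous_on UNIV ?r"
    unfolding case_prod_beta by (intro continuous_intros)
  have c\<delta>: "continuous_on (states t0) (\<lambda>(a, b, c). \<delta> a b c)" and
    "bounded ((\<lambda>(a, b, c). \<delta> a b c) ` states t0)" using assms by (auto simp: B_space_def)
  then obtain B where B: "\<And>p. p \<in> states t0 \<Longrightarrow> \<bar>(\<lambda>(a, b, c). \<delta> a b c) p\<bar> \<le> B"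
    unfolding bounded_iff by force
  have "continuous_on UNIV (\<lambda>(a, b, c). state_ext \<delta> a b c)"
    unfolding eq by (rule continuous_on_compose2[OF c\<delta> cr]) (use r in blast)
  moreover have "\<bar>state_ext \<delta> a b c\<bar> \<le> B" for a b c
    using B[OF r[of "(a, b, c)"]] unfolding state_ext_def prod.case .
  ultimately show ?thesis unfolding bounded_continuous3_def by (intro conjI exI[of _ B] allI)
qed

text \<open>The change relative to stopping at once when waiting at most \<open>r\<close>: if the
  catch comes at \<open>x \<le> r\<close>, its utility, the continuation value
  \<open>\<delta>\<close> and the cost up to \<open>x\<close>; otherwise only the cost of the wait.
  Neither the density nor the derivative of the cost occurs.\<close>

definition gain :: "(real \<Rightarrow> real \<Rightarrow> real \<Rightarrow> real) \<Rightarrow> real \<Rightarrow> real \<Rightarrow> real \<Rightarrow> real \<Rightarrow> real \<times> real \<Rightarrow> real" where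
  "gain \<delta> a b c r = (\<lambda>(x, w). if x \<le> r
     then g_ext (a + w) - g_ext a + \<delta> (a + w) (b + x) (c - x) - (k_ext (b + x) - k_ext b)
     else - (k_ext (b + r) - k_ext b))"

definition mean_gain :: "(real \<Rightarrow> real \<Rightarrow> real \<Rightarrow> real) \<Rightarrow> real \<Rightarrow> real \<Rightarrow> real \<Rightarrow> real \<Rightarrow> real" where
  "mean_gain \<delta> a b c r = (\<integral>\<omega>. gain \<delta> a b c r (S \<omega>, W \<omega>) \<partial>M)"

lemma gain_meas[measurable (raw)]:
  assumes [measurable]: "bounded_continuous3 \<delta>"
    "a \<in> borel_measurable N" "b \<in> borel_measurable N" "c \<in> borel_measurable N" "r \<in> borel_measurable N"
    "x \<in> borel_measurable N" "w \<in> borel_measurable N"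
  shows "(\<lambda>z. gain \<delta> (a z) (b z) (c z) (r z) (x z, w z)) \<in> borel_measurable N"
  unfolding gain_def using assms(1) by measurable

lemma gain_bound:
  assumes "bounded_continuous3 \<delta>" shows "\<exists>B. \<forall>a b c r p. \<bar>gain \<delta> a b c r p\<bar> \<le> B"
proof -
  obtain B1 where B1: "\<bar>g_ext x\<bar> \<le> B1" for x using g_ext_bound by auto
  obtain B2 where B2: "\<bar>k_ext x\<bar> \<le> B2" for x using k_ext_bound by auto
  obtain B3 where B3: "\<bar>\<delta> a b c\<bar> \<le> B3" for a b c using assms by (auto simp: bounded_continuous3_def)
  have "\<bar>gain \<delta> a b c r p\<bar> \<le> 2 * B1 + B3 + 2 * B2" for a b c r p
  proof (cases p)
    case (Pair x w)
    have "0 \<le> B1" "0 \<le> B3" using B1[of 0] B3[of 0 0 0] by (auto intro: order_trans[OF abs_ge_zero])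
    then show ?thesis
      using B1[of "a + w"] B1[of a] B2[of "b + x"] B2[of b] B2[of "b + r"] B3[of "a + w" "b + x" "c - x"]
      unfolding gain_def Pair abs_le_iff by (cases "x \<le> r") simp_all
  qed
  then show ?thesis by blast
qed

lemma integrable_gain:
  assumes "bounded_continuous3 \<delta>" shows "integrable M (\<lambda>\<omega>. gain \<delta> a b c r (S \<omega>, W \<omega>))"
proof -
  obtain B where "\<And>p. \<bar>gain \<delta> a b c r p\<bar> \<le> B" using gain_bound[OF assms] by blast
  then show ?thesis by (intro integrable_const_bound[of _ B]) (use assms in auto)
qed

section \<open>The law of a waiting time and its density\<close>

lemma cdf_eq: "F x = prob {\<omega> \<in> space M. S \<omega> \<le> x}"
proof -
  have "F x = measure (distr M borel S) {..x}" unfolding F_cdf[symmetric] cdf_def2 ..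
  also have "\<dots> = prob (S -` {..x} \<inter> space M)" by (rule measure_distr) auto
  also have "S -` {..x} \<inter> space M = {\<omega> \<in> space M. S \<omega> \<le> x}" by auto
  finally show ?thesis .
qed

lemma F_mono: "x \<le> y \<Longrightarrow> F x \<le> F y"
  unfolding cdf_eq by (rule finite_measure_mono) auto

lemma F_nonneg: "0 \<le> F x" unfolding cdf_eq by simp

lemma AE_S_neq: "AE \<omega> in M. S \<omega> \<noteq> x"
proof (rule AE_I)
  show "{\<omega> \<in> space M. \<not> S \<omega> \<noteq> x} \<subseteq> S -` {x} \<inter> space M" by auto
  show "emeasure M (S -` {x} \<inter> space M) = 0"
    by (subst distributed_emeasure[OF S_density]) (auto simp: nn_integral_indicator_singleton)
qed auto

lemma AE_S_pos: "AE \<omega> in M. 0 < S \<omega>"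
  using AE_S_neq[of 0] AE_space by eventually_elim (use S_nonneg in force)

lemma F_0: "F 0 = 0"
proof -
  have "AE \<omega> in M. \<not> S \<omega> \<le> 0" using AE_S_pos by eventually_elim auto
  then show ?thesis unfolding cdf_eq by (subst prob_eq_0) auto
qed

lemma density_integral:
  fixes A :: "real \<Rightarrow> real"
  assumes [measurable]: "A \<in> borel_measurable borel" and B: "\<And>x. \<bar>A x\<bar> \<le> B"
  shows "(\<lambda>x. f x * A x) integrable_on {u..v}"
    and "integral {u..v} (\<lambda>x. f x * A x) = (\<integral>\<omega>. indicator {u..v} (S \<omega>) * A (S \<omega>) \<partial>M)"
proof -
  let ?h = "\<lambda>x. indicator {u..v} x * A x"
  have "0 \<le> B" using B[of 0] by simp
  have "integrable M (\<lambda>\<omega>. ?h (S \<omega>))"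
    by (rule integrable_const_bound[of _ B]) (auto simp: indicator_def B \<open>0 \<le> B\<close> intro!: AE_I2)
  then have "integrable lborel (\<lambda>x. f x * ?h x)"
    by (subst distributed_integrable[OF S_density]) (auto simp: f_nonneg)
  then have "set_integrable lborel {u..v} (\<lambda>x. f x * A x)"
    by (simp add: set_integrable_def mult_ac)
  note * = set_borel_integral_eq_integral[OF this]
  show "(\<lambda>x. f x * A x) integrable_on {u..v}" by (rule *(1))
  have "integral {u..v} (\<lambda>x. f x * A x) = (\<integral>x. f x * ?h x \<partial>lborel)"
    unfolding *(2)[symmetric] by (simp add: set_lebesgue_integral_def mult_ac)
  also have "\<dots> = (\<integral>\<omega>. ?h (S \<omega>) \<partial>M)"
    by (rule distributed_integral[OF S_density]) (auto simp: f_nonneg)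
  finally show "integral {u..v} (\<lambda>x. f x * A x) = \<dots>" .
qed

lemma F_diff:
  assumes "0 \<le> u" "u \<le> v" shows "F v - F u = integral {u..v} f"
proof -
  have "integral {u..v} (\<lambda>x. f x * 1) = (\<integral>\<omega>. indicator {u..v} (S \<omega>) * 1 \<partial>M)"
    by (rule density_integral[of _ 1]) auto
  also have "\<dots> = (\<integral>\<omega>. indicator {\<omega>\<in>space M. S \<omega> \<le> v} \<omega> - indicator {\<omega>\<in>space M. S \<omega> \<le> u} \<omega> \<partial>M)"
    using AE_S_neq[of u] by (intro integral_cong_AE) (auto simp: indicator_def assms intro: order_trans[OF _ assms(2)])
  also have "\<dots> = F v - F u" unfolding cdf_eq
    by (subst Bochner_Integration.integral_diff) (auto simp: less_top[symmetric])
  finally show ?thesis by simp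
qed

text \<open>The factor \<open>1 - F z\<close> turns the hazard rate into the density
  \<open>f z\<close>, and integrating \<open>F z * k' (b + z)\<close> by parts removes the
  derivative of the cost. What remains are integrals against \<open>f\<close>, hence expectations in
  \<open>S\<close>; averaging over the independent weight inside them gives
  \<open>mean_gain\<close>.\<close>

lemma phi_eq:
  assumes \<delta>: "\<delta> \<in> B_space t0" and st: "(a, b, c) \<in> states t0" and r: "0 \<le> r" "r \<le> c"
  shows "phi M W F f g k' \<delta> a b c r = mean_gain (state_ext \<delta>) a b c r"
proof -
  have abc: "0 \<le> a" "0 \<le> b" "0 \<le> c" "b + c \<le> t0" using st by (auto simp: states_def)
  let ?\<delta> = "state_ext \<delta>"
  note [measurable] = bounded_continuous3_measurable[OF bounded_continuous3_state_ext[OF \<delta>]]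
  obtain B1 where B1: "\<bar>g_ext x\<bar> \<le> B1" for x using g_ext_bound by auto
  obtain B2 where B2: "\<bar>k_ext x\<bar> \<le> B2" for x using k_ext_bound by auto
  obtain B3 where B3: "\<bar>?\<delta> a b c\<bar> \<le> B3" for a b c
    using bounded_continuous3_state_ext[OF \<delta>] by (auto simp: bounded_continuous3_def)
  have igd: "integrable M (\<lambda>\<omega>. g_ext (a + W \<omega>))"
    by (rule integrable_const_bound[of _ B1]) (auto simp: B1)
  have id: "integrable M (\<lambda>\<omega>. ?\<delta> (a + W \<omega>) y z)" for y z
    by (rule integrable_const_bound[of _ B3]) (auto simp: B3)
  define D where "D = (\<integral>\<omega>. (g_ext (a + W \<omega>) - g_ext a) \<partial>M)"
  define A where "A z = D + (\<integral>\<omega>. ?\<delta> (a + W \<omega>) (b + z) (c - z) \<partial>M)" for z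
  have A_meas[measurable]: "A \<in> borel_measurable borel"
    unfolding A_def by measurable
  have A_bound: "\<bar>A z\<bar> \<le> \<bar>D\<bar> + B3" for z
  proof -
    have "norm (\<integral>\<omega>. ?\<delta> (a + W \<omega>) (b + z) (c - z) \<partial>M) \<le> (\<integral>\<omega>. norm (?\<delta> (a + W \<omega>) (b + z) (c - z)) \<partial>M)"
      by (rule integral_norm_bound)
    also have "\<dots> \<le> (\<integral>\<omega>. B3 \<partial>M)" by (intro integral_mono integrable_norm id) (auto simp: B3)
    finally show ?thesis by (auto simp: A_def prob_space)
  qed
  let ?K = "\<lambda>z. k_ext (b + z)"
  have K_meas: "?K \<in> borel_measurable borel" by measurable
  note iA = density_integral[OF A_meas A_bound, of 0 r] and iK = density_integral[OF K_meas B2, of 0 r]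
  have K_deriv: "(?K has_real_derivative k' (b + z)) (at z within {0..r})" if z: "z \<in> {0..r}" for z
    proof -
      have "((\<lambda>z. k (b + z)) has_real_derivative k' (b + z)) (at z within {0..r})"
        using DERIV_subset[OF k_deriv[of "b + z"], of "(+) b ` {0..r}"] z r abc
        by (subst DERIV_at_within_shift[symmetric]) auto
      then show ?thesis
        by (rule has_field_derivative_transform_within[OF _ zero_less_one z]) (use r abc in \<open>auto simp: k_ext_eq\<close>)
    qed
  have "((\<lambda>z. F z * k' (b + z)) has_integral
      F r * ?K r - F 0 * ?K 0 - integral {0..r} (\<lambda>z. f z * ?K z)) {0..r}"
  proof (rule has_integral_mono_times_derivative)
    show "f integrable_on {0..r}" using density_integral(1)[of "\<lambda>_. 1" 1 0 r] by simp
  qed (use r iK F_diff f_nonneg K_deriv in auto)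
  moreover have "((\<lambda>z. k' (b + z)) has_integral ?K r - ?K 0) {0..r}"
  proof (rule fundamental_theorem_of_calculus[OF r(1)])
    show "(?K has_vector_derivative k' (b + z)) (at z within {0..r})" if z: "z \<in> {0..r}" for z
      using K_deriv[OF z] by (simp add: has_real_derivative_iff_has_vector_derivative)
  qed
  moreover have "((\<lambda>z. f z * A z) has_integral integral {0..r} (\<lambda>z. f z * A z)) {0..r}"
    using iA(1) by (rule integrable_integral)
  ultimately have hi: "((\<lambda>z. f z * A z - k' (b + z) + F z * k' (b + z)) has_integral
      (integral {0..r} (\<lambda>z. f z * A z) - (?K r - ?K 0) +
      (F r * ?K r - F 0 * ?K 0 - integral {0..r} (\<lambda>z. f z * ?K z)))) {0..r}"
    by (intro has_integral_add has_integral_diff)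
  have pw: "(1 - F z) * (f z / (1 - F z) * ((\<integral>\<omega>. (g (a + W \<omega>) - g a) \<partial>M) +
      (\<integral>\<omega>. \<delta> (a + W \<omega>) (b + z) (c - z) \<partial>M)) - k' (b + z)) = f z * A z - k' (b + z) + F z * k' (b + z)"
    if z: "z \<in> {0..r}" for z
  proof -
    have "(\<integral>\<omega>. (g (a + W \<omega>) - g a) \<partial>M) = D" unfolding D_def using abc W_nonneg
      by (intro Bochner_Integration.integral_cong) (auto simp: g_ext_eq)
    moreover have "(\<integral>\<omega>. \<delta> (a + W \<omega>) (b + z) (c - z) \<partial>M) = (\<integral>\<omega>. ?\<delta> (a + W \<omega>) (b + z) (c - z) \<partial>M)"
      using abc W_nonneg z r
      by (intro Bochner_Integration.integral_cong refl state_ext_eq[symmetric]) (auto simp: states_def)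
    \<comment> \<open>The hazard rate is a genuine quotient here: \<open>z \<le> c \<le> t0\<close>
      keeps \<open>F z\<close> below 1.\<close>
    moreover have "F z < 1" using F_mono[of z t0] F_lt_1 z r abc by auto
    moreover have "(1 - F z) * (f z / (1 - F z) * x - y) = f z * x - y + F z * y" if "F z < 1" for x y
    proof -
      have e: "(1 - F z) * (f z / (1 - F z)) = f z" using that by simp
      have "(1 - F z) * (f z / (1 - F z) * x - y) = ((1 - F z) * (f z / (1 - F z))) * x - (1 - F z) * y"
        by (simp only: right_diff_distrib mult.assoc)
      then show ?thesis unfolding e by (simp add: left_diff_distrib)
    qed
    ultimately show ?thesis by (simp only: A_def)
  qed
  have "phi M W F f g k' \<delta> a b c r = integral {0..r} (\<lambda>z. f z * A z - k' (b + z) + F z * k' (b + z))"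
    unfolding phi_def Let_def by (intro Henstock_Kurzweil_Integration.integral_cong pw)
  also have "\<dots> = integral {0..r} (\<lambda>z. f z * A z) - integral {0..r} (\<lambda>z. f z * ?K z) + ?K 0 * F r
     - (?K r - ?K 0) * (1 - F r)"
    using integral_unique[OF hi] by (simp add: F_0 algebra_simps)
  also have "\<dots> = (\<integral>\<omega>. indicator {0..r} (S \<omega>) * A (S \<omega>) \<partial>M) - (\<integral>\<omega>. indicator {0..r} (S \<omega>) * ?K (S \<omega>) \<partial>M)
     + ?K 0 * (\<integral>\<omega>. indicator {0..r} (S \<omega>) \<partial>M) - (?K r - ?K 0) * (\<integral>\<omega>. 1 - indicator {0..r} (S \<omega>) \<partial>M)"
  proof -
    have "(\<integral>\<omega>. indicator {0..r} (S \<omega>) \<partial>M) = F r"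
      using density_integral(2)[of "\<lambda>_. 1" 1 0 r] F_diff[of 0 r] r F_0 by simp
    moreover have "integrable M (\<lambda>\<omega>. indicator {0..r} (S \<omega>) :: real)"
      by (rule integrable_const_bound[of _ 1]) auto
    ultimately show ?thesis unfolding iA(2) iK(2) by (simp add: prob_space)
  qed
  also have "\<dots> = (\<integral>\<omega>. (indicator {0..r} (S \<omega>) * A (S \<omega>) - indicator {0..r} (S \<omega>) * ?K (S \<omega>))
     + ?K 0 * indicator {0..r} (S \<omega>) - (?K r - ?K 0) * (1 - indicator {0..r} (S \<omega>)) \<partial>M)"
  proof -
    have "integrable M (\<lambda>\<omega>. indicator {0..r} (S \<omega>) :: real)"
      by (rule integrable_const_bound[of _ 1]) auto
    moreover have "integrable M (\<lambda>\<omega>. indicator {0..r} (S \<omega>) * A (S \<omega>))"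
      by (rule integrable_const_bound[of _ "\<bar>D\<bar> + B3"]) (auto simp: A_bound indicator_def intro: order_trans[OF abs_ge_zero A_bound[of 0]])
    moreover have "integrable M (\<lambda>\<omega>. indicator {0..r} (S \<omega>) * ?K (S \<omega>))"
      by (rule integrable_const_bound[of _ B2]) (auto simp: B2 indicator_def intro: order_trans[OF abs_ge_zero B2[of 0]])
    ultimately show ?thesis by simp
  qed
  also have "\<dots> = (\<integral>\<omega>. (\<integral>\<omega>'. gain ?\<delta> a b c r (S \<omega>, W \<omega>') \<partial>M) \<partial>M)"
  proof (rule Bochner_Integration.integral_cong[OF refl])
    fix \<omega> assume "\<omega> \<in> space M"
    then show "(indicator {0..r} (S \<omega>) * A (S \<omega>) - indicator {0..r} (S \<omega>) * ?K (S \<omega>))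
     + ?K 0 * indicator {0..r} (S \<omega>) - (?K r - ?K 0) * (1 - indicator {0..r} (S \<omega>)) =
     (\<integral>\<omega>'. gain ?\<delta> a b c r (S \<omega>, W \<omega>') \<partial>M)"
      using S_nonneg id igd by (cases "S \<omega> \<le> r") (auto simp: gain_def A_def D_def prob_space)
  qed
  also have "\<dots> = mean_gain ?\<delta> a b c r"
  proof -
    obtain B where B: "\<bar>gain ?\<delta> a b c r p\<bar> \<le> B" for p
      using gain_bound[OF bounded_continuous3_state_ext[OF \<delta>]] by blast
    have "(\<lambda>p. gain ?\<delta> a b c r (fst p, snd p)) \<in> borel_measurable (borel \<Otimes>\<^sub>M borel)"
      by (intro gain_meas bounded_continuous3_state_ext[OF \<delta>]) auto
    moreover have "prob ((S -` U \<inter> space M) \<inter> (W -` V \<inter> space M)) = prob (S -` U \<inter> space M) * prob (W -` V \<inter> space M)"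
      if "U \<in> sets borel" "V \<in> sets borel" for U V
    proof -
      have "(S -` U \<inter> space M) \<inter> (W -` V \<inter> space M) = (\<lambda>x. (S x, W x)) -` (U \<times> V) \<inter> space M" by auto
      then show ?thesis using indep_varD[OF S_W_indep that] by simp
    qed
    ultimately show ?thesis unfolding mean_gain_def using B
      by (intro expectation_indep_pair(1)[symmetric, where B=B, OF S_meas W_meas]) auto
  qed
  finally show ?thesis .
qed

text \<open>As a function of \<open>r\<close>, \<open>gain\<close> can jump only at
  \<open>r = S \<omega>\<close>, and \<open>S\<close> avoids the limit \<open>r'\<close> almost
  surely because it has a density. Elsewhere the convergence is pointwise, and \<open>gain\<close>
  is bounded.\<close>

lemma mean_gain_tendsto:
  assumes \<delta>: "bounded_continuous3 \<delta>"
    and lim: "a \<longlonglongrightarrow> a'" "b \<longlonglongrightarrow> b'" "c \<longlonglongrightarrow> c'" "r \<longlonglongrightarrow> r'"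
  shows "(\<lambda>n. mean_gain \<delta> (a n) (b n) (c n) (r n)) \<longlonglongrightarrow> mean_gain \<delta> a' b' c' r'"
proof -
  obtain B where B: "\<And>a b c r p. \<bar>gain \<delta> a b c r p\<bar> \<le> B" using gain_bound[OF \<delta>] by blast
  have lims: "(\<lambda>n. g_ext (u n)) \<longlonglongrightarrow> g_ext v" "(\<lambda>n. k_ext (u n)) \<longlonglongrightarrow> k_ext v" if "u \<longlonglongrightarrow> v" for u v
    using that continuous_g_ext continuous_k_ext
    by (auto intro!: isCont_tendsto_compose[OF _ that] simp: continuous_on_eq_continuous_at)
  show ?thesis unfolding mean_gain_def
  proof (rule integral_dominated_convergence[where w = "\<lambda>_. B"])
    show "AE \<omega> in M. (\<lambda>n. gain \<delta> (a n) (b n) (c n) (r n) (S \<omega>, W \<omega>)) \<longlonglongrightarrow> gain \<delta> a' b' c' r' (S \<omega>, W \<omega>)"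
      using AE_S_neq[of r']
    proof eventually_elim
      case (elim \<omega>)
      show ?case
      proof (cases "S \<omega> < r'")
        case True
        have "\<forall>\<^sub>F n in sequentially. S \<omega> < r n" using order_tendstoD(1)[OF lim(4) True] .
        then have "\<forall>\<^sub>F n in sequentially. g_ext (a n + W \<omega>) - g_ext (a n) + \<delta> (a n + W \<omega>) (b n + S \<omega>) (c n - S \<omega>)
            - (k_ext (b n + S \<omega>) - k_ext (b n)) = gain \<delta> (a n) (b n) (c n) (r n) (S \<omega>, W \<omega>)"
          by eventually_elim (simp add: gain_def)
        moreover have "(\<lambda>n. g_ext (a n + W \<omega>) - g_ext (a n) + \<delta> (a n + W \<omega>) (b n + S \<omega>) (c n - S \<omega>)
            - (k_ext (b n + S \<omega>) - k_ext (b n))) \<longlonglongrightarrow> gain \<delta> a' b' c' r' (S \<omega>, W \<omega>)"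
          using True by (auto simp: gain_def intro!: tendsto_intros lims lim bounded_continuous3_tendsto[OF \<delta>])
        ultimately show ?thesis by (rule Lim_transform_eventually[rotated])
      next
        case False
        then have "r' < S \<omega>" using elim by auto
        have "\<forall>\<^sub>F n in sequentially. r n < S \<omega>" using order_tendstoD(2)[OF lim(4) \<open>r' < S \<omega>\<close>] .
        then have "\<forall>\<^sub>F n in sequentially. - (k_ext (b n + r n) - k_ext (b n)) = gain \<delta> (a n) (b n) (c n) (r n) (S \<omega>, W \<omega>)"
          by eventually_elim (simp add: gain_def)
        moreover have "(\<lambda>n. - (k_ext (b n + r n) - k_ext (b n))) \<longlonglongrightarrow> gain \<delta> a' b' c' r' (S \<omega>, W \<omega>)"
          using \<open>r' < S \<omega>\<close> by (auto simp: gain_def intro!: tendsto_intros lims lim)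
        ultimately show ?thesis by (rule Lim_transform_eventually[rotated])
      qed
    qed
  qed (use B \<delta> in auto)
qed

lemma continuous_on_mean_gain:
  fixes u :: "'b::metric_space \<Rightarrow> real"
  assumes \<delta>: "bounded_continuous3 \<delta>"
    and "continuous_on A u" "continuous_on A v" "continuous_on A w" "continuous_on A r"
  shows "continuous_on A (\<lambda>x. mean_gain \<delta> (u x) (v x) (w x) (r x))"
  unfolding continuous_on_sequentially o_def
proof (intro allI ballI impI)
  fix X a assume a: "a \<in> A" and X: "(\<forall>n. X n \<in> A) \<and> X \<longlonglongrightarrow> a"
  then have "(\<lambda>n. h (X n)) \<longlonglongrightarrow> h a" if "continuous_on A h" for h :: "'b \<Rightarrow> real"
    by (intro continuous_on_tendsto_compose[OF that]) auto
  with assms show "(\<lambda>n. mean_gain \<delta> (u (X n)) (v (X n)) (w (X n)) (r (X n))) \<longlonglongrightarrow> mean_gain \<delta> (u a) (v a) (w a) (r a)"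
    by (intro mean_gain_tendsto[OF \<delta>]) auto
qed

text \<open>The truncation at \<open>x\<close> lets one function serve two purposes: with
  \<open>x = t0\<close> it is \<open>Phi\<close> on \<open>states t0\<close>, and for general
  \<open>x\<close> it describes the event that the least maximiser is at most
  \<open>x\<close>.\<close>

definition sup_gain :: "(real \<Rightarrow> real \<Rightarrow> real \<Rightarrow> real) \<Rightarrow> real \<Rightarrow> real \<Rightarrow> real \<Rightarrow> real \<Rightarrow> real" where
  "sup_gain \<delta> x a b c = (SUP r\<in>{0..min x c}. mean_gain \<delta> a b c r)"

lemma mean_gain_bound:
  assumes "bounded_continuous3 \<delta>" shows "\<exists>B. \<forall>a b c r. \<bar>mean_gain \<delta> a b c r\<bar> \<le> B"
proof -
  obtain B where B: "\<And>a b c r p. \<bar>gain \<delta> a b c r p\<bar> \<le> B" using gain_bound[OF assms] by blast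
  have "\<bar>mean_gain \<delta> a b c r\<bar> \<le> B" for a b c r
  proof -
    have "norm (mean_gain \<delta> a b c r) \<le> (\<integral>\<omega>. norm (gain \<delta> a b c r (S \<omega>, W \<omega>)) \<partial>M)"
      unfolding mean_gain_def by (rule integral_norm_bound)
    also have "\<dots> \<le> (\<integral>\<omega>. B \<partial>M)"
      by (intro integral_mono integrable_norm integrable_gain assms) (auto simp: B)
    finally show ?thesis by (simp add: prob_space)
  qed
  then show ?thesis by blast
qed

lemma sup_gain_continuous:
  fixes A :: "(real \<times> real \<times> real) set"
  assumes \<delta>: "bounded_continuous3 \<delta>" and A: "\<And>a b c. (a, b, c) \<in> A \<Longrightarrow> 0 \<le> c" and x: "0 \<le> x"
  shows "continuous_on A (\<lambda>(a, b, c). sup_gain \<delta> x a b c)"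
proof -
  \<comment> \<open>Writing \<open>r = t * min x c\<close> replaces the interval that moves with
    \<open>c\<close> by the fixed compact set \<open>{0..1}\<close>.\<close>
  let ?\<psi> = "\<lambda>((a, b, c), t). mean_gain \<delta> a b c (t * min x c)"
  have "continuous_on (A \<times> {0..1}) ?\<psi>"
    unfolding case_prod_beta by (intro continuous_on_mean_gain[OF \<delta>] continuous_intros)
  then have "continuous_on A (\<lambda>p. SUP t\<in>{0..1}. ?\<psi> (p, t))"
    by (rule continuous_on_SUP_prod) auto
  moreover have "(SUP t\<in>{0..1}. ?\<psi> ((a, b, c), t)) = sup_gain \<delta> x a b c" if "(a, b, c) \<in> A" for a b c
  proof -
    have "0 \<le> min x c" using A[OF that] x by auto
    then have "(\<lambda>t. t * min x c) ` {0..1} = {0..min x c}"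
      using image_mult_atLeastAtMost_if'[of "min x c" 0 1] by (auto simp: mult.commute)
    then show ?thesis unfolding sup_gain_def by (simp flip: image_image[of _ "\<lambda>t. t * min x c"])
  qed
  ultimately show ?thesis
    by (subst continuous_on_cong[OF refl, of _ _ "\<lambda>p. SUP t\<in>{0..1}. ?\<psi> (p, t)"]) auto
qed

lemma statesD: "(a, b, c) \<in> states t0 \<Longrightarrow> 0 \<le> a \<and> 0 \<le> b \<and> 0 \<le> c \<and> c \<le> t0 \<and> b + c \<le> t0"
  by (auto simp: states_def)

lemma continuous_mean_gain_r:
  "\<delta> \<in> B_space t0 \<Longrightarrow> continuous_on A (mean_gain (state_ext \<delta>) a b c)"
  using continuous_on_mean_gain[OF bounded_continuous3_state_ext, of \<delta> A "\<lambda>_. a" "\<lambda>_. b" "\<lambda>_. c" "\<lambda>r. r"]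
  by (auto intro!: continuous_intros)

section \<open>The contraction property of the operator\<close>

abbreviation Phi2 where "Phi2 \<equiv> Phi M W F f g k'"
abbreviation phi2 where "phi2 \<equiv> phi M W F f g k'"

lemma Phi_eq:
  assumes "\<delta> \<in> B_space t0" "(a, b, c) \<in> states t0"
  shows "Phi2 \<delta> a b c = (SUP r\<in>{0..c}. mean_gain (state_ext \<delta>) a b c r)"
  unfolding Phi_def using assms by (intro SUP_cong refl phi_eq) auto

lemma Phi_B_space:
  assumes \<delta>: "\<delta> \<in> B_space t0" shows "Phi2 \<delta> \<in> B_space t0"
proof -
  note bc = bounded_continuous3_state_ext[OF \<delta>]
  have eq: "Phi2 \<delta> a b c = sup_gain (state_ext \<delta>) t0 a b c" if "(a, b, c) \<in> states t0" for a b c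
    unfolding Phi_eq[OF \<delta> that] sup_gain_def using statesD[OF that] by (simp add: min_absorb2)
  obtain B where B: "\<And>a b c r. \<bar>mean_gain (state_ext \<delta>) a b c r\<bar> \<le> B" using mean_gain_bound[OF bc] by blast
  have "continuous_on (states t0) (\<lambda>(a, b, c). sup_gain (state_ext \<delta>) t0 a b c)"
    using statesD t0_nonneg by (intro sup_gain_continuous[OF bc]) auto
  then have "continuous_on (states t0) (\<lambda>(a, b, c). Phi2 \<delta> a b c)"
    by (subst continuous_on_cong[OF refl]) (auto simp: eq)
  moreover have "\<bar>Phi2 \<delta> a b c\<bar> \<le> B" if "(a, b, c) \<in> states t0" for a b c
    unfolding Phi_eq[OF \<delta> that]
    by (subst least_argmax(2)[OF continuous_mean_gain_r[OF \<delta>], symmetric]) (use statesD[OF that] B in auto)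
  then have "bounded ((\<lambda>(a, b, c). Phi2 \<delta> a b c) ` states t0)"
    by (intro boundedI[of _ B]) auto
  ultimately show ?thesis by (simp add: B_space_def)
qed

lemma mean_gain_le_Phi:
  assumes "\<delta> \<in> B_space t0" "(a, b, c) \<in> states t0" "0 \<le> r" "r \<le> c"
  shows "mean_gain (state_ext \<delta>) a b c r \<le> Phi2 \<delta> a b c"
  unfolding Phi_eq[OF assms(1,2)]
  using least_argmax(2,3)[OF continuous_mean_gain_r[OF assms(1)], of c] assms(3,4) by auto

lemma mean_gain_diff:
  assumes "\<delta> \<in> B_space t0" "\<delta>' \<in> B_space t0"
  shows "mean_gain (state_ext \<delta>) a b c r - mean_gain (state_ext \<delta>') a b c r =
    (\<integral>\<omega>. indicator {..r} (S \<omega>) * (state_ext \<delta> (a + W \<omega>) (b + S \<omega>) (c - S \<omega>)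
       - state_ext \<delta>' (a + W \<omega>) (b + S \<omega>) (c - S \<omega>)) \<partial>M)"
  unfolding mean_gain_def
proof (subst Bochner_Integration.integral_diff[symmetric])
  show "(\<integral>\<omega>. gain (state_ext \<delta>) a b c r (S \<omega>, W \<omega>) - gain (state_ext \<delta>') a b c r (S \<omega>, W \<omega>) \<partial>M) =
    (\<integral>\<omega>. indicator {..r} (S \<omega>) * (state_ext \<delta> (a + W \<omega>) (b + S \<omega>) (c - S \<omega>)
       - state_ext \<delta>' (a + W \<omega>) (b + S \<omega>) (c - S \<omega>)) \<partial>M)"
    by (intro Bochner_Integration.integral_cong) (auto simp: gain_def)
qed (intro integrable_gain bounded_continuous3_state_ext assms)+

text \<open>The continuation value is received only if the catch comes within \<open>r\<close>, so
  an excess of at most \<open>e\<close> counts with probability \<open>F r\<close>, which is at most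
  \<open>F t0\<close>.\<close>

lemma mean_gain_contraction:
  assumes \<delta>: "\<delta> \<in> B_space t0" "\<delta>' \<in> B_space t0" and st: "(a, b, c) \<in> states t0" and r: "0 \<le> r" "r \<le> c"
    and le: "\<And>a b c. (a, b, c) \<in> states t0 \<Longrightarrow> \<delta> a b c \<le> \<delta>' a b c + e" and e: "0 \<le> e"
  shows "mean_gain (state_ext \<delta>) a b c r \<le> mean_gain (state_ext \<delta>') a b c r + F t0 * e"
proof -
  note [measurable] = bounded_continuous3_measurable[OF bounded_continuous3_state_ext[OF \<delta>(1)]]
    bounded_continuous3_measurable[OF bounded_continuous3_state_ext[OF \<delta>(2)]]
  let ?D = "\<lambda>\<omega>. indicator {..r} (S \<omega>) * (state_ext \<delta> (a + W \<omega>) (b + S \<omega>) (c - S \<omega>)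
       - state_ext \<delta>' (a + W \<omega>) (b + S \<omega>) (c - S \<omega>))"
  let ?A = "{\<omega>\<in>space M. S \<omega> \<le> r}"
  have "integrable M (\<lambda>\<omega>. gain (state_ext \<delta>) a b c r (S \<omega>, W \<omega>) - gain (state_ext \<delta>') a b c r (S \<omega>, W \<omega>))"
    by (intro Bochner_Integration.integrable_diff integrable_gain bounded_continuous3_state_ext \<delta>)
  then have "integrable M ?D"
    by (subst (asm) Bochner_Integration.integrable_cong[OF refl, of _ _ ?D]) (auto simp: gain_def)
  then have "(\<integral>\<omega>. ?D \<omega> \<partial>M) \<le> (\<integral>\<omega>. indicator ?A \<omega> * e \<partial>M)"
  proof (rule integral_mono)
    fix \<omega> assume w: "\<omega> \<in> space M"
    show "?D \<omega> \<le> indicator ?A \<omega> * e"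
    proof (cases "S \<omega> \<le> r")
      case True
      then have st': "(a + W \<omega>, b + S \<omega>, c - S \<omega>) \<in> states t0"
        using st r S_nonneg[OF w] W_nonneg[OF w] by (auto simp: states_def)
      from le[OF st'] show ?thesis using True w by (simp add: state_ext_eq[OF st'])
    qed (auto simp: indicator_def)
  qed (auto simp: less_top[symmetric])
  also have "\<dots> = F r * e" by (simp add: cdf_eq)
  also have "\<dots> \<le> F t0 * e" using F_mono[of r t0] e r statesD[OF st] by (intro mult_right_mono) auto
  finally show ?thesis using mean_gain_diff[OF \<delta>, of a b c r] by simp
qed

text \<open>The one-sided form contains both properties needed of the operator: monotonicity for
  \<open>e = 0\<close>, and, applied in both directions, the Lipschitz constant
  \<open>F t0 < 1\<close>.\<close>

lemma Phi_contraction: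
  assumes \<delta>: "\<delta> \<in> B_space t0" "\<delta>' \<in> B_space t0"
    and le: "\<And>a b c. (a, b, c) \<in> states t0 \<Longrightarrow> \<delta> a b c \<le> \<delta>' a b c + e" and e: "0 \<le> e"
    and st: "(a, b, c) \<in> states t0"
  shows "Phi2 \<delta> a b c \<le> Phi2 \<delta>' a b c + F t0 * e"
  unfolding Phi_eq[OF \<delta>(1) st]
proof (rule cSUP_least)
  fix r assume r: "r \<in> {0..c}"
  then have r': "0 \<le> r" "r \<le> c" by auto
  show "mean_gain (state_ext \<delta>) a b c r \<le> Phi2 \<delta>' a b c + F t0 * e"
    using mean_gain_contraction[OF \<delta> st r' le e] mean_gain_le_Phi[OF \<delta>(2) st r'] by linarith
qed (use statesD[OF st] in auto)

lemma Phi_contraction_abs: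
  assumes \<delta>: "\<delta> \<in> B_space t0" "\<delta>' \<in> B_space t0"
    and le: "\<And>a b c. (a, b, c) \<in> states t0 \<Longrightarrow> \<bar>\<delta> a b c - \<delta>' a b c\<bar> \<le> e"
    and st: "(a, b, c) \<in> states t0"
  shows "\<bar>Phi2 \<delta> a b c - Phi2 \<delta>' a b c\<bar> \<le> F t0 * e"
proof -
  have e: "0 \<le> e" using le[OF st] by auto
  have "\<delta> a b c \<le> \<delta>' a b c + e" "\<delta>' a b c \<le> \<delta> a b c + e" if "(a, b, c) \<in> states t0" for a b c
    using le[OF that] by auto
  from Phi_contraction[OF \<delta> this(1) e st] Phi_contraction[OF \<delta>(2,1) this(2) e st]
  show ?thesis by auto
qed

subsection \<open>The fixed point and the limit of the least maximisers\<close>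

abbreviation y2 where "y2 \<equiv> y_iter M W F f g k'"
abbreviation Y where "Y \<equiv> y_fix M W F f g k' t0"

lemma Phi_nonneg:
  assumes "\<delta> \<in> B_space t0" "(a, b, c) \<in> states t0" shows "0 \<le> Phi2 \<delta> a b c"
proof -
  have "0 = mean_gain (state_ext \<delta>) a b c 0"
    using phi_eq[OF assms, of 0] statesD[OF assms(2)] by (simp add: phi_def)
  then show ?thesis using mean_gain_le_Phi[OF assms, of 0] statesD[OF assms(2)] by simp
qed

lemma zero_B_space: "(\<lambda>a b c. 0) \<in> B_space t0"
  by (auto simp: B_space_def case_prod_unfold intro!: boundedI[of _ 0])

lemma y2_B_space: "y2 j \<in> B_space t0"
  by (induction j) (auto intro: Phi_B_space zero_B_space)

lemma B_space_bound:
  assumes "\<delta> \<in> B_space t0" obtains B where "\<And>a b c. (a, b, c) \<in> states t0 \<Longrightarrow> \<bar>\<delta> a b c\<bar> \<le> B"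
proof -
  obtain B where "\<forall>x\<in>(\<lambda>(a, b, c). \<delta> a b c) ` states t0. norm x \<le> B"
    using assms unfolding B_space_def bounded_iff by auto
  then show thesis by (intro that[of B]) force
qed

lemma y2_step:
  obtains B where "\<And>j a b c. (a, b, c) \<in> states t0 \<Longrightarrow> \<bar>y2 (Suc j) a b c - y2 j a b c\<bar> \<le> F t0 ^ j * B"
proof -
  obtain B where B: "\<And>a b c. (a, b, c) \<in> states t0 \<Longrightarrow> \<bar>y2 (Suc 0) a b c\<bar> \<le> B"
    using B_space_bound[OF y2_B_space[of "Suc 0"]] by blast
  have "\<bar>y2 (Suc j) a b c - y2 j a b c\<bar> \<le> F t0 ^ j * B" if "(a, b, c) \<in> states t0" for j a b c
    using that
  proof (induction j arbitrary: a b c)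
    case 0 then show ?case using B by simp
  next
    case (Suc j)
    have "\<bar>Phi2 (y2 (Suc j)) a b c - Phi2 (y2 j) a b c\<bar> \<le> F t0 * (F t0 ^ j * B)"
      by (rule Phi_contraction_abs[OF y2_B_space y2_B_space Suc.IH Suc.prems])
    then show ?case by (simp add: mult.assoc)
  qed
  then show thesis by (rule that)
qed

text \<open>Nothing can be said about \<open>y_fix\<close> before this, as it is chosen by
  \<open>SOME\<close>. The Banach iteration is carried out directly: the increments of the iterates
  are dominated by a geometric series, the uniform limit inherits continuity and boundedness on
  \<open>states t0\<close>, and the contraction property identifies it as a fixed point.\<close>

lemma fixed_point_exists:
  "\<exists>\<delta>. \<delta> \<in> B_space t0 \<and> (\<forall>(a, b, c)\<in>states t0. \<delta> a b c = Phi2 \<delta> a b c)"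
proof -
  obtain B where B: "\<And>j a b c. (a, b, c) \<in> states t0 \<Longrightarrow> \<bar>y2 (Suc j) a b c - y2 j a b c\<bar> \<le> F t0 ^ j * B"
    using y2_step by blast
  let ?d = "\<lambda>j (a, b, c). y2 (Suc j) a b c - y2 j a b c"
  define l where "l = (\<lambda>p. \<Sum>j. ?d j p)"
  define \<delta> where "\<delta> a b c = l (a, b, c)" for a b c
  have tele: "(\<Sum>j<n. ?d j (a, b, c)) = y2 n a b c" for n a b c
    using sum_lessThan_telescope[of "\<lambda>j. y2 j a b c" n] by simp
  have "uniform_limit (states t0) (\<lambda>n p. \<Sum>j<n. ?d j p) l sequentially"
    unfolding l_def
  proof (rule Weierstrass_m_test)
    show "summable (\<lambda>j. F t0 ^ j * B)"
      using F_nonneg F_lt_1 by (intro summable_mult2 summable_geometric) auto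
    show "norm (?d j p) \<le> F t0 ^ j * B" if "p \<in> states t0" for j p
      using B that by (cases p) auto
  qed
  then have ul: "uniform_limit (states t0) (\<lambda>n (a, b, c). y2 n a b c) l sequentially"
    by (rule uniform_limit_cong'[THEN iffD1, rotated -1]) (auto simp: tele[simplified])
  have cont: "continuous_on (states t0) l"
    using y2_B_space by (intro uniform_limit_theorem[OF _ ul]) (auto simp: B_space_def)
  have "\<forall>\<^sub>F n in sequentially. \<forall>p\<in>states t0. dist (case p of (a, b, c) \<Rightarrow> y2 n a b c) (l p) < 1"
    by (intro uniform_limitD[OF ul]) auto
  then obtain n where n: "\<And>p. p \<in> states t0 \<Longrightarrow> dist (case p of (a, b, c) \<Rightarrow> y2 n a b c) (l p) < 1"
    unfolding eventually_sequentially by blast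
  obtain B' where B': "\<And>a b c. (a, b, c) \<in> states t0 \<Longrightarrow> \<bar>y2 n a b c\<bar> \<le> B'"
    using B_space_bound[OF y2_B_space[of n]] by blast
  have "\<bar>\<delta> a b c\<bar> \<le> B' + 1" if "(a, b, c) \<in> states t0" for a b c
    using n[OF that] B'[OF that] by (auto simp: \<delta>_def dist_real_def)
  then have \<delta>: "\<delta> \<in> B_space t0"
    using cont by (auto simp: B_space_def \<delta>_def case_prod_unfold intro!: boundedI[of _ "B' + 1"])
  have "\<delta> a b c = Phi2 \<delta> a b c" if st: "(a, b, c) \<in> states t0" for a b c
  proof (rule LIMSEQ_unique)
    have lim: "(\<lambda>n. y2 n a b c) \<longlonglongrightarrow> \<delta> a b c"
      using tendsto_uniform_limitI[OF ul st] by (simp add: \<delta>_def)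
    then show "(\<lambda>n. y2 (Suc n) a b c) \<longlonglongrightarrow> \<delta> a b c" by (rule LIMSEQ_Suc)
    show "(\<lambda>n. y2 (Suc n) a b c) \<longlonglongrightarrow> Phi2 \<delta> a b c"
    proof (rule tendstoI)
      fix e :: real assume e: "e > 0"
      have "\<forall>\<^sub>F n in sequentially. \<forall>p\<in>states t0. dist (case p of (a, b, c) \<Rightarrow> y2 n a b c) (l p) < e"
        by (intro uniform_limitD[OF ul] e)
      then show "\<forall>\<^sub>F n in sequentially. dist (y2 (Suc n) a b c) (Phi2 \<delta> a b c) < e"
      proof eventually_elim
        case (elim n)
        then have "\<bar>y2 n a b c - \<delta> a b c\<bar> \<le> e" if "(a, b, c) \<in> states t0" for a b c
          using that by (force simp: \<delta>_def dist_real_def)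
        from Phi_contraction_abs[OF y2_B_space \<delta> this st]
        have "\<bar>y2 (Suc n) a b c - Phi2 \<delta> a b c\<bar> \<le> F t0 * e" by simp
        also have "\<dots> < e" using F_lt_1 e by simp
        finally show ?case by (simp add: dist_real_def)
      qed
    qed
  qed
  then show ?thesis using \<delta> by auto
qed

lemma Y_B_space: "Y \<in> B_space t0"
  and Y_fixed: "(a, b, c) \<in> states t0 \<Longrightarrow> Phi2 Y a b c = Y a b c"
  using someI_ex[OF fixed_point_exists] unfolding y_fix_def[symmetric] by auto

lemma y2_tendsto:
  obtains B where "\<And>j a b c. (a, b, c) \<in> states t0 \<Longrightarrow> \<bar>y2 j a b c - Y a b c\<bar> \<le> F t0 ^ j * B"
proof -
  \<comment> \<open>The iteration starts at 0, so a bound on \<open>Y\<close> is a bound on the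
    initial error.\<close>
  obtain B where B: "\<And>a b c. (a, b, c) \<in> states t0 \<Longrightarrow> \<bar>Y a b c\<bar> \<le> B"
    using B_space_bound[OF Y_B_space] by blast
  have "\<bar>y2 j a b c - Y a b c\<bar> \<le> F t0 ^ j * B" if "(a, b, c) \<in> states t0" for j a b c
    using that
  proof (induction j arbitrary: a b c)
    case 0 then show ?case using B by simp
  next
    case (Suc j)
    have "\<bar>Phi2 (y2 j) a b c - Phi2 Y a b c\<bar> \<le> F t0 * (F t0 ^ j * B)"
      by (rule Phi_contraction_abs[OF y2_B_space Y_B_space Suc.IH Suc.prems])
    then show ?case using Y_fixed[OF Suc.prems] by (simp add: mult.assoc)
  qed
  then show thesis by (rule that)
qed

text \<open>Waiting for time 0 is allowed and gains nothing, so \<open>0 \<le> Y\<close>;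
  monotonicity of the operator carries this along the iteration. The sign of \<open>Y - y2 j\<close>
  is what compares the gain increments in \<open>r_star_tendsto\<close>.\<close>

lemma y2_le_Y: "(a, b, c) \<in> states t0 \<Longrightarrow> y2 j a b c \<le> Y a b c"
proof (induction j arbitrary: a b c)
  case 0 then show ?case using Phi_nonneg[OF Y_B_space] Y_fixed by simp
next
  case (Suc j)
  then show ?case using Phi_contraction[OF y2_B_space Y_B_space _ order_refl, of j a b c] Y_fixed by simp
qed

definition r_lim :: "real \<Rightarrow> real \<Rightarrow> real \<Rightarrow> real" where
  "r_lim a b c = (LEAST r. r \<in> {0..c} \<and> mean_gain (state_ext Y) a b c r =
     (SUP r\<in>{0..c}. mean_gain (state_ext Y) a b c r))"

lemma r_lim:
  assumes st: "(a, b, c) \<in> states t0"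
  shows "r_lim a b c \<in> {0..c}" "mean_gain (state_ext Y) a b c (r_lim a b c) = Y a b c"
proof -
  have c: "0 \<le> c" using statesD[OF st] by simp
  note * = least_argmax[OF continuous_mean_gain_r[OF Y_B_space] c, of a b c, folded r_lim_def]
  show "r_lim a b c \<in> {0..c}" by (rule *(1))
  show "mean_gain (state_ext Y) a b c (r_lim a b c) = Y a b c"
    using *(2) Phi_eq[OF Y_B_space st] Y_fixed[OF st] by simp
qed

lemma mean_gain_le_Y:
  "(a, b, c) \<in> states t0 \<Longrightarrow> 0 \<le> r \<Longrightarrow> r \<le> c \<Longrightarrow> mean_gain (state_ext Y) a b c r \<le> Y a b c"
  using mean_gain_le_Phi[OF Y_B_space] Y_fixed by simp

lemma r_star_eq:
  assumes st: "(a, b, c) \<in> states t0" and j: "1 \<le> j"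
  shows "r_star M W F f g k' j a b c = (LEAST r. r \<in> {0..c} \<and> mean_gain (state_ext (y2 (j - 1))) a b c r =
     (SUP r\<in>{0..c}. mean_gain (state_ext (y2 (j - 1))) a b c r))"
proof -
  have "y2 j a b c = (SUP r\<in>{0..c}. mean_gain (state_ext (y2 (j - 1))) a b c r)"
    using Phi_eq[OF y2_B_space st, of "j - 1"] j by (cases j) auto
  moreover have "phi2 (y2 (j - 1)) a b c r = mean_gain (state_ext (y2 (j - 1))) a b c r" if "r \<in> {0..c}" for r
    using that by (intro phi_eq y2_B_space st) auto
  ultimately show ?thesis unfolding r_star_def by (intro arg_cong[where f=Least] ext) auto
qed

text \<open>Between the waits \<open>u\<close> and \<open>v\<close>, the gain increments for
  \<open>Y\<close> and for \<open>y2 j\<close> differ by the mean of \<open>Y - y2 j\<close> over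
  the event that the catch falls between \<open>u\<close> and \<open>v\<close>. This is nonnegative,
  as \<open>least_argmax_tendsto\<close> demands; the uniform convergence is geometric.\<close>

lemma r_star_tendsto:
  assumes st: "(a, b, c) \<in> states t0"
  shows "(\<lambda>j. r_star M W F f g k' j a b c) \<longlonglongrightarrow> r_lim a b c"
proof (rule LIMSEQ_offset[of _ 1])
  have c: "0 \<le> c" using statesD[OF st] by simp
  obtain B where B: "\<And>j a b c. (a, b, c) \<in> states t0 \<Longrightarrow> \<bar>y2 j a b c - Y a b c\<bar> \<le> F t0 ^ j * B"
    using y2_tendsto by blast
  have "(\<lambda>j. LEAST r. r \<in> {0..c} \<and> mean_gain (state_ext (y2 j)) a b c r =
     (SUP r\<in>{0..c}. mean_gain (state_ext (y2 j)) a b c r)) \<longlonglongrightarrow> r_lim a b c"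
    unfolding r_lim_def
  proof (rule least_argmax_tendsto[OF _ _ c])
    show "uniform_limit {0..c} (\<lambda>j. mean_gain (state_ext (y2 j)) a b c) (mean_gain (state_ext Y) a b c) sequentially"
    proof (rule uniform_limitI)
      fix e :: real assume e: "e > 0"
      have "(\<lambda>j. F t0 * (F t0 ^ j * B)) \<longlonglongrightarrow> F t0 * (0 * B)"
        using F_nonneg F_lt_1 by (intro tendsto_intros LIMSEQ_realpow_zero) auto
      then have "\<forall>\<^sub>F j in sequentially. F t0 * (F t0 ^ j * B) < e"
        using e by (intro order_tendstoD(2)) auto
      then show "\<forall>\<^sub>F j in sequentially. \<forall>r\<in>{0..c}. dist (mean_gain (state_ext (y2 j)) a b c r)
          (mean_gain (state_ext Y) a b c r) < e"
      proof eventually_elim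
        case (elim j)
        have e': "0 \<le> F t0 ^ j * B" using B[OF st, of j] by simp
        have "y2 j a b c \<le> Y a b c + F t0 ^ j * B" "Y a b c \<le> y2 j a b c + F t0 ^ j * B"
          if "(a, b, c) \<in> states t0" for a b c using B[OF that, of j] by auto
        from mean_gain_contraction[OF y2_B_space Y_B_space st _ _ this(1) e']
          mean_gain_contraction[OF Y_B_space y2_B_space st _ _ this(2) e'] elim
        show ?case by (fastforce simp: dist_real_def)
      qed
    qed
    fix j u v assume uv: "0 \<le> u" "u \<le> v" "v \<le> c"
    note m = bounded_continuous3_measurable[OF bounded_continuous3_state_ext[OF y2_B_space[of j]]]
      bounded_continuous3_measurable[OF bounded_continuous3_state_ext[OF Y_B_space]]
    let ?D = "\<lambda>\<omega>. state_ext Y (a + W \<omega>) (b + S \<omega>) (c - S \<omega>) - state_ext (y2 j) (a + W \<omega>) (b + S \<omega>) (c - S \<omega>)"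
    have int: "integrable M (\<lambda>\<omega>. indicator {..r} (S \<omega>) * ?D \<omega>)" for r
    proof -
      have "integrable M (\<lambda>\<omega>. gain (state_ext Y) a b c r (S \<omega>, W \<omega>) - gain (state_ext (y2 j)) a b c r (S \<omega>, W \<omega>))"
        by (intro Bochner_Integration.integrable_diff integrable_gain bounded_continuous3_state_ext y2_B_space Y_B_space)
      then show ?thesis
        by (subst (asm) Bochner_Integration.integrable_cong[OF refl, of _ _ "\<lambda>\<omega>. indicator {..r} (S \<omega>) * ?D \<omega>"])
          (auto simp: gain_def)
    qed
    have "(\<integral>\<omega>. indicator {..u} (S \<omega>) * ?D \<omega> \<partial>M) \<le> (\<integral>\<omega>. indicator {..v} (S \<omega>) * ?D \<omega> \<partial>M)"
    proof (rule integral_mono[OF int int])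
      fix \<omega> assume w: "\<omega> \<in> space M"
      have "0 \<le> ?D \<omega>" if "S \<omega> \<le> v"
      proof -
        have st': "(a + W \<omega>, b + S \<omega>, c - S \<omega>) \<in> states t0"
          using st that uv S_nonneg[OF w] W_nonneg[OF w] by (auto simp: states_def)
        show ?thesis using y2_le_Y[OF st'] by (simp add: state_ext_eq[OF st'])
      qed
      then show "indicator {..u} (S \<omega>) * ?D \<omega> \<le> indicator {..v} (S \<omega>) * ?D \<omega>"
        using uv by (auto simp: indicator_def)
    qed
    then show "mean_gain (state_ext (y2 j)) a b c v - mean_gain (state_ext (y2 j)) a b c u
      \<le> mean_gain (state_ext Y) a b c v - mean_gain (state_ext Y) a b c u"
      using mean_gain_diff[OF Y_B_space y2_B_space, of a b c u j] mean_gain_diff[OF Y_B_space y2_B_space, of a b c v j]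
      by simp
  qed (intro continuous_mean_gain_r y2_B_space Y_B_space)+
  \<comment> \<open>The shift by one arises because \<open>r_star\<close> with index
    \<open>j + 1\<close> maximises the gain for the iterate \<open>y2 j\<close>.\<close>
  then show "(\<lambda>j. r_star M W F f g k' (j + 1) a b c) \<longlonglongrightarrow> r_lim a b c"
    by (simp add: r_star_eq[OF st])
qed

lemma closed_states: "closed (states t0)"
proof -
  have "states t0 = {p. 0 \<le> fst p} \<inter> {p. 0 \<le> fst (snd p)} \<inter> {p. 0 \<le> snd (snd p)} \<inter> {p. fst (snd p) + snd (snd p) \<le> t0}"
    by (auto simp: states_def)
  then show ?thesis by (auto intro!: closed_Int closed_Collect_le continuous_intros)
qed

text \<open>The least maximiser may jump, but its sublevel sets in \<open>states t0\<close> are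
  closed: being at most \<open>x\<close> means that the supremum over waits up to \<open>x\<close>
  already reaches the full supremum, and both are continuous.\<close>

lemma r_lim_measurable:
  assumes [measurable]: "u \<in> borel_measurable N" "v \<in> borel_measurable N" "w \<in> borel_measurable N"
    and st: "\<And>x. x \<in> space N \<Longrightarrow> P x \<Longrightarrow> (u x, v x, w x) \<in> states t0"
    and P[measurable]: "Measurable.pred N P"
  shows "(\<lambda>x. if P x then r_lim (u x) (v x) (w x) else 0) \<in> borel_measurable N"
proof -
  let ?h = "\<lambda>p. if p \<in> states t0 then (\<lambda>(a, b, c). r_lim a b c) p else 0"
  have "?h \<in> borel_measurable borel"
  proof (rule borel_measurable_iff_le[THEN iffD2, rule_format])
    fix x :: real
    show "{p \<in> space borel. ?h p \<le> x} \<in> sets borel"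
    proof (cases "0 \<le> x")
      case False
      have h0: "0 \<le> ?h p" for p using r_lim(1) by (cases p) force
      have "\<not> ?h p \<le> x" for p using h0[of p] False by linarith
      then have "{p \<in> space borel. ?h p \<le> x} = {}" by blast
      then show ?thesis by (simp only: sets.empty_sets)
    next
      case True
      \<comment> \<open>Truncation at \<open>t0\<close> is no restriction because
        \<open>c \<le> t0\<close> on \<open>states t0\<close>, so the second term is the full
        supremum.\<close>
      let ?s = "\<lambda>p. (\<lambda>(a, b, c). sup_gain (state_ext Y) x a b c) p - (\<lambda>(a, b, c). sup_gain (state_ext Y) t0 a b c) p"
      have "continuous_on (states t0) ?s"
        using True t0_nonneg statesD
        by (intro continuous_on_diff sup_gain_continuous bounded_continuous3_state_ext Y_B_space) auto
      then have "closed {p \<in> states t0. 0 \<le> ?s p}"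
        using closed_states by (intro continuous_on_closed_Collect_le continuous_on_const) auto
      moreover have "r_lim a b c \<le> x \<longleftrightarrow> 0 \<le> ?s (a, b, c)" if "(a, b, c) \<in> states t0" for a b c
        using statesD[OF that] True unfolding r_lim_def sup_gain_def
        by (subst least_argmax_le_iff[OF continuous_mean_gain_r[OF Y_B_space]]) (auto simp: min_absorb2)
      then have "{p \<in> space borel. ?h p \<le> x} = {p \<in> states t0. 0 \<le> ?s p} \<union> - states t0"
        using True by auto
      ultimately show ?thesis using closed_states by (auto intro!: sets.Un borel_closed)
    qed
  qed
  moreover have "(\<lambda>x. (u x, v x, w x)) \<in> borel_measurable N" by (intro borel_measurable_Pair) auto
  ultimately have [measurable]: "(\<lambda>x. ?h (u x, v x, w x)) \<in> borel_measurable N"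
    by (rule measurable_compose[rotated])
  have "(\<lambda>x. if P x then ?h (u x, v x, w x) else 0) \<in> borel_measurable N" by measurable
  then show ?thesis by (subst measurable_cong[where g="\<lambda>x. if P x then ?h (u x, v x, w x) else 0"]) (auto simp: st)
qed

end

subsection \<open>The past of the catches\<close>

text \<open>The summands are required to be measurable only after being cut off at
  \<open>n \<le> K \<omega>\<close>, because a history reveals the \<open>n\<close>-th weight only
  if the \<open>n\<close>-th catch has been made.\<close>

lemma random_sum_measurable:
  fixes Z :: "nat \<Rightarrow> 'a \<Rightarrow> real"
  assumes K: "\<And>n. {\<omega> \<in> space N. n \<le> K \<omega>} \<in> sets N"
    and Z: "\<And>n. (\<lambda>\<omega>. if n \<le> K \<omega> then Z n \<omega> else 0) \<in> borel_measurable N"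
  shows "(\<lambda>\<omega>. \<Sum>n=1..K \<omega>. Z n \<omega>) \<in> borel_measurable N"
proof -
  have "K -` {n} \<inter> space N \<in> sets N" for n
  proof -
    have "K -` {n} \<inter> space N = {\<omega> \<in> space N. n \<le> K \<omega>} - {\<omega> \<in> space N. Suc n \<le> K \<omega>}" by auto
    then show ?thesis using K by auto
  qed
  then have "K \<in> measurable N (count_space UNIV)"
    by (subst measurable_count_space_eq2_countable) auto
  then have "(\<lambda>\<omega>. (\<lambda>j \<omega>. \<Sum>n=1..j. if n \<le> K \<omega> then Z n \<omega> else 0) (K \<omega>) \<omega>) \<in> borel_measurable N"
    by (rule measurable_compose_countable[rotated]) (intro borel_measurable_sum Z)
  moreover have "(\<Sum>n=1..K \<omega>. if n \<le> K \<omega> then Z n \<omega> else 0) = (\<Sum>n=1..K \<omega>. Z n \<omega>)" for \<omega>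
    by (rule sum.cong) auto
  ultimately show ?thesis by simp
qed

lemma (in prob_space) integrable_indicator_mult:
  fixes h :: "'a \<Rightarrow> real"
  assumes [measurable]: "D \<in> sets M" "h \<in> borel_measurable M" and B: "\<And>\<omega>. \<omega> \<in> space M \<Longrightarrow> \<bar>h \<omega>\<bar> \<le> B"
  shows "integrable M (\<lambda>\<omega>. indicator D \<omega> * h \<omega>)"
proof (rule integrable_const_bound[of _ "\<bar>B\<bar>"])
  show "AE \<omega> in M. norm (indicator D \<omega> * h \<omega>) \<le> \<bar>B\<bar>"
    using B by (intro AE_I2) (fastforce simp: indicator_def)
qed measurable

locale fishing_change = fishing_model M S X F H g G cost cost' C t0
  for M :: "'a measure" and S X :: "nat \<Rightarrow> nat \<Rightarrow> 'a \<Rightarrow> real"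
    and F H g :: "nat \<Rightarrow> real \<Rightarrow> real" and G :: "nat \<Rightarrow> real"
    and cost cost' :: "nat \<Rightarrow> real \<Rightarrow> real" and C :: "nat \<Rightarrow> real" and t0 :: real +
  fixes f2 :: "real \<Rightarrow> real" and s :: real
  assumes s_nonneg: "0 \<le> s" and F2_lt_1: "F 2 t0 < 1" and f2_nonneg: "\<And>x. 0 \<le> f2 x"
    and f2_density: "\<And>k. 1 \<le> k \<Longrightarrow> distributed M lborel (S 2 k) (\<lambda>x. ennreal (f2 x))"
begin

definition V :: "(nat \<times> nat) + (nat \<times> nat) \<Rightarrow> 'a \<Rightarrow> real" where
  "V = case_sum (\<lambda>(i, n). S i n) (\<lambda>(i, n). X i n)"

text \<open>
  The past of the \<open>k\<close>-th catch contains the whole future at place 1; this is harmless, as place 1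
  is independent of place 2, and spares a separate treatment of the moment \<open>s\<close>.
\<close>

definition past_index :: "nat \<Rightarrow> ((nat \<times> nat) + (nat \<times> nat)) set" where
  "past_index k = ({1} \<times> {1..} \<union> {2} \<times> {1..k}) <+> ({1} \<times> {1..} \<union> {2} \<times> {1..k})"

definition past :: "nat \<Rightarrow> 'a measure" where
  "past k = vimage_algebra (space M) (\<lambda>\<omega>. restrict (\<lambda>i. V i \<omega>) (past_index k)) (PiM (past_index k) (\<lambda>_. borel))"

abbreviation T where "T \<equiv> arrival S s 2"

definition L :: "nat \<Rightarrow> 'a \<Rightarrow> real" where "L k \<omega> = (\<Sum>i=1..k. X 2 i \<omega>)"

lemma V_indep: "indep_vars (\<lambda>_. borel) V (({1, 2} \<times> {1..}) <+> ({1, 2} \<times> {1..}))"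
  unfolding V_def by (rule independent)

lemma S_meas[measurable]: "i \<in> {1, 2} \<Longrightarrow> 1 \<le> n \<Longrightarrow> S i n \<in> borel_measurable M"
  and X_meas'[measurable]: "i \<in> {1, 2} \<Longrightarrow> 1 \<le> n \<Longrightarrow> X i n \<in> borel_measurable M"
proof -
  assume "i \<in> {1, 2}" "1 \<le> n"
  then have "Inl (i, n) \<in> ({1, 2} \<times> {1..}) <+> ({1, 2} \<times> {1..} :: (nat \<times> nat) set)"
    "Inr (i, n) \<in> ({1, 2} \<times> {1..} :: (nat \<times> nat) set) <+> ({1, 2} \<times> {1..})" by auto
  then have "V (Inl (i, n)) \<in> borel_measurable M" "V (Inr (i, n)) \<in> borel_measurable M"
    using V_indep unfolding indep_vars_def by blast+
  then show "S i n \<in> borel_measurable M" "X i n \<in> borel_measurable M" by (auto simp: V_def)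
qed

lemma X_meas: "i \<in> {1, 2} \<Longrightarrow> X i n \<in> borel_measurable M"
  using X_meas'[of i n] weight_0[of i] by (cases "n = 0") (auto cong: measurable_cong)

lemma space_past [simp]: "space (past k) = space M"
  by (simp add: past_def)

lemma past_index_subset: "past_index k \<subseteq> ({1, 2} \<times> {1..}) <+> ({1, 2} \<times> {1..})"
  by (auto simp: past_index_def)

lemma past_least:
  assumes "space N = space M" "\<And>i. i \<in> past_index k \<Longrightarrow> V i \<in> borel_measurable N"
  shows "sets (past k) \<subseteq> sets N"
proof -
  have "(\<lambda>\<omega>. restrict (\<lambda>i. V i \<omega>) (past_index k)) \<in> measurable N (PiM (past_index k) (\<lambda>_. borel))"
    using assms(2) by (intro measurable_restrict)
  then show ?thesis unfolding past_def assms(1)[symmetric] by (intro sets_image_in_sets) auto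
qed

lemma past_V: "i \<in> past_index k \<Longrightarrow> V i \<in> borel_measurable (past k)"
proof -
  assume i: "i \<in> past_index k"
  have "(\<lambda>\<omega>. restrict (\<lambda>i. V i \<omega>) (past_index k)) \<in> measurable (past k) (PiM (past_index k) (\<lambda>_. borel))"
    unfolding past_def by (rule measurable_vimage_algebra1) (auto simp: space_PiM)
  from measurable_compose[OF this measurable_component_singleton[OF i]] show ?thesis using i by simp
qed

lemma past_subset: "sets (past k) \<subseteq> sets M"
  using V_indep past_index_subset[of k] unfolding indep_vars_def by (intro past_least) auto

lemma past_mono: "k \<le> l \<Longrightarrow> sets (past k) \<subseteq> sets (past l)"
  by (intro past_least past_V) (auto simp: past_index_def)

lemma past_index_iff:
  "Inl (i, n) \<in> past_index k \<longleftrightarrow> 1 \<le> n \<and> (i = 1 \<or> i = 2 \<and> n \<le> k)"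
  "Inr (i, n) \<in> past_index k \<longleftrightarrow> 1 \<le> n \<and> (i = 1 \<or> i = 2 \<and> n \<le> k)"
  by (auto simp: past_index_def)

lemma past_S: "1 \<le> n \<Longrightarrow> i = 1 \<or> i = 2 \<and> n \<le> k \<Longrightarrow> S i n \<in> borel_measurable (past k)"
  using past_V[of "Inl (i, n)" k] by (auto simp: past_index_iff V_def)

lemma past_X: "i = 1 \<or> i = 2 \<and> n \<le> k \<Longrightarrow> X i n \<in> borel_measurable (past k)"
proof (cases "n = 0")
  case True
  assume "i = 1 \<or> i = 2 \<and> n \<le> k"
  then have "X i n \<in> borel_measurable (past k) \<longleftrightarrow> (\<lambda>_. 0 :: real) \<in> borel_measurable (past k)"
    using True weight_0[of i] by (intro measurable_cong) auto
  then show ?thesis by simp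
qed (use past_V[of "Inr (i, n)" k] in \<open>auto simp: past_index_iff V_def\<close>)

lemma past_T: "T k \<in> borel_measurable (past k)"
proof -
  have "(\<lambda>\<omega>. s + (\<Sum>i=1..k. S 2 i \<omega>)) \<in> borel_measurable (past k)"
    by (intro borel_measurable_add borel_measurable_sum past_S) auto
  then show ?thesis by (simp add: arrival_def[abs_def])
qed

lemma past_L: "L k \<in> borel_measurable (past k)"
  unfolding L_def[abs_def] by (intro borel_measurable_sum past_X) auto

lemma past_measurable_mono: "k \<le> l \<Longrightarrow> h \<in> measurable (past k) N \<Longrightarrow> h \<in> measurable (past l) N"
  using past_mono[of k l] by (auto simp: measurable_def)

lemma past_measurable_M: "h \<in> measurable (past k) N \<Longrightarrow> h \<in> measurable M N"
  using past_subset[of k] by (auto simp: measurable_def)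

lemma T_Suc: "T (Suc k) \<omega> = T k \<omega> + S 2 (Suc k) \<omega>"
  by (simp add: arrival_def)

lemma L_Suc: "L (Suc k) \<omega> = L k \<omega> + X 2 (Suc k) \<omega>"
  by (simp add: L_def)

lemma T_mono: "\<omega> \<in> space M \<Longrightarrow> k \<le> l \<Longrightarrow> T k \<omega> \<le> T l \<omega>"
  by (rule lift_Suc_mono_le[of "\<lambda>k. T k \<omega>"]) (auto simp: T_Suc waiting_nonneg)

lemma T_0: "T 0 \<omega> = s" by (simp add: arrival_def)

lemma T_ge_s: "\<omega> \<in> space M \<Longrightarrow> s \<le> T k \<omega>"
  using T_mono[of \<omega> 0 k] by (simp add: T_0)

lemma L_nonneg: "\<omega> \<in> space M \<Longrightarrow> 0 \<le> L k \<omega>"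
  by (auto simp: L_def intro!: sum_nonneg weight_nonneg)

text \<open>\<open>catches\<close> is a cardinality. As the partial sums are nondecreasing, the
  counted set is an initial segment of the positive numbers, so its size decides membership.\<close>

lemma catches_ge_iff:
  assumes w: "\<omega> \<in> space M" and i: "i \<in> {1, 2}"
  shows "n \<le> catches S i u \<omega> \<longleftrightarrow> n = 0 \<or> (\<Sum>k=1..n. S i k \<omega>) \<le> u"
proof -
  let ?A = "{n. 1 \<le> n \<and> (\<Sum>k=1..n. S i k \<omega>) \<le> u}"
  have mono: "(\<Sum>k=1..m. S i k \<omega>) \<le> (\<Sum>k=1..n. S i k \<omega>)" if "m \<le> n" for m n
    using that i w waiting_nonneg by (intro sum_mono2) auto
  have fin: "finite ?A" by (rule finite_catches[OF i w])
  show ?thesis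
  proof (cases "n = 0")
    case False
    show ?thesis
    proof
      assume "n \<le> catches S i u \<omega>"
      then have "n \<le> card ?A" by (simp add: catches_def)
      have "\<not> ?A \<subseteq> {1..<n}"
      proof
        assume "?A \<subseteq> {1..<n}"
        then have "card ?A \<le> card {1..<n}" by (intro card_mono) auto
        then show False using \<open>n \<le> card ?A\<close> False by simp
      qed
      then obtain m where "m \<in> ?A" "n \<le> m" by force
      then show "n = 0 \<or> (\<Sum>k=1..n. S i k \<omega>) \<le> u" using mono[of n m] by force
    next
      assume "n = 0 \<or> (\<Sum>k=1..n. S i k \<omega>) \<le> u"
      then have "{1..n} \<subseteq> ?A" using False mono by (force intro: order_trans)
      then have "card {1..n} \<le> card ?A" by (intro card_mono fin)
      then show "n \<le> catches S i u \<omega>" by (simp add: catches_def)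
    qed
  qed simp
qed

lemma catches_2_ge_iff:
  "\<omega> \<in> space M \<Longrightarrow> n \<le> catches S 2 (t - s) \<omega> \<longleftrightarrow> n = 0 \<or> T n \<omega> \<le> t"
  by (subst catches_ge_iff) (auto simp: arrival_def)

lemma T_unbounded: "\<omega> \<in> space M \<Longrightarrow> \<exists>n. u < T n \<omega>"
  using catches_2_ge_iff[of \<omega> "Suc (catches S 2 (u - s) \<omega>)" u] by (auto simp: not_le intro: exI[of _ "Suc (catches S 2 (u - s) \<omega>)"])

subsection \<open>The next catch is independent of the past\<close>

text \<open>The indices of the next waiting time and weight are disjoint from
  \<open>past_index k\<close>, and disjoint blocks of an independent family are independent.\<close>

lemma past_indep_next:
  assumes A: "A \<in> sets (past k)" and B: "B \<in> sets (borel \<Otimes>\<^sub>M borel)"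
  shows "prob (A \<inter> ((\<lambda>\<omega>. (S 2 (Suc k) \<omega>, X 2 (Suc k) \<omega>)) -` B \<inter> space M)) =
    prob A * prob ((\<lambda>\<omega>. (S 2 (Suc k) \<omega>, X 2 (Suc k) \<omega>)) -` B \<inter> space M)"
proof -
  let ?P = "\<lambda>\<omega>. restrict (\<lambda>i. V i \<omega>) (past_index k)"
  let ?J = "{Inl (2, Suc k), Inr (2, Suc k)} :: ((nat \<times> nat) + (nat \<times> nat)) set"
  let ?Q = "\<lambda>\<omega>. restrict (\<lambda>i. V i \<omega>) ?J"
  let ?N = "\<lambda>\<omega>. (S 2 (Suc k) \<omega>, X 2 (Suc k) \<omega>)"
  let ?h = "\<lambda>q :: ((nat \<times> nat) + (nat \<times> nat)) \<Rightarrow> real. (q (Inl (2, Suc k)), q (Inr (2, Suc k)))"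
  obtain A' where A': "A' \<in> sets (PiM (past_index k) (\<lambda>_. borel))" "A = ?P -` A' \<inter> space M"
    using A unfolding past_def by (auto simp: sets_vimage_algebra2 space_PiM)
  have ind: "indep_var (PiM (past_index k) (\<lambda>_. borel)) ?P (PiM ?J (\<lambda>_. borel)) ?Q"
    by (rule indep_var_restrict[OF V_indep _ past_index_subset]) (auto simp: past_index_def)
  have h: "?h \<in> measurable (PiM ?J (\<lambda>_. borel)) (borel \<Otimes>\<^sub>M borel)"
    by (intro measurable_Pair measurable_component_singleton) auto
  let ?B' = "?h -` B \<inter> space (PiM ?J (\<lambda>_. borel))"
  have "?N -` B \<inter> space M = ?Q -` ?B' \<inter> space M"
    by (auto simp: V_def space_PiM)
  then show ?thesis
    using indep_varD[OF ind A'(1), of ?B'] measurable_sets[OF h B] unfolding A'(2)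
    by (simp add: vimage_Times) (simp add: vimage_def Int_def conj_ac)
qed

lemma S_X_indep: "1 \<le> k \<Longrightarrow> indep_var borel (S 2 k) borel (X 2 k)"
proof -
  assume k: "1 \<le> k"
  let ?a = "Inl (2, k) :: (nat \<times> nat) + (nat \<times> nat)" and ?b = "Inr (2, k) :: (nat \<times> nat) + (nat \<times> nat)"
  have "indep_var (PiM {?a} (\<lambda>_. borel)) (\<lambda>\<omega>. restrict (\<lambda>i. V i \<omega>) {?a})
      (PiM {?b} (\<lambda>_. borel)) (\<lambda>\<omega>. restrict (\<lambda>i. V i \<omega>) {?b})"
    using k by (intro indep_var_restrict[OF V_indep]) auto
  then have "indep_var borel ((\<lambda>q. q ?a) \<circ> (\<lambda>\<omega>. restrict (\<lambda>i. V i \<omega>) {?a}))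
      borel ((\<lambda>q. q ?b) \<circ> (\<lambda>\<omega>. restrict (\<lambda>i. V i \<omega>) {?b}))"
    by (rule indep_var_compose) (intro measurable_component_singleton; simp)+
  then show ?thesis by (simp add: o_def V_def)
qed

text \<open>The single-catch analysis is instantiated with the first catch at place 2. Equality of
  the joint laws, from the common density, the common weight distribution and the independence
  within each catch, transfers it to all later ones.\<close>

lemma next_distr:
  assumes "1 \<le> k"
  shows "distr M (borel \<Otimes>\<^sub>M borel) (\<lambda>\<omega>. (S 2 k \<omega>, X 2 k \<omega>)) =
    distr M (borel \<Otimes>\<^sub>M borel) (\<lambda>\<omega>. (S 2 1 \<omega>, X 2 1 \<omega>))"
proof -
  have "distr M borel (S 2 k) = density lborel (\<lambda>x. ennreal (f2 x))" if "1 \<le> k" for k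
    using distributed_distr_eq_density[OF f2_density[OF that]] by (simp cong: distr_cong)
  then have S: "distr M borel (S 2 k) = distr M borel (S 2 1)" using assms by simp
  have "real_distribution (distr M borel (X 2 k))" for k
    using X_meas[of 2 k] by (intro real_distribution_distr) auto
  then have X: "distr M borel (X 2 k) = distr M borel (X 2 1)"
    using assms weight_cdf[of 2] by (intro cdf_unique) auto
  show ?thesis
    using S_X_indep[OF assms] S_X_indep[of 1] S X unfolding indep_var_distribution_eq by simp
qed

text \<open>This replaces conditioning on the first \<open>k\<close> catches: the past is frozen at
  \<omega>, and the next catch is averaged as an independent copy of the first one.\<close>

lemma expectation_next:
  fixes h :: "'a \<times> (real \<times> real) \<Rightarrow> real"
  assumes h[measurable]: "h \<in> borel_measurable (past k \<Otimes>\<^sub>M (borel \<Otimes>\<^sub>M borel))"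
    and bound: "\<And>\<omega> p. \<omega> \<in> space M \<Longrightarrow> \<bar>h (\<omega>, p)\<bar> \<le> B"
  shows "(\<integral>\<omega>. h (\<omega>, (S 2 (Suc k) \<omega>, X 2 (Suc k) \<omega>)) \<partial>M) =
      (\<integral>\<omega>. (\<integral>\<omega>'. h (\<omega>, (S 2 1 \<omega>', X 2 1 \<omega>')) \<partial>M) \<partial>M)"
    and "(\<lambda>\<omega>. \<integral>\<omega>'. h (\<omega>, (S 2 1 \<omega>', X 2 1 \<omega>')) \<partial>M) \<in> borel_measurable (past k)"
proof -
  have [measurable]: "(\<lambda>\<omega>. (S 2 (Suc k) \<omega>, X 2 (Suc k) \<omega>)) \<in> M \<rightarrow>\<^sub>M borel \<Otimes>\<^sub>M borel"
    "(\<lambda>\<omega>. (S 2 1 \<omega>, X 2 1 \<omega>)) \<in> M \<rightarrow>\<^sub>M borel \<Otimes>\<^sub>M borel"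
    by (intro measurable_Pair; simp)+
  have id: "(\<lambda>\<omega>. \<omega>) \<in> measurable M (past k)"
    using past_subset[of k] by (auto simp: measurable_def dest: sets.sets_into_space intro: sets.Int)
  have eq: "(\<integral>\<omega>'. h (\<omega>, (S 2 (Suc k) \<omega>', X 2 (Suc k) \<omega>')) \<partial>M) = (\<integral>\<omega>'. h (\<omega>, (S 2 1 \<omega>', X 2 1 \<omega>')) \<partial>M)"
    if "\<omega> \<in> space M" for \<omega>
  proof -
    have m: "(\<lambda>p. h (\<omega>, p)) \<in> borel_measurable (borel \<Otimes>\<^sub>M borel)"
      using that by (intro measurable_compose[OF _ h] measurable_Pair1') auto
    show ?thesis
      using integral_distr[OF _ m, of "\<lambda>\<omega>. (S 2 (Suc k) \<omega>, X 2 (Suc k) \<omega>)" M]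
        integral_distr[OF _ m, of "\<lambda>\<omega>. (S 2 1 \<omega>, X 2 1 \<omega>)" M] next_distr[of "Suc k"] by simp
  qed
  have ind: "prob (((\<lambda>\<omega>. \<omega>) -` A \<inter> space M) \<inter> ((\<lambda>\<omega>. (S 2 (Suc k) \<omega>, X 2 (Suc k) \<omega>)) -` B \<inter> space M)) =
      prob ((\<lambda>\<omega>. \<omega>) -` A \<inter> space M) * prob ((\<lambda>\<omega>. (S 2 (Suc k) \<omega>, X 2 (Suc k) \<omega>)) -` B \<inter> space M)"
    if "A \<in> sets (past k)" "B \<in> sets (borel \<Otimes>\<^sub>M borel)" for A B
  proof -
    have "(\<lambda>\<omega>. \<omega>) -` A \<inter> space M = A" using sets.sets_into_space[OF that(1)] by auto
    then show ?thesis using past_indep_next[OF that] by simp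
  qed
  note * = expectation_indep_pair[OF id _ ind h, of B]
  have "(\<lambda>\<omega>. \<integral>\<omega>'. h (\<omega>, (S 2 (Suc k) \<omega>', X 2 (Suc k) \<omega>')) \<partial>M) \<in> borel_measurable (past k)"
    by (rule *(2)) (auto simp: bound)
  then show "(\<lambda>\<omega>. \<integral>\<omega>'. h (\<omega>, (S 2 1 \<omega>', X 2 1 \<omega>')) \<partial>M) \<in> borel_measurable (past k)"
    by (subst measurable_cong[OF eq[symmetric]]) auto
  have "(\<integral>\<omega>. h (\<omega>, (S 2 (Suc k) \<omega>, X 2 (Suc k) \<omega>)) \<partial>M) =
      (\<integral>\<omega>. (\<integral>\<omega>'. h (\<omega>, (S 2 (Suc k) \<omega>', X 2 (Suc k) \<omega>')) \<partial>M) \<partial>M)"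
    by (rule *(1)) (auto simp: bound)
  also have "\<dots> = (\<integral>\<omega>. (\<integral>\<omega>'. h (\<omega>, (S 2 1 \<omega>', X 2 1 \<omega>')) \<partial>M) \<partial>M)"
    by (intro Bochner_Integration.integral_cong refl eq)
  finally show "(\<integral>\<omega>. h (\<omega>, (S 2 (Suc k) \<omega>, X 2 (Suc k) \<omega>)) \<partial>M) = \<dots>" .
qed

subsection \<open>Stopping times between two catches\<close>

sublocale P2: single_catch M "X 2 1" "S 2 1" f2 "F 2" "g 2" "cost 2" "cost' 2" t0
proof
  show "bounded (g 2 ` {0..})"
  proof (rule boundedI[of _ "G 2"])
    fix z assume "z \<in> g 2 ` {0..}"
    then obtain x where "0 \<le> x" "z = g 2 x" by auto
    then show "norm z \<le> G 2" using utility_range[of 2 x] by simp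
  qed
  show "cdf (distr M borel (S 2 1)) = F 2" by (rule waiting_cdf) auto
  show "continuous_on {0..} (g 2)" by (rule utility_continuous) auto
  show "(cost 2 has_real_derivative cost' 2 t) (at t within {0..t0})" if "t \<in> {0..t0}" for t
    using that by (intro cost_derivative) auto
  show "0 \<le> S 2 1 \<omega>" "0 \<le> X 2 1 \<omega>" if "\<omega> \<in> space M" for \<omega>
    using that waiting_nonneg[of 2 1 \<omega>] weight_nonneg[of 2 1 \<omega>] by simp_all
qed (rule f2_nonneg f2_density S_X_indep F2_lt_1 horizon order_refl)+

section \<open>The filtration of the visible catches\<close>

abbreviation F1 where "F1 \<equiv> filt1 (space M) S X s"
abbreviation FF where "FF \<equiv> filt2 (space M) S X s"

lemma history_space: "history (space M) S X u i t \<subseteq> Pow (space M)"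
  by (auto simp: history_def)

lemma sets_F1: "sets F1 = sigma_sets (space M) (history (space M) S X 0 1 s)"
  unfolding filt1_def using history_space by (rule sets_measure_of)

lemma space_F1: "space F1 = space M"
  unfolding filt1_def using history_space by (rule space_measure_of)

lemma sets_FF_generators: "sets F1 \<union> history (space M) S X s 2 t \<subseteq> Pow (space M)"
  using history_space sets.space_closed[of F1] by (auto simp: space_F1)

lemma sets_FF: "sets (FF t) = sigma_sets (space M) (sets F1 \<union> history (space M) S X s 2 t)"
  unfolding filt2_def using sets_FF_generators by (rule sets_measure_of)

lemma space_FF [simp]: "space (FF t) = space M"
  unfolding filt2_def using sets_FF_generators by (rule space_measure_of)

text \<open>Whether the \<open>n\<close>-th catch at place 1 is made by time \<open>s\<close> is
  decided by waiting times at place 1, all of which belong to every \<open>past k\<close>.\<close>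

lemma F1_past: "sets F1 \<subseteq> sets (past k)"
proof -
  have "history (space M) S X 0 1 s \<subseteq> sets (past k)"
  proof
    fix B assume "B \<in> history (space M) S X 0 1 s"
    then obtain n Z A where B: "B = {\<omega> \<in> space M. n \<le> catches S 1 s \<omega> \<and> Z \<omega> \<in> A}"
      "Z = X 1 n \<or> Z = arrival S 0 1 n" and A[measurable]: "A \<in> sets borel"
      by (auto simp: history_def)
    have sum[measurable]: "(\<lambda>\<omega>. \<Sum>j=1..n. S 1 j \<omega>) \<in> borel_measurable (past k)"
      by (intro borel_measurable_sum past_S) auto
    then have Z[measurable]: "Z \<in> borel_measurable (past k)"
      using B(2) past_X[of 1 n k] by (auto simp: arrival_def[abs_def])
    have "B = {\<omega> \<in> space (past k). (n = 0 \<or> (\<Sum>j=1..n. S 1 j \<omega>) \<le> s) \<and> Z \<omega> \<in> A}"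
      unfolding B(1) using catches_ge_iff[of _ 1 n s] by auto
    also have "\<dots> \<in> sets (past k)" by measurable
    finally show "B \<in> sets (past k)" .
  qed
  then show ?thesis unfolding sets_F1 using sets.sigma_sets_subset[of _ "past k"] by simp
qed

lemma F1_FF: "sets F1 \<subseteq> sets (FF t)"
  unfolding sets_FF by (auto intro: sigma_sets.Basic)

lemma FF_history: "B \<in> history (space M) S X s 2 t \<Longrightarrow> B \<in> sets (FF t)"
  unfolding sets_FF by (auto intro: sigma_sets.Basic)

lemma history_2E:
  assumes "B \<in> history (space M) S X s 2 t"
  obtains n Z A where "B = {\<omega> \<in> space M. n \<le> catches S 2 (t - s) \<omega> \<and> Z \<omega> \<in> A}"
    "Z = X 2 n \<or> Z = T n" "A \<in> sets borel"
  using assms unfolding history_def if_P[OF refl] mem_Collect_eq insert_iff empty_iff by blast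

text \<open>The disjunct \<open>n = 0\<close> is needed because the zeroth entry is present at all
  times, even for \<open>t < s\<close>, when \<open>T 0 \<omega> \<le> t\<close> fails.\<close>

lemma FF_event:
  assumes "Z = X 2 n \<or> Z = T n" "A \<in> sets borel"
  shows "{\<omega> \<in> space M. (n = 0 \<or> T n \<omega> \<le> t) \<and> Z \<omega> \<in> A} \<in> sets (FF t)"
proof -
  have "{\<omega> \<in> space M. (n = 0 \<or> T n \<omega> \<le> t) \<and> Z \<omega> \<in> A} = {\<omega> \<in> space M. n \<le> catches S 2 (t - s) \<omega> \<and> Z \<omega> \<in> A}"
    using catches_2_ge_iff[of _ n t] by auto
  also have "\<dots> \<in> history (space M) S X s 2 t"
    unfolding history_def by (intro CollectI exI[of _ n] exI[of _ Z] exI[of _ A]) (use assms in auto)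
  finally show ?thesis by (rule FF_history)
qed

lemma FF_event_T: "{\<omega> \<in> space M. T n \<omega> \<le> t} \<in> sets (FF t)"
proof (cases "n = 0")
  case True
  have "{\<omega> \<in> space M. T n \<omega> \<le> t} = (if s \<le> t then space (FF t) else {})"
    by (auto simp: True T_0)
  then show ?thesis by (simp del: space_FF)
next
  case False
  then show ?thesis using FF_event[of "T n" n UNIV t] by simp
qed

lemma FF_truncated:
  assumes "Z = X 2 n \<or> Z = T n"
  shows "(\<lambda>\<omega>. if T n \<omega> \<le> t then Z \<omega> else 0) \<in> borel_measurable (FF t)"
proof (rule measurableI)
  fix A :: "real set" assume A: "A \<in> sets borel"
  have "(\<lambda>\<omega>. if T n \<omega> \<le> t then Z \<omega> else 0) -` A \<inter> space (FF t) =
    {\<omega> \<in> space M. (n = 0 \<or> T n \<omega> \<le> t) \<and> Z \<omega> \<in> A} \<inter> {\<omega> \<in> space M. T n \<omega> \<le> t} \<union>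
    (if 0 \<in> A then space M - {\<omega> \<in> space M. T n \<omega> \<le> t} else {})"
    by (auto split: if_splits)
  also have "\<dots> \<in> sets (FF t)"
  proof (intro sets.Un sets.Int FF_event[OF assms A] FF_event_T)
    have "space M - {\<omega> \<in> space M. T n \<omega> \<le> t} \<in> sets (FF t)"
      using sets.compl_sets[OF FF_event_T[of n t]] by (simp only: space_FF)
    then show "(if 0 \<in> A then space M - {\<omega> \<in> space M. T n \<omega> \<le> t} else {}) \<in> sets (FF t)"
      by (cases "0 \<in> A") (simp_all only: if_True if_False sets.empty_sets)
  qed
  finally show "(\<lambda>\<omega>. if T n \<omega> \<le> t then Z \<omega> else 0) -` A \<inter> space (FF t) \<in> sets (FF t)" .
qed auto

lemma FF_mono: "t \<le> u \<Longrightarrow> sets (FF t) \<subseteq> sets (FF u)"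
proof -
  assume tu: "t \<le> u"
  have "B \<in> sets (FF u)" if hB: "B \<in> history (space M) S X s 2 t" for B
  proof -
    obtain n Z A where B: "B = {\<omega> \<in> space M. n \<le> catches S 2 (t - s) \<omega> \<and> Z \<omega> \<in> A}"
      and Z: "Z = X 2 n \<or> Z = T n" and A: "A \<in> sets borel"
      using hB by (rule history_2E)
    show ?thesis
    proof (cases "n = 0")
      case True
      then have "B = {\<omega> \<in> space M. (n = 0 \<or> T n \<omega> \<le> u) \<and> Z \<omega> \<in> A}" unfolding B by auto
      then show ?thesis by (simp only:) (intro FF_event Z A)
    next
      case False
      \<comment> \<open>At the later time \<open>u\<close>, visibility at \<open>t\<close> is
        recovered from the recorded catch time \<open>T n\<close> itself.\<close>
      then have "B = {\<omega> \<in> space M. (n = 0 \<or> T n \<omega> \<le> u) \<and> Z \<omega> \<in> A} \<inter>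
          {\<omega> \<in> space M. (n = 0 \<or> T n \<omega> \<le> u) \<and> T n \<omega> \<in> {..t}}"
        unfolding B using catches_2_ge_iff[of _ n t] tu by auto
      then show ?thesis by (simp only:) (intro sets.Int FF_event Z A; simp)
    qed
  qed
  then show ?thesis
    unfolding sets_FF[of t] using sets.sigma_sets_subset[of "sets F1 \<union> history (space M) S X s 2 t" "FF u"] F1_FF[of u]
    by (simp add: subset_iff)
qed

sublocale FF: filtration "space M" FF
  by unfold_locales (auto dest: FF_mono)

lemma FF_subset: "sets (FF t) \<subseteq> sets M"
proof -
  have "B \<in> sets M" if hB: "B \<in> history (space M) S X s 2 t" for B
  proof -
    obtain n Z A where B: "B = {\<omega> \<in> space M. n \<le> catches S 2 (t - s) \<omega> \<and> Z \<omega> \<in> A}"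
      and Z: "Z = X 2 n \<or> Z = T n" and A[measurable]: "A \<in> sets borel"
      using hB by (rule history_2E)
    have [measurable]: "Z \<in> borel_measurable M" "T n \<in> borel_measurable M"
      using Z X_meas[of 2 n] past_measurable_M[OF past_T] by auto
    have "B = {\<omega> \<in> space M. (n = 0 \<or> T n \<omega> \<le> t) \<and> Z \<omega> \<in> A}"
      unfolding B using catches_2_ge_iff[of _ n t] by auto
    then show ?thesis by simp
  qed
  then show ?thesis
    unfolding sets_FF using F1_past[of 0] past_subset[of 0] by (intro sets.sigma_sets_subset) auto
qed

lemma stopping_time_T: "stopping_time FF (T n)"
  unfolding stopping_time_def pred_def using FF_event_T by simp

text \<open>While the \<open>k\<close>-th catch is the last one made, a generator with
  \<open>n \<le> k\<close> concerns an entry known from the past, and one with \<open>n > k\<close>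
  is empty there. Agreement with a past event on this stretch survives complements and countable
  unions.\<close>

lemma FF_trace_past:
  assumes "B \<in> sets (FF t)"
  shows "\<exists>B'\<in>sets (past k). \<forall>\<omega>\<in>space M. T k \<omega> \<le> t \<and> t < T (Suc k) \<omega> \<longrightarrow> (\<omega> \<in> B \<longleftrightarrow> \<omega> \<in> B')"
  using assms unfolding sets_FF
proof (induction rule: sigma_sets.induct)
  case (Basic B)
  show ?case
  proof (cases "B \<in> sets F1")
    case True
    then show ?thesis using F1_past[of k] by blast
  next
    case False
    then obtain n Z A where B: "B = {\<omega> \<in> space M. n \<le> catches S 2 (t - s) \<omega> \<and> Z \<omega> \<in> A}"
      and Z: "Z = X 2 n \<or> Z = T n" and A[measurable]: "A \<in> sets borel"
      using Basic by (auto elim: history_2E)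
    show ?thesis
    proof (cases "n \<le> k")
      case True
      then have [measurable]: "Z \<in> borel_measurable (past k)"
        using Z past_X[of 2 n k] past_measurable_mono[OF True past_T] by auto
      have "n \<le> catches S 2 (t - s) \<omega>" if "\<omega> \<in> space M" "T k \<omega> \<le> t" for \<omega>
        using that T_mono[OF that(1) True] by (subst catches_2_ge_iff) auto
      moreover have "{\<omega> \<in> space (past k). Z \<omega> \<in> A} \<in> sets (past k)" by measurable
      ultimately show ?thesis unfolding B by (intro bexI[of _ "{\<omega> \<in> space (past k). Z \<omega> \<in> A}"]) auto
    next
      case False
      then have "\<not> n \<le> catches S 2 (t - s) \<omega>" if "\<omega> \<in> space M" "t < T (Suc k) \<omega>" for \<omega>
        using that T_mono[OF that(1), of "Suc k" n] by (subst catches_2_ge_iff) auto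
      then show ?thesis unfolding B by (intro bexI[of _ "{}"]) auto
    qed
  qed
next
  case Empty
  then show ?case by blast
next
  case (Compl B)
  then obtain B' where "B' \<in> sets (past k)"
    "\<forall>\<omega>\<in>space M. T k \<omega> \<le> t \<and> t < T (Suc k) \<omega> \<longrightarrow> (\<omega> \<in> B \<longleftrightarrow> \<omega> \<in> B')" by auto
  then show ?case
    using sets.compl_sets[of B' "past k"] by (intro bexI[of _ "space (past k) - B'"]) auto
next
  case (Union B)
  then obtain B' where "\<And>i. B' i \<in> sets (past k)"
    "\<And>i. \<forall>\<omega>\<in>space M. T k \<omega> \<le> t \<and> t < T (Suc k) \<omega> \<longrightarrow> (\<omega> \<in> B i \<longleftrightarrow> \<omega> \<in> B' i)" by metis
  then show ?case by (intro bexI[of _ "\<Union>i::nat. B' i"]) auto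
qed

text \<open>For each \<open>t\<close> the trace yields a past event \<open>B t\<close> that decides
  \<open>\<sigma> \<le> t\<close> as long as the next catch is still to come. These events are
  chosen separately for each \<open>t\<close> and need not increase with \<open>t\<close>, so \<rho>
  is an infimum over rational times only, which keeps it measurable. Extended values are needed
  twice: \<rho> is infinite if no rational time qualifies, and \<open>pre_sigma_past\<close> uses a
  \<sigma> that is infinite off an event.\<close>

lemma stopping_time_between_catches:
  fixes \<sigma> :: "'a \<Rightarrow> ereal"
  assumes \<sigma>: "\<And>t. {\<omega> \<in> space M. \<sigma> \<omega> \<le> ereal t} \<in> sets (FF t)"
  obtains \<rho> where "\<rho> \<in> borel_measurable (past k)"
    and "\<And>\<omega>. \<omega> \<in> space M \<Longrightarrow> ereal (T k \<omega>) \<le> \<rho> \<omega>"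
    and "\<And>\<omega>. \<omega> \<in> space M \<Longrightarrow> ereal (T k \<omega>) \<le> \<sigma> \<omega> \<Longrightarrow> \<sigma> \<omega> < ereal (T (Suc k) \<omega>) \<Longrightarrow> \<rho> \<omega> = \<sigma> \<omega>"
    and "\<And>\<omega>. \<omega> \<in> space M \<Longrightarrow> ereal (T (Suc k) \<omega>) \<le> \<sigma> \<omega> \<Longrightarrow> ereal (T (Suc k) \<omega>) \<le> \<rho> \<omega>"
proof -
  obtain B where B[measurable]: "\<And>t. B t \<in> sets (past k)"
    and trace: "\<And>t \<omega>. \<omega> \<in> space M \<Longrightarrow> T k \<omega> \<le> t \<Longrightarrow> t < T (Suc k) \<omega> \<Longrightarrow> \<sigma> \<omega> \<le> ereal t \<longleftrightarrow> \<omega> \<in> B t"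
  proof -
    define R where "R t B' \<longleftrightarrow> B' \<in> sets (past k) \<and> (\<forall>\<omega>\<in>space M. T k \<omega> \<le> t \<and> t < T (Suc k) \<omega> \<longrightarrow>
        (\<omega> \<in> {\<omega> \<in> space M. \<sigma> \<omega> \<le> ereal t} \<longleftrightarrow> \<omega> \<in> B'))" for t B'
    have "\<forall>t. \<exists>B'. R t B'"
      unfolding R_def using FF_trace_past[OF \<sigma>] by blast
    from choice[OF this] obtain B where R: "\<And>t. R t (B t)" by blast
    show thesis
    proof (rule that[of B])
      show "B t \<in> sets (past k)" for t using R[of t] unfolding R_def by blast
      show "\<sigma> \<omega> \<le> ereal t \<longleftrightarrow> \<omega> \<in> B t"
        if "\<omega> \<in> space M" "T k \<omega> \<le> t" "t < T (Suc k) \<omega>" for t \<omega>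
        using R[of t] that unfolding R_def by blast
    qed
  qed
  \<comment> \<open>Times before \<open>T k\<close> are discarded, since the trace says nothing
    about them; this also gives \<open>T k \<le> \<rho>\<close>.\<close>
  let ?v = "\<lambda>q \<omega>. if T k \<omega> \<le> real_of_rat q \<and> \<omega> \<in> B (real_of_rat q) then ereal (real_of_rat q) else \<infinity>"
  define \<rho> where "\<rho> \<omega> = (INF q. ?v q \<omega>)" for \<omega>
  note [measurable] = past_T[of k]
  have lower: "x \<le> \<rho> \<omega>" if "\<And>q. T k \<omega> \<le> real_of_rat q \<Longrightarrow> \<omega> \<in> B (real_of_rat q) \<Longrightarrow> x \<le> ereal (real_of_rat q)" for x \<omega>
    unfolding \<rho>_def using that by (intro INF_greatest) auto
  show thesis
  proof (rule that)
    show "\<rho> \<in> borel_measurable (past k)" unfolding \<rho>_def by measurable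
  next
    fix \<omega> assume w: "\<omega> \<in> space M"
    show "ereal (T k \<omega>) \<le> \<rho> \<omega>" by (rule lower) simp
    show "ereal (T (Suc k) \<omega>) \<le> \<rho> \<omega>" if "ereal (T (Suc k) \<omega>) \<le> \<sigma> \<omega>"
    proof (rule lower)
      fix q assume q: "T k \<omega> \<le> real_of_rat q" "\<omega> \<in> B (real_of_rat q)"
      show "ereal (T (Suc k) \<omega>) \<le> ereal (real_of_rat q)"
      proof (rule ccontr)
        assume "\<not> ereal (T (Suc k) \<omega>) \<le> ereal (real_of_rat q)"
        then have *: "real_of_rat q < T (Suc k) \<omega>" by simp
        have "\<sigma> \<omega> \<le> ereal (real_of_rat q)" using trace[OF w q(1) *] q(2) by simp
        also have "\<dots> < ereal (T (Suc k) \<omega>)" using * by simp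
        finally show False using that by simp
      qed
    qed
    show "\<rho> \<omega> = \<sigma> \<omega>" if 1: "ereal (T k \<omega>) \<le> \<sigma> \<omega>" and 2: "\<sigma> \<omega> < ereal (T (Suc k) \<omega>)"
    proof (rule antisym)
      obtain x where x: "\<sigma> \<omega> = ereal x" using 1 2 by (cases "\<sigma> \<omega>") auto
      show "\<sigma> \<omega> \<le> \<rho> \<omega>"
      proof (rule lower)
        fix q assume q: "T k \<omega> \<le> real_of_rat q" "\<omega> \<in> B (real_of_rat q)"
        show "\<sigma> \<omega> \<le> ereal (real_of_rat q)"
        proof (cases "real_of_rat q < T (Suc k) \<omega>")
          case True then show ?thesis using trace[OF w q(1) True] q(2) by simp
        next
          case False
          then have "ereal (T (Suc k) \<omega>) \<le> ereal (real_of_rat q)" by simp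
          then show ?thesis using 2 by order
        qed
      qed
      show "\<rho> \<omega> \<le> \<sigma> \<omega>"
      proof (rule ccontr)
        assume "\<not> \<rho> \<omega> \<le> \<sigma> \<omega>"
        then have "\<sigma> \<omega> < min (\<rho> \<omega>) (ereal (T (Suc k) \<omega>))" using 2 by simp
        then obtain z where z: "\<sigma> \<omega> < ereal z" "ereal z < min (\<rho> \<omega>) (ereal (T (Suc k) \<omega>))"
          using ereal_dense2 by blast
        then have "x < z" using x by simp
        then obtain q where q: "x < real_of_rat q" "real_of_rat q < z" using of_rat_dense by blast
        have 3: "T k \<omega> \<le> real_of_rat q" "real_of_rat q < T (Suc k) \<omega>" using q z 1 x by auto
        then have "\<omega> \<in> B (real_of_rat q)" using trace[OF w 3] q x by simp
        then have "\<rho> \<omega> \<le> ereal (real_of_rat q)"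
          unfolding \<rho>_def using 3 by (intro INF_lower2[of q]) auto
        also have "\<dots> < \<rho> \<omega>" using q z by (auto intro: less_trans[of _ "ereal z"])
        finally show False by simp
      qed
    qed
  qed
qed

text \<open>The density excludes a zero waiting time for the first catch, and equality in law
  transfers this to every later one.\<close>

lemma AE_S_pos: "AE \<omega> in M. \<forall>k\<ge>1. 0 < S 2 k \<omega>"
proof -
  have "AE \<omega> in M. 0 < S 2 k \<omega>" if k: "1 \<le> k" for k
  proof -
    have "AE x in distr M (borel \<Otimes>\<^sub>M borel) (\<lambda>\<omega>. (S 2 k \<omega>, X 2 k \<omega>)). 0 < fst x"
      unfolding next_distr[OF k] using P2.AE_S_pos
      by (subst AE_distr_iff) (auto intro!: measurable_Pair)
    then show ?thesis using k by (subst (asm) AE_distr_iff) (auto intro!: measurable_Pair)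
  qed
  then show ?thesis by (simp add: AE_all_countable AE_impI)
qed

text \<open>The proof uses the stopping time that is \<open>T n\<close> on \<open>A\<close> and \<open>\<infinity>\<close> elsewhere.\<close>

lemma pre_sigma_past:
  assumes A: "A \<in> sets (FF.pre_sigma (T n))"
  obtains A' where "A' \<in> sets (past n)" "\<And>\<omega>. \<omega> \<in> space M \<Longrightarrow> 0 < S 2 (Suc n) \<omega> \<Longrightarrow> \<omega> \<in> A \<longleftrightarrow> \<omega> \<in> A'"
proof -
  let ?\<sigma> = "\<lambda>\<omega>. if \<omega> \<in> A then ereal (T n \<omega>) else \<infinity>"
  have AM: "A \<subseteq> space M" using sets.sets_into_space[OF A] by (simp add: FF.space_pre_sigma)
  have "{\<omega> \<in> space M. ?\<sigma> \<omega> \<le> ereal t} \<in> sets (FF t)" for t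
  proof -
    have "{\<omega> \<in> space M. ?\<sigma> \<omega> \<le> ereal t} = {\<omega> \<in> A. T n \<omega> \<le> t}" using AM by auto
    then show ?thesis using FF.sets_pre_sigmaD[OF stopping_time_T A] by simp
  qed
  then obtain \<rho> where [measurable]: "\<rho> \<in> borel_measurable (past n)"
    and "\<And>\<omega>. \<omega> \<in> space M \<Longrightarrow> ereal (T n \<omega>) \<le> \<rho> \<omega>"
    and \<rho>: "\<And>\<omega>. \<omega> \<in> space M \<Longrightarrow> ereal (T n \<omega>) \<le> ?\<sigma> \<omega> \<Longrightarrow> ?\<sigma> \<omega> < ereal (T (Suc n) \<omega>) \<Longrightarrow> \<rho> \<omega> = ?\<sigma> \<omega>"
      "\<And>\<omega>. \<omega> \<in> space M \<Longrightarrow> ereal (T (Suc n) \<omega>) \<le> ?\<sigma> \<omega> \<Longrightarrow> ereal (T (Suc n) \<omega>) \<le> \<rho> \<omega>"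
    by (rule stopping_time_between_catches[where k = n]) (rule that)
  note [measurable] = past_T[of n]
  show thesis
  proof (rule that)
    \<comment> \<open>The wanted event is that \<rho> stops at once. On \<open>A\<close> it does;
      off \<open>A\<close> the infinite value pushes \<rho> to the next catch or later, which is
      strictly after \<open>T n\<close> when the waiting time is positive.\<close>
    show "{\<omega> \<in> space (past n). \<rho> \<omega> \<le> ereal (T n \<omega>)} \<in> sets (past n)" by measurable
    fix \<omega> assume w: "\<omega> \<in> space M" and pos: "0 < S 2 (Suc n) \<omega>"
    show "\<omega> \<in> A \<longleftrightarrow> \<omega> \<in> {\<omega> \<in> space (past n). \<rho> \<omega> \<le> ereal (T n \<omega>)}"
    proof (cases "\<omega> \<in> A")
      case True
      then show ?thesis using \<rho>(1)[OF w] pos w by (simp add: T_Suc)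
    next
      case False
      then have "ereal (T n \<omega>) < \<rho> \<omega>" using \<rho>(2)[OF w] pos
        by (auto simp: T_Suc intro: less_le_trans[of _ "ereal (T n \<omega> + S 2 (Suc n) \<omega>)"])
      then show ?thesis using False by auto
    qed
  qed
qed

subsection \<open>The payoff after the next catch\<close>

abbreviation good where "good \<omega> \<equiv> \<omega> \<in> space M \<and> (\<forall>k\<ge>1. 0 < S 2 k \<omega>)"

definition g1 :: "real \<Rightarrow> real" where "g1 x = g 1 (max 0 x)"
definition M1 :: "'a \<Rightarrow> real" where "M1 \<omega> = (\<Sum>n=1..catches S 1 s \<omega>. X 1 n \<omega>)"
definition W0 :: "'a \<Rightarrow> real" where "W0 \<omega> = g1 (M1 \<omega>) - cost 1 s"
text \<open>\<open>pay\<close> and \<open>gam\<close> are the payoff and \<open>gamma\<close> as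
  functions of the value \<open>w\<close> secured at place 1, the mass \<open>l\<close> caught at
  place 2 and the time \<open>t\<close>. The extended functions make them Borel without conditions
  on the domain.\<close>

definition pay :: "real \<Rightarrow> real \<Rightarrow> real \<Rightarrow> real" where
  "pay w l t = (if t \<le> t0 then w + P2.g_ext l - P2.k_ext (t - s) else - (C 1 + C 2))"
definition gam :: "real \<Rightarrow> real \<Rightarrow> real \<Rightarrow> real" where
  "gam w l t = (if t \<le> t0 then w + P2.g_ext l - P2.k_ext (t - s) + P2.state_ext P2.Y l (t - s) (t0 - t)
     else - (C 1 + C 2))"

lemma AE_good: "AE \<omega> in M. good \<omega>"
  using AE_S_pos AE_space by eventually_elim auto

lemma g1_meas[measurable]: "g1 \<in> borel_measurable borel"
proof -
  have "continuous_on UNIV g1"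
    unfolding g1_def by (rule continuous_on_compose2[OF utility_continuous[of 1]]) (auto intro!: continuous_intros)
  then show ?thesis by (rule borel_measurable_continuous_onI)
qed

lemma M1_F1: "M1 \<in> borel_measurable F1"
proof -
  have sub: "{\<omega> \<in> space M. n \<le> catches S 1 s \<omega> \<and> X 1 n \<omega> \<in> A} \<in> sets F1" if "A \<in> sets borel" for n A
  proof -
    have "{\<omega> \<in> space M. n \<le> catches S 1 s \<omega> \<and> X 1 n \<omega> \<in> A} \<in> history (space M) S X 0 1 s"
      unfolding history_def by (intro CollectI exI[of _ n] exI[of _ "X 1 n"] exI[of _ A]) (use that in auto)
    then show ?thesis unfolding sets_F1 by (rule sigma_sets.Basic)
  qed
  have K: "{\<omega> \<in> space F1. n \<le> catches S 1 s \<omega>} \<in> sets F1" for n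
    using sub[of UNIV n] by (simp add: space_F1)
  show ?thesis unfolding M1_def[abs_def]
  proof (rule random_sum_measurable[OF K])
    show "(\<lambda>\<omega>. if n \<le> catches S 1 s \<omega> then X 1 n \<omega> else 0) \<in> borel_measurable F1" for n
    proof (rule measurableI)
      fix A :: "real set" assume A: "A \<in> sets borel"
      have "(\<lambda>\<omega>. if n \<le> catches S 1 s \<omega> then X 1 n \<omega> else 0) -` A \<inter> space F1 =
        {\<omega> \<in> space M. n \<le> catches S 1 s \<omega> \<and> X 1 n \<omega> \<in> A} \<union>
        (if 0 \<in> A then space F1 - {\<omega> \<in> space F1. n \<le> catches S 1 s \<omega>} else {})"
        by (auto simp: space_F1 split: if_splits)
      also have "\<dots> \<in> sets F1"
        using sub[OF A, of n] sets.compl_sets[OF K[of n]] by (intro sets.Un) (simp_all split: if_split)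
      finally show "(\<lambda>\<omega>. if n \<le> catches S 1 s \<omega> then X 1 n \<omega> else 0) -` A \<inter> space F1 \<in> sets F1" .
    qed auto
  qed
qed

lemma W0_F1: "W0 \<in> borel_measurable F1"
  unfolding W0_def[abs_def] using M1_F1 by measurable

lemma W0_past: "W0 \<in> borel_measurable (past k)"
  using W0_F1 F1_past[of k] by (auto simp: measurable_def space_F1)

lemma M1_nonneg: "\<omega> \<in> space M \<Longrightarrow> 0 \<le> M1 \<omega>"
  unfolding M1_def by (intro sum_nonneg weight_nonneg) auto

lemma W0_bound: "\<omega> \<in> space M \<Longrightarrow> \<bar>W0 \<omega>\<bar> \<le> G 1 + \<bar>cost 1 s\<bar>"
  using utility_range[of 1 "M1 \<omega>"] M1_nonneg[of \<omega>] by (auto simp: W0_def g1_def)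

lemma W0_lower: "\<omega> \<in> space M \<Longrightarrow> s \<le> t0 \<Longrightarrow> - C 1 \<le> W0 \<omega>"
  using utility_range[of 1 "M1 \<omega>"] M1_nonneg[of \<omega>] cost_range[of 1 s] s_nonneg by (auto simp: W0_def g1_def)

lemma bounded_Y: "bounded_continuous3 (P2.state_ext P2.Y)"
  by (rule P2.bounded_continuous3_state_ext[OF P2.Y_B_space])

lemma pay_meas[measurable (raw)]:
  assumes [measurable]: "w \<in> borel_measurable N" "l \<in> borel_measurable N" "t \<in> borel_measurable N"
  shows "(\<lambda>x. pay (w x) (l x) (t x)) \<in> borel_measurable N"
  unfolding pay_def by measurable

lemma gam_meas[measurable (raw)]:
  assumes [measurable]: "w \<in> borel_measurable N" "l \<in> borel_measurable N" "t \<in> borel_measurable N"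
  shows "(\<lambda>x. gam (w x) (l x) (t x)) \<in> borel_measurable N"
proof -
  have [measurable]: "(\<lambda>x. P2.state_ext P2.Y (l x) (t x - s) (t0 - t x)) \<in> borel_measurable N"
    by (intro bounded_continuous3_measurable[OF bounded_Y]) auto
  show ?thesis unfolding gam_def by measurable
qed

lemma pay_gam_bound:
  obtains B where "\<And>w l t. \<bar>w\<bar> \<le> G 1 + \<bar>cost 1 s\<bar> \<Longrightarrow> \<bar>pay w l t\<bar> \<le> B"
    "\<And>w l t. \<bar>w\<bar> \<le> G 1 + \<bar>cost 1 s\<bar> \<Longrightarrow> \<bar>gam w l t\<bar> \<le> B"
proof -
  obtain B1 where B1: "\<And>x. \<bar>P2.g_ext x\<bar> \<le> B1" using P2.g_ext_bound by blast
  obtain B2 where B2: "\<And>x. \<bar>P2.k_ext x\<bar> \<le> B2" using P2.k_ext_bound by blast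
  obtain B3 where B3: "\<And>a b c. \<bar>P2.state_ext P2.Y a b c\<bar> \<le> B3"
    using bounded_Y unfolding bounded_continuous3_def by blast
  define B where "B = \<bar>G 1 + \<bar>cost 1 s\<bar>\<bar> + \<bar>B1\<bar> + \<bar>B2\<bar> + \<bar>B3\<bar> + \<bar>C 1 + C 2\<bar>"
  show thesis
  proof (rule that)
    fix w l t assume w: "\<bar>w\<bar> \<le> G 1 + \<bar>cost 1 s\<bar>"
    show "\<bar>pay w l t\<bar> \<le> B"
      using w B1[of l] B2[of "t - s"] unfolding pay_def B_def by (cases "t \<le> t0") simp_all
    show "\<bar>gam w l t\<bar> \<le> B"
      using w B1[of l] B2[of "t - s"] B3[of l "t - s" "t0 - t"] unfolding gam_def B_def by (cases "t \<le> t0") simp_all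
  qed
qed

text \<open>One step of dynamic programming: stop at \<rho> if this precedes the next catch,
  otherwise take the catch and receive the continuation value. A tie counts as taking the catch, in
  agreement with \<open>x \<le> r\<close> in \<open>gain\<close>.\<close>

definition after_next :: "real \<Rightarrow> real \<Rightarrow> real \<Rightarrow> ereal \<Rightarrow> real \<times> real \<Rightarrow> real" where
  "after_next w l t \<rho> = (\<lambda>(x, y).
     if \<rho> < ereal (t + x) then pay w l (real_of_ereal \<rho>) else gam w (l + y) (t + x))"

definition mean_after_next :: "real \<Rightarrow> real \<Rightarrow> real \<Rightarrow> ereal \<Rightarrow> real" where
  "mean_after_next w l t \<rho> = (\<integral>\<omega>. after_next w l t \<rho> (S 2 1 \<omega>, X 2 1 \<omega>) \<partial>M)"

lemma after_next_meas[measurable (raw)]: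
  assumes [measurable]: "w \<in> borel_measurable N" "l \<in> borel_measurable N" "t \<in> borel_measurable N"
    "\<rho> \<in> borel_measurable N" "x \<in> borel_measurable N" "y \<in> borel_measurable N"
  shows "(\<lambda>z. after_next (w z) (l z) (t z) (\<rho> z) (x z, y z)) \<in> borel_measurable N"
  unfolding after_next_def by measurable

lemma after_next_bound:
  "\<exists>B. \<forall>w l t \<rho> p. \<bar>w\<bar> \<le> G 1 + \<bar>cost 1 s\<bar> \<longrightarrow> \<bar>after_next w l t \<rho> p\<bar> \<le> B"
proof -
  obtain B where B: "\<And>w l t. \<bar>w\<bar> \<le> G 1 + \<bar>cost 1 s\<bar> \<Longrightarrow> \<bar>pay w l t\<bar> \<le> B"
    "\<And>w l t. \<bar>w\<bar> \<le> G 1 + \<bar>cost 1 s\<bar> \<Longrightarrow> \<bar>gam w l t\<bar> \<le> B" by (rule pay_gam_bound) (rule that)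
  show ?thesis by (intro exI[of _ B]) (auto simp: after_next_def B split: prod.split)
qed

lemma integrable_after_next:
  assumes "\<bar>w\<bar> \<le> G 1 + \<bar>cost 1 s\<bar>"
  shows "integrable M (\<lambda>\<omega>. after_next w l t \<rho> (S 2 1 \<omega>, X 2 1 \<omega>))"
proof -
  obtain B where "\<forall>w l t \<rho> p. \<bar>w\<bar> \<le> G 1 + \<bar>cost 1 s\<bar> \<longrightarrow> \<bar>after_next w l t \<rho> p\<bar> \<le> B"
    using after_next_bound ..
  then have "\<bar>after_next w l t \<rho> p\<bar> \<le> B" for p using assms by blast
  then show ?thesis by (intro integrable_const_bound[of _ B]) auto
qed

text \<open>\<open>gain\<close> is measured relative to stopping at once, hence the constant
  summands.\<close>

lemma mean_after_next_eq:
  assumes l: "0 \<le> l" and t: "s \<le> t" "t \<le> x" "x \<le> t0"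
  shows "mean_after_next w l t (ereal x) =
    w + P2.g_ext l - P2.k_ext (t - s) + P2.mean_gain (P2.state_ext P2.Y) l (t - s) (t0 - t) (x - t)"
proof -
  have "after_next w l t (ereal x) p = (w + P2.g_ext l - P2.k_ext (t - s)) +
      P2.gain (P2.state_ext P2.Y) l (t - s) (t0 - t) (x - t) p" for p
    using t by (cases p) (auto simp: after_next_def P2.gain_def pay_def gam_def algebra_simps)
  then show ?thesis unfolding mean_after_next_def P2.mean_gain_def
    using P2.integrable_gain[OF bounded_Y, of l "t - s" "t0 - t" "x - t"] by (simp add: prob_space)
qed

lemma mean_after_next_late:
  assumes "t0 < t" "ereal t \<le> \<rho>"
  shows "mean_after_next w l t \<rho> = gam w l t"
proof -
  have "after_next w l t \<rho> (S 2 1 \<omega>, X 2 1 \<omega>) = - (C 1 + C 2)" if "\<omega> \<in> space M" for \<omega>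
    using assms P2.S_nonneg[OF that] by (cases \<rho>) (auto simp: after_next_def pay_def gam_def)
  then have "mean_after_next w l t \<rho> = (\<integral>\<omega>. - (C 1 + C 2) \<partial>M)"
    unfolding mean_after_next_def by (intro Bochner_Integration.integral_cong) auto
  then show ?thesis using assms by (simp add: gam_def prob_space)
qed

lemma state_place2: "0 \<le> l \<Longrightarrow> s \<le> t \<Longrightarrow> t \<le> t0 \<Longrightarrow> (l, t - s, t0 - t) \<in> states t0"
  using s_nonneg by (auto simp: states_def)

text \<open>Up to \<open>t0\<close> this is maximality of \<open>Y\<close> among all waits. A \<rho>
  beyond \<open>t0\<close> is compared with \<open>t0\<close>: the outcomes differ only if no catch
  comes by \<open>t0\<close>, and then \<rho> yields \<open>- (C 1 + C 2)\<close>, whereas stopping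
  at \<open>t0\<close> yields at least \<open>- C 1\<close> from \<open>w\<close>, a nonnegative
  utility and a cost of at most \<open>C 2\<close>.\<close>

lemma mean_after_next_le:
  assumes w: "\<bar>w\<bar> \<le> G 1 + \<bar>cost 1 s\<bar>" "s \<le> t0 \<Longrightarrow> - C 1 \<le> w" and l: "0 \<le> l" and t: "s \<le> t" "ereal t \<le> \<rho>"
  shows "mean_after_next w l t \<rho> \<le> gam w l t"
proof (cases "t \<le> t0")
  case False
  then show ?thesis using mean_after_next_late[of t \<rho>] t by simp
next
  case True
  note st = state_place2[OF l t(1) True]
  have main: "mean_after_next w l t (ereal x) \<le> gam w l t" if "t \<le> x" "x \<le> t0" for x
    using mean_after_next_eq[OF l t(1) that] P2.mean_gain_le_Y[OF st, of "x - t"] that True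
      P2.state_ext_eq[OF st, of P2.Y] by (simp add: gam_def)
  show ?thesis
  proof (cases "\<rho> \<le> ereal t0")
    case True
    with t obtain x where "\<rho> = ereal x" "t \<le> x" "x \<le> t0" by (cases \<rho>) auto
    then show ?thesis using main by simp
  next
    case False
    have "mean_after_next w l t \<rho> \<le> mean_after_next w l t (ereal t0)"
      unfolding mean_after_next_def
    proof (rule integral_mono[OF integrable_after_next[OF w(1)] integrable_after_next[OF w(1)]])
      fix \<omega> assume "\<omega> \<in> space M"
      show "after_next w l t \<rho> (S 2 1 \<omega>, X 2 1 \<omega>) \<le> after_next w l t (ereal t0) (S 2 1 \<omega>, X 2 1 \<omega>)"
      proof (cases "t + S 2 1 \<omega> \<le> t0")
        case le: True
        then have "\<not> \<rho> < ereal (t + S 2 1 \<omega>)" using False by (cases \<rho>) auto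
        then show ?thesis using le by (simp add: after_next_def)
      next
        case gt: False
        have "P2.k_ext (t0 - s) \<le> C 2" "0 \<le> P2.g_ext l"
          using cost_range[of 2 "t0 - s"] utility_range[of 2 l] l s_nonneg t True
          by (auto simp: P2.k_ext_eq P2.g_ext_eq)
        moreover have "after_next w l t \<rho> (S 2 1 \<omega>, X 2 1 \<omega>) = - (C 1 + C 2)"
          using False gt by (cases \<rho>) (auto simp: after_next_def pay_def gam_def)
        ultimately show ?thesis using gt w(2) t True by (simp add: after_next_def pay_def)
      qed
    qed
    also have "\<dots> \<le> gam w l t" using True by (intro main) auto
    finally show ?thesis .
  qed
qed

lemma mean_after_next_optimal:
  assumes l: "0 \<le> l" and t: "s \<le> t"
  shows "mean_after_next w l t (ereal (t + (if t \<le> t0 then P2.r_lim l (t - s) (t0 - t) else 0))) = gam w l t"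
proof (cases "t \<le> t0")
  case True
  note st = state_place2[OF l t(1) True]
  have "0 \<le> P2.r_lim l (t - s) (t0 - t)" "P2.r_lim l (t - s) (t0 - t) \<le> t0 - t"
    using P2.r_lim(1)[OF st] by auto
  then show ?thesis
    using mean_after_next_eq[OF l t, of "t + P2.r_lim l (t - s) (t0 - t)" w] P2.r_lim(2)[OF st] True
      P2.state_ext_eq[OF st, of P2.Y] by (simp add: gam_def)
qed (simp add: mean_after_next_late)

lemma expectation_after_next:
  assumes A: "A \<in> sets (past k)" and \<rho>: "\<rho> \<in> borel_measurable (past k)"
  shows "(\<integral>\<omega>. indicator A \<omega> * after_next (W0 \<omega>) (L k \<omega>) (T k \<omega>) (\<rho> \<omega>) (S 2 (Suc k) \<omega>, X 2 (Suc k) \<omega>) \<partial>M) =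
      (\<integral>\<omega>. indicator A \<omega> * mean_after_next (W0 \<omega>) (L k \<omega>) (T k \<omega>) (\<rho> \<omega>) \<partial>M)"
    and "(\<lambda>\<omega>. mean_after_next (W0 \<omega>) (L k \<omega>) (T k \<omega>) (\<rho> \<omega>)) \<in> borel_measurable M"
proof -
  obtain B where "\<forall>w l t \<rho> p. \<bar>w\<bar> \<le> G 1 + \<bar>cost 1 s\<bar> \<longrightarrow> \<bar>after_next w l t \<rho> p\<bar> \<le> B"
    using after_next_bound ..
  then have B: "\<bar>w\<bar> \<le> G 1 + \<bar>cost 1 s\<bar> \<Longrightarrow> \<bar>after_next w l t \<rho> p\<bar> \<le> B" for w l t \<rho> p by blast
  have m: "(\<lambda>z. after_next (W0 (fst z)) (L k (fst z)) (T k (fst z)) (\<rho> (fst z)) (fst (snd z), snd (snd z)))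
      \<in> borel_measurable (past k \<Otimes>\<^sub>M (borel \<Otimes>\<^sub>M borel))"
    by (intro after_next_meas measurable_compose[OF measurable_fst] W0_past past_L past_T \<rho>)
      (intro measurable_compose[OF measurable_snd] measurable_fst measurable_snd)+
  have ind: "(\<lambda>z. indicator A (fst z) :: real) \<in> borel_measurable (past k \<Otimes>\<^sub>M (borel \<Otimes>\<^sub>M borel))"
    using A by (intro measurable_compose[OF measurable_fst] borel_measurable_indicator)
  let ?h = "\<lambda>D z. indicator D (fst z) * after_next (W0 (fst z)) (L k (fst z)) (T k (fst z)) (\<rho> (fst z)) (fst (snd z), snd (snd z))"
  have b: "\<bar>?h D (\<omega>, p)\<bar> \<le> B" if "\<omega> \<in> space M" for \<omega> p D
    using B[OF W0_bound[OF that], of "L k \<omega>" "T k \<omega>" "\<rho> \<omega>" p] by (auto simp: indicator_def)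
  have "(\<integral>\<omega>. ?h A (\<omega>, (S 2 (Suc k) \<omega>, X 2 (Suc k) \<omega>)) \<partial>M) =
      (\<integral>\<omega>. (\<integral>\<omega>'. ?h A (\<omega>, (S 2 1 \<omega>', X 2 1 \<omega>')) \<partial>M) \<partial>M)"
    by (rule expectation_next(1)[OF borel_measurable_times[OF ind m] b])
  then show "(\<integral>\<omega>. indicator A \<omega> * after_next (W0 \<omega>) (L k \<omega>) (T k \<omega>) (\<rho> \<omega>) (S 2 (Suc k) \<omega>, X 2 (Suc k) \<omega>) \<partial>M) =
      (\<integral>\<omega>. indicator A \<omega> * mean_after_next (W0 \<omega>) (L k \<omega>) (T k \<omega>) (\<rho> \<omega>) \<partial>M)"
    by (simp add: mean_after_next_def)
  have b': "\<bar>after_next (W0 \<omega>) (L k \<omega>) (T k \<omega>) (\<rho> \<omega>) p\<bar> \<le> B" if "\<omega> \<in> space M" for \<omega> p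
    using B[OF W0_bound[OF that]] .
  have "(\<lambda>\<omega>. \<integral>\<omega>'. after_next (W0 \<omega>) (L k \<omega>) (T k \<omega>) (\<rho> \<omega>) (S 2 1 \<omega>', X 2 1 \<omega>') \<partial>M) \<in> borel_measurable (past k)"
    using expectation_next(2)[OF m, of B] b' by simp
  then show "(\<lambda>\<omega>. mean_after_next (W0 \<omega>) (L k \<omega>) (T k \<omega>) (\<rho> \<omega>)) \<in> borel_measurable M"
    unfolding mean_after_next_def by (rule past_measurable_M)
qed

subsection \<open>Telescoping over the catches\<close>

abbreviation Z where "Z \<equiv> payoff S X g cost C t0 s"

text \<open>The value of following \<sigma> up to the \<open>k\<close>-th catch and continuing
  optimally from there. It interpolates between the claimed value at \<open>k = n\<close> and the
  payoff of \<sigma> as \<open>k\<close> grows.\<close>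

definition U :: "('a \<Rightarrow> real) \<Rightarrow> nat \<Rightarrow> 'a \<Rightarrow> real" where
  "U \<sigma> k \<omega> = (if \<sigma> \<omega> < T k \<omega> then Z (\<sigma> \<omega>) \<omega> else gam (W0 \<omega>) (L k \<omega>) (T k \<omega>))"

lemma catches_mono: "\<omega> \<in> space M \<Longrightarrow> i \<in> {1, 2} \<Longrightarrow> u \<le> v \<Longrightarrow> catches S i u \<omega> \<le> catches S i v \<omega>"
  using catches_ge_iff[of \<omega> i "catches S i u \<omega>" u] catches_ge_iff[of \<omega> i "catches S i u \<omega>" v] by auto

lemma mass_eq: "s \<le> t \<Longrightarrow> mass S X s t \<omega> = M1 \<omega> + L (catches S 2 (t - s) \<omega>) \<omega>"
  by (simp add: mass_def M1_def L_def)

lemma L_mono: "\<omega> \<in> space M \<Longrightarrow> k \<le> l \<Longrightarrow> L k \<omega> \<le> L l \<omega>"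
  unfolding L_def by (intro sum_mono2) (auto intro: weight_nonneg)

text \<open>This holds on every trajectory, also with simultaneous catches, and therefore yields
  measurability of the payoff; the identification of the masses with \<open>L k\<close> is available
  only for \<open>good\<close> ones.\<close>

lemma payoff_eq:
  assumes w: "\<omega> \<in> space M" and t: "s \<le> t"
  shows "Z t \<omega> = (if t \<le> t0 then g1 (mass S X s s \<omega>) - cost 1 s + P2.g_ext (mass S X s t \<omega> - mass S X s s \<omega>)
    - P2.k_ext (t - s) else - (C 1 + C 2))"
proof -
  have "L (catches S 2 (s - s) \<omega>) \<omega> \<le> L (catches S 2 (t - s) \<omega>) \<omega>"
    using t by (intro L_mono catches_mono w) auto
  moreover have "0 \<le> mass S X s s \<omega>" unfolding mass_eq[OF order_refl] using M1_nonneg[OF w] L_nonneg[OF w] by simp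
  ultimately show ?thesis
    using t s_nonneg by (simp add: payoff_def w2_def w1_def g1_def P2.g_ext_eq P2.k_ext_eq mass_eq)
qed

lemma payoff_measurable:
  assumes \<sigma>[measurable]: "\<sigma> \<in> borel_measurable M" and s: "\<And>\<omega>. \<omega> \<in> space M \<Longrightarrow> s \<le> \<sigma> \<omega>"
  shows "(\<lambda>\<omega>. Z (\<sigma> \<omega>) \<omega>) \<in> borel_measurable M"
proof -
  have sum[measurable]: "(\<lambda>\<omega>. \<Sum>n=1..catches S i (u \<omega>) \<omega>. X i n \<omega>) \<in> borel_measurable M"
    if i: "i \<in> {1, 2}" and [measurable]: "u \<in> borel_measurable M" for i u
  proof -
    have *: "{\<omega> \<in> space M. n \<le> catches S i (u \<omega>) \<omega>} \<in> sets M" for n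
    proof -
      have [measurable]: "(\<lambda>\<omega>. \<Sum>k=1..n. S i k \<omega>) \<in> borel_measurable M"
        using i by (intro borel_measurable_sum) auto
      have "{\<omega> \<in> space M. n \<le> catches S i (u \<omega>) \<omega>} = {\<omega> \<in> space M. n = 0 \<or> (\<Sum>k=1..n. S i k \<omega>) \<le> u \<omega>}"
        using catches_ge_iff[OF _ i] by auto
      also have "\<dots> \<in> sets M" by measurable
      finally show ?thesis .
    qed
    show ?thesis
    proof (rule random_sum_measurable[OF *])
      fix n
      have [measurable]: "X i n \<in> borel_measurable M" "Measurable.pred M (\<lambda>\<omega>. n \<le> catches S i (u \<omega>) \<omega>)"
        using X_meas[OF i] * by (auto simp: pred_def)
      show "(\<lambda>\<omega>. if n \<le> catches S i (u \<omega>) \<omega> then X i n \<omega> else 0) \<in> borel_measurable M" by measurable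
    qed
  qed
  have m[measurable]: "(\<lambda>\<omega>. mass S X s (u \<omega>) \<omega>) \<in> borel_measurable M" if [measurable]: "u \<in> borel_measurable M" for u
    unfolding mass_def
  proof (rule borel_measurable_add)
    show "(\<lambda>\<omega>. \<Sum>n=1..catches S 1 (min s (u \<omega>)) \<omega>. X 1 n \<omega>) \<in> borel_measurable M"
      by (rule sum) simp_all
    show "(\<lambda>\<omega>. \<Sum>n=1..catches S 2 (max 0 (u \<omega> - s)) \<omega>. X 2 n \<omega>) \<in> borel_measurable M"
      by (rule sum) simp_all
  qed
  have [measurable]: "(\<lambda>\<omega>. mass S X s s \<omega>) \<in> borel_measurable M" by (rule m) simp
  have "(\<lambda>\<omega>. if \<sigma> \<omega> \<le> t0 then g1 (mass S X s s \<omega>) - cost 1 s + P2.g_ext (mass S X s (\<sigma> \<omega>) \<omega> - mass S X s s \<omega>)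
    - P2.k_ext (\<sigma> \<omega> - s) else - (C 1 + C 2)) \<in> borel_measurable M" by measurable
  then show ?thesis by (subst measurable_cong[OF payoff_eq[OF _ s]]) auto
qed

section \<open>Trajectories without simultaneous catches\<close>

lemma catches_between:
  assumes w: "\<omega> \<in> space M" and t: "T k \<omega> \<le> t" "t < T (Suc k) \<omega>"
  shows "catches S 2 (t - s) \<omega> = k"
  using t catches_2_ge_iff[OF w, of k t] catches_2_ge_iff[OF w, of "Suc k" t] by auto

lemma good_T_Suc: "good \<omega> \<Longrightarrow> T k \<omega> < T (Suc k) \<omega>"
  by (simp add: T_Suc)

lemma good_mass_s: "good \<omega> \<Longrightarrow> mass S X s s \<omega> = M1 \<omega>"
  using catches_between[of \<omega> 0 s] good_T_Suc[of \<omega> 0] by (simp add: mass_eq T_0 L_def)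

lemma good_mass:
  assumes "good \<omega>" "T k \<omega> \<le> t" "t < T (Suc k) \<omega>"
  shows "mass S X s t \<omega> = M1 \<omega> + L k \<omega>"
  using catches_between[of \<omega> k t] T_ge_s[of \<omega> k] assms by (simp add: mass_eq)

lemma good_payoff:
  assumes "good \<omega>" "T k \<omega> \<le> t" "t < T (Suc k) \<omega>"
  shows "Z t \<omega> = pay (W0 \<omega>) (L k \<omega>) t"
proof -
  have "s \<le> t" using T_ge_s[of \<omega> k] assms by simp
  then show ?thesis
    using assms by (simp add: payoff_eq good_mass[OF assms] good_mass_s pay_def W0_def)
qed

lemma good_gamma:
  assumes "good \<omega>"
  shows "gamma M X F f2 g cost cost' C t0 s (mass S X s s \<omega>) (mass S X s (T k \<omega>) \<omega>) (T k \<omega>) =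
    gam (W0 \<omega>) (L k \<omega>) (T k \<omega>)"
proof -
  have w: "\<omega> \<in> space M" using assms by simp
  note ms = good_mass_s[OF assms] and mT = good_mass[OF assms order_refl good_T_Suc[OF assms]]
  show ?thesis
    using state_place2[OF L_nonneg[OF w] T_ge_s[OF w], of k k] T_ge_s[OF w, of k] L_nonneg[OF w, of k] M1_nonneg[OF w]
      s_nonneg
    by (simp add: gamma_def gam_def w2_def w1_def ms mT W0_def g1_def P2.g_ext_eq P2.k_ext_eq P2.state_ext_eq)
qed

lemma payoff_U_bound: "\<exists>B. \<forall>\<sigma> k \<omega>. \<omega> \<in> space M \<and> s \<le> \<sigma> \<omega> \<longrightarrow> \<bar>Z (\<sigma> \<omega>) \<omega>\<bar> \<le> B \<and> \<bar>U \<sigma> k \<omega>\<bar> \<le> B"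
proof -
  obtain B where B: "\<And>w l t. \<bar>w\<bar> \<le> G 1 + \<bar>cost 1 s\<bar> \<Longrightarrow> \<bar>pay w l t\<bar> \<le> B"
    "\<And>w l t. \<bar>w\<bar> \<le> G 1 + \<bar>cost 1 s\<bar> \<Longrightarrow> \<bar>gam w l t\<bar> \<le> B" by (rule pay_gam_bound) (rule that)
  have "\<bar>Z t \<omega>\<bar> \<le> B" if w: "\<omega> \<in> space M" and t: "s \<le> t" for t \<omega>
  proof -
    have m: "0 \<le> mass S X s s \<omega>" unfolding mass_eq[OF order_refl] using M1_nonneg[OF w] L_nonneg[OF w] by simp
    have "Z t \<omega> = pay (g1 (mass S X s s \<omega>) - cost 1 s) (mass S X s t \<omega> - mass S X s s \<omega>) t"
      by (simp add: payoff_eq[OF w t] pay_def)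
    moreover have "\<bar>g1 (mass S X s s \<omega>) - cost 1 s\<bar> \<le> G 1 + \<bar>cost 1 s\<bar>"
      using utility_range[of 1 "mass S X s s \<omega>"] m by (auto simp: g1_def)
    ultimately show ?thesis using B(1) by simp
  qed
  then show ?thesis using B(2)[OF W0_bound] by (intro exI[of _ B]) (auto simp: U_def)
qed

lemma U_measurable:
  assumes \<sigma>[measurable]: "\<sigma> \<in> borel_measurable M" and s: "\<And>\<omega>. \<omega> \<in> space M \<Longrightarrow> s \<le> \<sigma> \<omega>"
  shows "U \<sigma> k \<in> borel_measurable M"
proof -
  note [measurable] = past_measurable_M[OF past_T[of k]] past_measurable_M[OF past_L[of k]]
    past_measurable_M[OF W0_past[of 0]] payoff_measurable[OF \<sigma> s]
  show ?thesis unfolding U_def[abs_def] by measurable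
qed

lemma tendsto_U:
  assumes "\<omega> \<in> space M" shows "(\<lambda>k. U \<sigma> k \<omega>) \<longlonglongrightarrow> Z (\<sigma> \<omega>) \<omega>"
proof -
  obtain N where N: "\<sigma> \<omega> < T N \<omega>" using T_unbounded[OF assms] by blast
  have "U \<sigma> k \<omega> = Z (\<sigma> \<omega>) \<omega>" if "N \<le> k" for k
    using N T_mono[OF assms that] by (simp add: U_def)
  then show ?thesis
    by (intro tendsto_eventually) (auto simp: eventually_sequentially)
qed

text \<open>Nothing changes after the rule has stopped. While it is running, the hypotheses put
  \<rho> and \<sigma> on the same side of the next catch, with equality before it, so
  \<open>after_next\<close> evaluated at \<rho> gives the next value of \<open>U\<close>.\<close>

lemma U_step:
  assumes w: "good \<omega>" and lower: "ereal (T k \<omega>) \<le> \<rho>"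
    and \<rho>: "T k \<omega> \<le> \<sigma> \<omega> \<Longrightarrow> \<sigma> \<omega> < T (Suc k) \<omega> \<Longrightarrow> \<rho> = ereal (\<sigma> \<omega>)"
      "T (Suc k) \<omega> \<le> \<sigma> \<omega> \<Longrightarrow> ereal (T (Suc k) \<omega>) \<le> \<rho>"
  shows "U \<sigma> (Suc k) \<omega> - U \<sigma> k \<omega> = (if T k \<omega> \<le> \<sigma> \<omega>
    then after_next (W0 \<omega>) (L k \<omega>) (T k \<omega>) \<rho> (S 2 (Suc k) \<omega>, X 2 (Suc k) \<omega>) - gam (W0 \<omega>) (L k \<omega>) (T k \<omega>) else 0)"
proof (cases "T k \<omega> \<le> \<sigma> \<omega>")
  case le: True
  show ?thesis
  proof (cases "\<sigma> \<omega> < T (Suc k) \<omega>")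
    case True
    then have "\<rho> = ereal (\<sigma> \<omega>)" "Z (\<sigma> \<omega>) \<omega> = pay (W0 \<omega>) (L k \<omega>) (\<sigma> \<omega>)"
      using \<rho>(1)[OF le] good_payoff[OF w le] by auto
    then show ?thesis using le True by (simp add: U_def after_next_def T_Suc)
  next
    case False
    then have "ereal (T (Suc k) \<omega>) \<le> \<rho>" using \<rho>(2) by simp
    then have "\<not> \<rho> < ereal (T k \<omega> + S 2 (Suc k) \<omega>)" by (simp add: T_Suc not_less)
    then show ?thesis using le False by (simp add: U_def after_next_def T_Suc L_Suc)
  qed
next
  case False
  then have "\<sigma> \<omega> < T (Suc k) \<omega>" using good_T_Suc[OF w, of k] by simp
  then show ?thesis using False by (simp add: U_def)
qed

lemma pre_sigma_subset: "sets (FF.pre_sigma (T n)) \<subseteq> sets M"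
proof
  fix A assume A: "A \<in> sets (FF.pre_sigma (T n))"
  have "{\<omega>\<in>A. T n \<omega> \<le> real j} \<in> sets M" for j :: nat
    using FF_subset FF.sets_pre_sigmaD[OF stopping_time_T A, of "real j"] by blast
  then have "(\<Union>j::nat. {\<omega>\<in>A. T n \<omega> \<le> real j}) \<in> sets M" by blast
  also have "(\<Union>j::nat. {\<omega>\<in>A. T n \<omega> \<le> real j}) = A" using real_arch_simple by auto
  finally show "A \<in> sets M" .
qed

text \<open>To integrate out the next catch, the event that the rule is still running at the
  \<open>k\<close>-th one must belong to the past. \<open>A'\<close> represents it, intersected with
  \<open>A\<close>, up to a null set. The rule \<sigma> is kept general so that arbitrary rules and
  the optimal one are treated alike.\<close>

lemma expectation_U_step:
  fixes \<sigma> :: "'a \<Rightarrow> real" and \<rho> :: "nat \<Rightarrow> 'a \<Rightarrow> ereal"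
  assumes \<sigma>: "\<sigma> \<in> borel_measurable M" "\<And>\<omega>. \<omega> \<in> space M \<Longrightarrow> s \<le> \<sigma> \<omega>" "AE \<omega> in M. T n \<omega> \<le> \<sigma> \<omega>"
    and \<rho>: "\<And>k. \<rho> k \<in> borel_measurable (past k)" "\<And>k \<omega>. \<omega> \<in> space M \<Longrightarrow> ereal (T k \<omega>) \<le> \<rho> k \<omega>"
    and \<rho>\<sigma>: "\<And>k \<omega>. n \<le> k \<Longrightarrow> \<omega> \<in> space M \<Longrightarrow> T k \<omega> \<le> \<sigma> \<omega> \<Longrightarrow> \<sigma> \<omega> < T (Suc k) \<omega> \<Longrightarrow> \<rho> k \<omega> = ereal (\<sigma> \<omega>)"
      "\<And>k \<omega>. n \<le> k \<Longrightarrow> \<omega> \<in> space M \<Longrightarrow> T (Suc k) \<omega> \<le> \<sigma> \<omega> \<Longrightarrow> ereal (T (Suc k) \<omega>) \<le> \<rho> k \<omega>"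
    and A: "A \<in> sets (FF.pre_sigma (T n))" and k: "n \<le> k"
  obtains A' where "A' \<in> sets (past k)"
    "(\<integral>\<omega>. indicator A \<omega> * U \<sigma> (Suc k) \<omega> \<partial>M) - (\<integral>\<omega>. indicator A \<omega> * U \<sigma> k \<omega> \<partial>M) =
     (\<integral>\<omega>. indicator A' \<omega> * (mean_after_next (W0 \<omega>) (L k \<omega>) (T k \<omega>) (\<rho> k \<omega>) - gam (W0 \<omega>) (L k \<omega>) (T k \<omega>)) \<partial>M)"
proof -
  have AM: "A \<in> sets M" using A pre_sigma_subset by blast
  \<comment> \<open>At \<open>n\<close> the rule is almost surely running, so \<open>A\<close> alone
    has to be represented. Afterwards, running at the next catch means having run at the current one
    with \<open>\<rho> k\<close> not before the next.\<close>
  have "\<exists>A'\<in>sets (past k). AE \<omega> in M. \<omega> \<in> A \<and> T k \<omega> \<le> \<sigma> \<omega> \<longleftrightarrow> \<omega> \<in> A'"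
    using k
  proof (induction k rule: dec_induct)
    case base
    obtain A' where A': "A' \<in> sets (past n)" "\<And>\<omega>. \<omega> \<in> space M \<Longrightarrow> 0 < S 2 (Suc n) \<omega> \<Longrightarrow> \<omega> \<in> A \<longleftrightarrow> \<omega> \<in> A'"
      using A by (rule pre_sigma_past) (rule that)
    have "AE \<omega> in M. \<omega> \<in> A \<and> T n \<omega> \<le> \<sigma> \<omega> \<longleftrightarrow> \<omega> \<in> A'"
      using AE_good \<sigma>(3) by eventually_elim (use A'(2) in auto)
    then show ?case using A'(1) by blast
  next
    case (step k)
    then obtain A' where A': "A' \<in> sets (past k)" "AE \<omega> in M. \<omega> \<in> A \<and> T k \<omega> \<le> \<sigma> \<omega> \<longleftrightarrow> \<omega> \<in> A'" by blast
    have [measurable]: "A' \<in> sets (past (Suc k))" "\<rho> k \<in> borel_measurable (past (Suc k))"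
      using A'(1) past_mono[of k "Suc k"] past_measurable_mono[OF _ \<rho>(1), of k "Suc k"] by auto
    note [measurable] = past_T[of "Suc k"]
    have "{\<omega> \<in> space (past (Suc k)). \<omega> \<in> A' \<and> ereal (T (Suc k) \<omega>) \<le> \<rho> k \<omega>} \<in> sets (past (Suc k))"
      by measurable
    moreover have "AE \<omega> in M. \<omega> \<in> A \<and> T (Suc k) \<omega> \<le> \<sigma> \<omega> \<longleftrightarrow>
        \<omega> \<in> {\<omega> \<in> space (past (Suc k)). \<omega> \<in> A' \<and> ereal (T (Suc k) \<omega>) \<le> \<rho> k \<omega>}"
      using A'(2) AE_space
    proof eventually_elim
      case (elim \<omega>)
      have "T k \<omega> \<le> T (Suc k) \<omega>" using T_mono[of \<omega> k "Suc k"] elim by simp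
      then show ?case
        using elim \<rho>\<sigma>[OF step(1), of \<omega>] by (cases "T (Suc k) \<omega> \<le> \<sigma> \<omega>") (auto simp: not_le)
    qed
    ultimately show ?case by blast
  qed
  then obtain A' where A': "A' \<in> sets (past k)" "AE \<omega> in M. \<omega> \<in> A \<and> T k \<omega> \<le> \<sigma> \<omega> \<longleftrightarrow> \<omega> \<in> A'" by blast
  let ?n = "\<lambda>\<omega>. after_next (W0 \<omega>) (L k \<omega>) (T k \<omega>) (\<rho> k \<omega>) (S 2 (Suc k) \<omega>, X 2 (Suc k) \<omega>)"
  let ?m = "\<lambda>\<omega>. mean_after_next (W0 \<omega>) (L k \<omega>) (T k \<omega>) (\<rho> k \<omega>)"
  let ?g = "\<lambda>\<omega>. gam (W0 \<omega>) (L k \<omega>) (T k \<omega>)"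
  note [measurable] = AM past_measurable_M[OF past_T[of k]] past_measurable_M[OF past_L[of k]]
    past_measurable_M[OF W0_past[of 0]] past_measurable_M[OF \<rho>(1)[of k]] U_measurable[OF \<sigma>(1,2)]
    expectation_after_next(2)[OF A'(1) \<rho>(1)]
  have A'M[measurable]: "A' \<in> sets M" using A'(1) past_subset by blast
  have [measurable]: "?n \<in> borel_measurable M" by measurable
  obtain B where B: "\<And>w l t. \<bar>w\<bar> \<le> G 1 + \<bar>cost 1 s\<bar> \<Longrightarrow> \<bar>pay w l t\<bar> \<le> B"
    "\<And>w l t. \<bar>w\<bar> \<le> G 1 + \<bar>cost 1 s\<bar> \<Longrightarrow> \<bar>gam w l t\<bar> \<le> B" by (rule pay_gam_bound) (rule that)
  obtain B1 where B1: "\<forall>w l t \<rho> p. \<bar>w\<bar> \<le> G 1 + \<bar>cost 1 s\<bar> \<longrightarrow> \<bar>after_next w l t \<rho> p\<bar> \<le> B1"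
    using after_next_bound ..
  obtain B2 where B2: "\<forall>\<sigma> k \<omega>. \<omega> \<in> space M \<and> s \<le> \<sigma> \<omega> \<longrightarrow> \<bar>Z (\<sigma> \<omega>) \<omega>\<bar> \<le> B2 \<and> \<bar>U \<sigma> k \<omega>\<bar> \<le> B2"
    using payoff_U_bound ..
  have intn: "integrable M (\<lambda>\<omega>. indicator A' \<omega> * ?n \<omega>)"
  proof (rule integrable_indicator_mult[of _ _ B1])
    show "\<bar>?n \<omega>\<bar> \<le> B1" if "\<omega> \<in> space M" for \<omega> using B1 W0_bound[OF that] by blast
  qed measurable
  have intg: "integrable M (\<lambda>\<omega>. indicator A' \<omega> * ?g \<omega>)"
  proof (rule integrable_indicator_mult[of _ _ B])
    show "\<bar>?g \<omega>\<bar> \<le> B" if "\<omega> \<in> space M" for \<omega> by (rule B(2)[OF W0_bound[OF that]])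
  qed measurable
  have bm: "\<bar>?m \<omega>\<bar> \<le> B1" if "\<omega> \<in> space M" for \<omega>
  proof -
    have "norm (?m \<omega>) \<le> (\<integral>\<omega>'. norm (after_next (W0 \<omega>) (L k \<omega>) (T k \<omega>) (\<rho> k \<omega>) (S 2 1 \<omega>', X 2 1 \<omega>')) \<partial>M)"
      unfolding mean_after_next_def by (rule integral_norm_bound)
    also have "\<dots> \<le> (\<integral>\<omega>'. B1 \<partial>M)"
      using B1 W0_bound[OF that] by (intro integral_mono integrable_norm integrable_after_next) auto
    finally show ?thesis by (simp add: prob_space)
  qed
  have intm: "integrable M (\<lambda>\<omega>. indicator A' \<omega> * ?m \<omega>)"
    by (rule integrable_indicator_mult[OF _ _ bm]) measurable
  have intU: "integrable M (\<lambda>\<omega>. indicator A \<omega> * U \<sigma> j \<omega>)" for j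
  proof (rule integrable_indicator_mult[of _ _ B2])
    show "\<bar>U \<sigma> j \<omega>\<bar> \<le> B2" if "\<omega> \<in> space M" for \<omega> using B2 \<sigma>(2)[OF that] that by blast
  qed measurable
  have "(\<integral>\<omega>. indicator A \<omega> * U \<sigma> (Suc k) \<omega> \<partial>M) - (\<integral>\<omega>. indicator A \<omega> * U \<sigma> k \<omega> \<partial>M) =
    (\<integral>\<omega>. indicator A \<omega> * U \<sigma> (Suc k) \<omega> - indicator A \<omega> * U \<sigma> k \<omega> \<partial>M)"
    using intU by simp
  also have "\<dots> = (\<integral>\<omega>. indicator A' \<omega> * ?n \<omega> - indicator A' \<omega> * ?g \<omega> \<partial>M)"
  proof (rule integral_cong_AE)
    show "AE \<omega> in M. indicator A \<omega> * U \<sigma> (Suc k) \<omega> - indicator A \<omega> * U \<sigma> k \<omega> = indicator A' \<omega> * ?n \<omega> - indicator A' \<omega> * ?g \<omega>"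
      using A'(2) AE_good
    proof eventually_elim
      case (elim \<omega>)
      have "U \<sigma> (Suc k) \<omega> - U \<sigma> k \<omega> = (if T k \<omega> \<le> \<sigma> \<omega> then ?n \<omega> - ?g \<omega> else 0)"
        using elim \<rho>(2) \<rho>\<sigma>[OF k] by (intro U_step) auto
      then show ?case using elim(1) by (auto simp: indicator_def right_diff_distrib[symmetric])
    qed
  qed measurable
  also have "\<dots> = (\<integral>\<omega>. indicator A' \<omega> * ?m \<omega> \<partial>M) - (\<integral>\<omega>. indicator A' \<omega> * ?g \<omega> \<partial>M)"
    using intn intg expectation_after_next(1)[OF A'(1) \<rho>(1)] by simp
  also have "\<dots> = (\<integral>\<omega>. indicator A' \<omega> * (?m \<omega> - ?g \<omega>) \<partial>M)"
    using intm intg by (simp add: right_diff_distrib)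
  finally show thesis by (rule that[OF A'(1)])
qed

lemma tendsto_expectation_U:
  assumes \<sigma>: "\<sigma> \<in> borel_measurable M" "\<And>\<omega>. \<omega> \<in> space M \<Longrightarrow> s \<le> \<sigma> \<omega>" and A[measurable]: "A \<in> sets M"
  shows "(\<lambda>k. \<integral>\<omega>. indicator A \<omega> * U \<sigma> k \<omega> \<partial>M) \<longlonglongrightarrow> (\<integral>\<omega>. indicator A \<omega> * Z (\<sigma> \<omega>) \<omega> \<partial>M)"
proof -
  note [measurable] = U_measurable[OF \<sigma>] payoff_measurable[OF \<sigma>]
  obtain B where B: "\<forall>\<sigma> k \<omega>. \<omega> \<in> space M \<and> s \<le> \<sigma> \<omega> \<longrightarrow> \<bar>Z (\<sigma> \<omega>) \<omega>\<bar> \<le> B \<and> \<bar>U \<sigma> k \<omega>\<bar> \<le> B"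
    using payoff_U_bound ..
  show ?thesis
  proof (rule integral_dominated_convergence[where w = "\<lambda>_. \<bar>B\<bar>"])
    show "AE \<omega> in M. (\<lambda>k. indicator A \<omega> * U \<sigma> k \<omega>) \<longlonglongrightarrow> indicator A \<omega> * Z (\<sigma> \<omega>) \<omega>"
      by (intro AE_I2 tendsto_mult_left tendsto_U)
    show "AE \<omega> in M. norm (indicator A \<omega> * U \<sigma> k \<omega>) \<le> \<bar>B\<bar>" for k
    proof (rule AE_I2)
      fix \<omega> assume w: "\<omega> \<in> space M"
      then have "\<bar>U \<sigma> k \<omega>\<bar> \<le> B" using B \<sigma>(2) by blast
      then show "norm (indicator A \<omega> * U \<sigma> k \<omega>) \<le> \<bar>B\<bar>" by (auto simp: indicator_def)
    qed
  qed auto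
qed

subsection \<open>The limiting stopping rule\<close>

definition R :: "nat \<Rightarrow> 'a \<Rightarrow> real" where
  "R k \<omega> = (if T k \<omega> \<le> t0 then P2.r_lim (L k \<omega>) (T k \<omega> - s) (t0 - T k \<omega>) else 0)"

text \<open>The counterpart of \<open>eta\<close> with the limiting waits and without the cap
  \<open>K\<close>; that the least index exists on every trajectory is \<open>stop_exists\<close>.
  With \<open>tau\<close> written down in this way, its stopping time property needs no limit
  argument.\<close>

definition stop_index :: "nat \<Rightarrow> 'a \<Rightarrow> nat" where
  "stop_index n \<omega> = (LEAST i. n \<le> i \<and> R i \<omega> < S 2 (Suc i) \<omega>)"

definition tau :: "nat \<Rightarrow> 'a \<Rightarrow> real" where
  "tau n \<omega> = T (stop_index n \<omega>) \<omega> + R (stop_index n \<omega>) \<omega>"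

lemma state_k: "\<omega> \<in> space M \<Longrightarrow> T k \<omega> \<le> t0 \<Longrightarrow> (L k \<omega>, T k \<omega> - s, t0 - T k \<omega>) \<in> states t0"
  by (intro state_place2 L_nonneg T_ge_s)

lemma R_nonneg: "\<omega> \<in> space M \<Longrightarrow> 0 \<le> R k \<omega>"
  using P2.r_lim(1)[OF state_k] by (simp add: R_def)

lemma R_le: "\<omega> \<in> space M \<Longrightarrow> T k \<omega> \<le> t0 \<Longrightarrow> R k \<omega> \<le> t0 - T k \<omega>"
  using P2.r_lim(1)[OF state_k] by (simp add: R_def)

lemma R_past: "R k \<in> borel_measurable (past k)"
proof -
  note [measurable] = past_T[of k] past_L[of k]
  have "Measurable.pred (past k) (\<lambda>\<omega>. T k \<omega> \<le> t0)" by measurable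
  then show ?thesis unfolding R_def[abs_def]
    by (intro P2.r_lim_measurable) (auto intro: state_k past_T past_L borel_measurable_diff)
qed

text \<open>After the horizon \<open>R\<close> is 0. Never stopping would then force all later
  waiting times to be at most 0, and the catch times would remain bounded.\<close>

lemma stop_exists:
  assumes w: "\<omega> \<in> space M" shows "\<exists>i\<ge>n. R i \<omega> < S 2 (Suc i) \<omega>"
proof -
  obtain N where "t0 < T N \<omega>" using T_unbounded[OF w] by blast
  define m where "m = max n N"
  have late: "t0 < T i \<omega>" if "m \<le> i" for i
    using \<open>t0 < T N \<omega>\<close> T_mono[OF w, of N i] that by (simp add: m_def)
  show ?thesis
  proof (rule ccontr)
    assume "\<not> ?thesis"
    then have le: "S 2 (Suc i) \<omega> \<le> 0" if "m \<le> i" for i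
      using late[OF that] that by (auto simp: R_def m_def not_less)
    have "T i \<omega> \<le> T m \<omega>" if "m \<le> i" for i
      using that
    proof (induction i rule: dec_induct)
      case (step i)
      then show ?case using le[of i] by (simp add: T_Suc)
    qed simp
    moreover obtain j where "T m \<omega> < T j \<omega>" using T_unbounded[OF w] by blast
    moreover have "T j \<omega> \<le> T (max m j) \<omega>" using T_mono[OF w] by simp
    ultimately show False by (meson max.cobounded1 not_less order_trans)
  qed
qed

lemma stop_index:
  assumes w: "\<omega> \<in> space M"
  shows "n \<le> stop_index n \<omega>" "R (stop_index n \<omega>) \<omega> < S 2 (Suc (stop_index n \<omega>)) \<omega>"
    and "\<And>j. n \<le> j \<Longrightarrow> j < stop_index n \<omega> \<Longrightarrow> S 2 (Suc j) \<omega> \<le> R j \<omega>"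
proof -
  have "n \<le> stop_index n \<omega> \<and> R (stop_index n \<omega>) \<omega> < S 2 (Suc (stop_index n \<omega>)) \<omega>"
    unfolding stop_index_def by (rule LeastI_ex) (use stop_exists[OF w] in blast)
  then show "n \<le> stop_index n \<omega>" "R (stop_index n \<omega>) \<omega> < S 2 (Suc (stop_index n \<omega>)) \<omega>" by auto
  show "S 2 (Suc j) \<omega> \<le> R j \<omega>" if "n \<le> j" "j < stop_index n \<omega>" for j
    using not_less_Least[of j "\<lambda>i. n \<le> i \<and> R i \<omega> < S 2 (Suc i) \<omega>"] that by (auto simp: stop_index_def)
qed

lemma stop_index_eqI:
  assumes "n \<le> i" "R i \<omega> < S 2 (Suc i) \<omega>" "\<And>j. n \<le> j \<Longrightarrow> j < i \<Longrightarrow> S 2 (Suc j) \<omega> \<le> R j \<omega>"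
  shows "stop_index n \<omega> = i"
  unfolding stop_index_def
proof (rule Least_equality)
  show "i \<le> j" if "n \<le> j \<and> R j \<omega> < S 2 (Suc j) \<omega>" for j
    using assms(3)[of j] that by (meson leD leI)
qed (use assms in simp)

lemma tau_ge: "\<omega> \<in> space M \<Longrightarrow> T n \<omega> \<le> tau n \<omega>"
  using stop_index(1)[of \<omega> n] T_mono[of \<omega> n "stop_index n \<omega>"] R_nonneg[of \<omega> "stop_index n \<omega>"]
  by (simp add: tau_def)

text \<open>For \<open>tau\<close> the past-measurable time between two catches is explicit, namely
  \<open>T k + R k\<close>; these are the properties that \<open>expectation_U_step\<close> asks of
  it.\<close>

lemma tau_between:
  assumes w: "\<omega> \<in> space M" and k: "n \<le> k"
  shows "T k \<omega> \<le> tau n \<omega> \<Longrightarrow> tau n \<omega> < T (Suc k) \<omega> \<Longrightarrow> T k \<omega> + R k \<omega> = tau n \<omega>"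
    and "T (Suc k) \<omega> \<le> tau n \<omega> \<Longrightarrow> T (Suc k) \<omega> \<le> T k \<omega> + R k \<omega>"
proof -
  let ?i = "stop_index n \<omega>"
  note i = stop_index[OF w, of n]
  have lt: "tau n \<omega> < T (Suc ?i) \<omega>" using i(2) by (simp add: tau_def T_Suc)
  have ge: "T ?i \<omega> \<le> tau n \<omega>" using R_nonneg[OF w] by (simp add: tau_def)
  show "T k \<omega> + R k \<omega> = tau n \<omega>" if 1: "T k \<omega> \<le> tau n \<omega>" and 2: "tau n \<omega> < T (Suc k) \<omega>"
  proof -
    have "\<not> ?i < k" using T_mono[OF w, of "Suc ?i" k] lt 1 by (auto simp: Suc_le_eq)
    moreover have "\<not> k < ?i" using T_mono[OF w, of "Suc k" ?i] ge 2 by (auto simp: Suc_le_eq)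
    ultimately have "?i = k" by simp
    then show ?thesis by (simp add: tau_def)
  qed
  show "T (Suc k) \<omega> \<le> T k \<omega> + R k \<omega>" if 2: "T (Suc k) \<omega> \<le> tau n \<omega>"
  proof -
    have "\<not> ?i \<le> k" using T_mono[OF w, of "Suc ?i" "Suc k"] lt 2 by auto
    then show ?thesis using i(3)[OF k] by (simp add: T_Suc)
  qed
qed

text \<open>The rule goes on from the \<open>j\<close>-th catch only if the next one comes within
  \<open>R j\<close>, which does not reach beyond the horizon, so no catch passed on the way is
  later than \<open>t0\<close>.\<close>

lemma tau_le_t0:
  assumes w: "\<omega> \<in> space M" and T: "T n \<omega> \<le> t0" shows "tau n \<omega> \<le> t0"
proof -
  let ?i = "stop_index n \<omega>"
  note i = stop_index[OF w, of n]
  have "T j \<omega> \<le> t0" if "n \<le> j" "j \<le> ?i" for j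
    using that
  proof (induction j rule: dec_induct)
    case (step j)
    then have "S 2 (Suc j) \<omega> \<le> R j \<omega>" "R j \<omega> \<le> t0 - T j \<omega>" using i(3)[of j] R_le[OF w] by auto
    then show ?case by (simp add: T_Suc)
  qed (rule T)
  then show ?thesis using i(1) R_le[OF w, of ?i] by (simp add: tau_def)
qed

text \<open>Truncating at \<open>t\<close> makes the data of the catches up to \<open>t\<close> measurable at time \<open>t\<close>.\<close>

lemma stopping_time_tau: "stopping_time FF (tau n)"
  unfolding stopping_time_def
proof
  fix t
  have pT: "Measurable.pred (FF t) (\<lambda>\<omega>. T i \<omega> \<le> t)" for i
    using FF_event_T by (simp add: pred_def)
  have pT0: "Measurable.pred (FF t) (\<lambda>\<omega>. T i \<omega> \<le> t \<and> T i \<omega> \<le> t0)" for i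
    using FF_event_T[of i "min t t0"] FF_mono[of "min t t0" t] by (auto simp: pred_def)
  define T' where "T' i \<omega> = (if T i \<omega> \<le> t then T i \<omega> else 0)" for i \<omega>
  define L' where "L' i \<omega> = (\<Sum>j=1..i. if T j \<omega> \<le> t then X 2 j \<omega> else 0)" for i \<omega>
  define R' where "R' i \<omega> = (if T i \<omega> \<le> t \<and> T i \<omega> \<le> t0 then P2.r_lim (L' i \<omega>) (T' i \<omega> - s) (t0 - T' i \<omega>) else 0)" for i \<omega>
  have T'm: "T' i \<in> borel_measurable (FF t)" for i
    unfolding T'_def[abs_def] by (rule FF_truncated) simp
  have L'm: "L' i \<in> borel_measurable (FF t)" for i
    unfolding L'_def[abs_def] by (intro borel_measurable_sum FF_truncated) simp
  have eqL: "L' i \<omega> = L i \<omega>" if "\<omega> \<in> space M" "T i \<omega> \<le> t" for i \<omega>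
    unfolding L'_def L_def using that T_mono[OF that(1), of _ i] by (intro sum.cong) (auto intro: order_trans)
  have eqR: "R' i \<omega> = R i \<omega>" if "\<omega> \<in> space M" "T i \<omega> \<le> t" for i \<omega>
    using that by (simp add: R'_def R_def eqL T'_def)
  have R'm: "R' i \<in> borel_measurable (FF t)" for i
    unfolding R'_def[abs_def]
  proof (rule P2.r_lim_measurable[OF L'm _ _ _ pT0])
    show "(L' i x, T' i x - s, t0 - T' i x) \<in> states t0"
      if "x \<in> space (FF t)" "T i x \<le> t \<and> T i x \<le> t0" for x
      using that state_k[of x i] by (simp add: eqL T'_def)
  qed (intro borel_measurable_diff T'm borel_measurable_const)+
  \<comment> \<open>\<open>?E i\<close> says that the rule stops after the \<open>i\<close>-th catch
    and not later than \<open>t\<close>, in terms of data visible at \<open>t\<close>. In the last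
    conjunct a next catch after \<open>t\<close> needs no comparison: it is automatically later than
    the planned stop, which is at most \<open>t\<close>.\<close>
  let ?E = "\<lambda>i \<omega>. T i \<omega> \<le> t \<and> (\<forall>j\<in>{n..<i}. T' (Suc j) \<omega> \<le> T' j \<omega> + R' j \<omega>) \<and> T' i \<omega> + R' i \<omega> \<le> t \<and>
    \<not> (T (Suc i) \<omega> \<le> t \<and> T' (Suc i) \<omega> \<le> T' i \<omega> + R' i \<omega>)"
  have "Measurable.pred (FF t) (\<lambda>\<omega>. \<exists>i\<in>{n..}. ?E i \<omega>)"
    using T'm R'm pT by measurable
  moreover have "tau n \<omega> \<le> t \<longleftrightarrow> (\<exists>i\<in>{n..}. ?E i \<omega>)" if "\<omega> \<in> space (FF t)" for \<omega>
  proof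
    have w: "\<omega> \<in> space M" using that by simp
    {
      assume le: "tau n \<omega> \<le> t"
      let ?i = "stop_index n \<omega>"
      note i = stop_index[OF w, of n]
      have Ti: "T ?i \<omega> \<le> t" using le R_nonneg[OF w, of ?i] by (simp add: tau_def)
      have Tj: "T j \<omega> \<le> t" if "j \<le> ?i" for j using T_mono[OF w that] Ti by simp
      have "T' (Suc j) \<omega> \<le> T' j \<omega> + R' j \<omega>" if j: "n \<le> j" "j < ?i" for j
        using i(3)[OF j] Tj[of j] Tj[of "Suc j"] j w by (simp add: T'_def eqR T_Suc)
      then have "?E ?i \<omega>"
        using i(2) Ti le w by (auto simp: T'_def eqR tau_def T_Suc)
      then show "\<exists>i\<in>{n..}. ?E i \<omega>" using i(1) by (intro bexI[of _ ?i]) auto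
    next
      assume "\<exists>i\<in>{n..}. ?E i \<omega>"
      then obtain i where n: "n \<le> i" and E: "?E i \<omega>" by auto
      then have Ti: "T i \<omega> \<le> t" and Ri: "T' i \<omega> + R' i \<omega> \<le> t" by blast+
      then have Tj: "T j \<omega> \<le> t" if "j \<le> i" for j using T_mono[OF w that] by simp
      have idx: "stop_index n \<omega> = i"
      proof (rule stop_index_eqI[OF n])
        show "R i \<omega> < S 2 (Suc i) \<omega>"
          using E w by (cases "T (Suc i) \<omega> \<le> t") (auto simp: T'_def eqR T_Suc)
        show "S 2 (Suc j) \<omega> \<le> R j \<omega>" if j: "n \<le> j" "j < i" for j
        proof -
          have "T' (Suc j) \<omega> \<le> T' j \<omega> + R' j \<omega>" using E j by simp
          then show ?thesis using Tj[of j] Tj[of "Suc j"] j w by (simp add: T'_def eqR T_Suc)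
        qed
      qed
      show "tau n \<omega> \<le> t" unfolding tau_def idx using Ri Ti eqR[OF w Ti] by (simp add: T'_def)
    }
  qed
  ultimately show "Measurable.pred (FF t) (\<lambda>\<omega>. tau n \<omega> \<le> t)"
    by (subst measurable_cong) auto
qed

text \<open>\<open>R k\<close> is determined by the past, and with the past frozen the next waiting
  time hits a given value with probability 0. This removes the trajectories on which the stopping
  index could fail to stabilise.\<close>

lemma AE_R_neq: "AE \<omega> in M. \<forall>k. R k \<omega> \<noteq> S 2 (Suc k) \<omega>"
  unfolding AE_all_countable
proof
  fix k
  let ?h = "\<lambda>z. if fst (snd z) = R k (fst z) then 1 else 0 :: real"
  have [measurable]: "(\<lambda>z. R k (fst z)) \<in> borel_measurable (past k \<Otimes>\<^sub>M ((borel :: real measure) \<Otimes>\<^sub>M (borel :: real measure)))"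
    by (rule measurable_compose[OF measurable_fst R_past])
  have m: "?h \<in> borel_measurable (past k \<Otimes>\<^sub>M ((borel :: real measure) \<Otimes>\<^sub>M (borel :: real measure)))"
    by measurable
  have "(\<integral>\<omega>. ?h (\<omega>, (S 2 (Suc k) \<omega>, X 2 (Suc k) \<omega>)) \<partial>M) = (\<integral>\<omega>. (\<integral>\<omega>'. ?h (\<omega>, (S 2 1 \<omega>', X 2 1 \<omega>')) \<partial>M) \<partial>M)"
    by (rule expectation_next(1)[OF m, of 1]) auto
  also have "\<dots> = (\<integral>\<omega>. 0 \<partial>M)"
  proof (rule Bochner_Integration.integral_cong[OF refl])
    fix \<omega>
    show "(\<integral>\<omega>'. ?h (\<omega>, (S 2 1 \<omega>', X 2 1 \<omega>')) \<partial>M) = 0"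
      using P2.AE_S_neq[of "R k \<omega>"] by (intro integral_eq_zero_AE) auto
  qed
  finally have "(\<integral>\<omega>. (if S 2 (Suc k) \<omega> = R k \<omega> then 1 else 0 :: real) \<partial>M) = 0" by simp
  moreover have [measurable]: "R k \<in> borel_measurable M" by (rule past_measurable_M[OF R_past])
  have "integrable M (\<lambda>\<omega>. (if S 2 (Suc k) \<omega> = R k \<omega> then 1 else 0 :: real))"
    by (rule integrable_const_bound[of _ 1]) auto
  ultimately have "AE \<omega> in M. (if S 2 (Suc k) \<omega> = R k \<omega> then 1 else 0 :: real) = 0"
    by (subst (asm) integral_nonneg_eq_0_iff_AE) auto
  then show "AE \<omega> in M. R k \<omega> \<noteq> S 2 (Suc k) \<omega>"
    by eventually_elim (auto split: if_splits)
qed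

text \<open>Up to the limiting index only finitely many comparisons between waits and waiting times
  matter. They are strict in the limit and hence the same for all large \<open>K\<close>, so the
  index stabilises and only the last wait still has to converge.\<close>

lemma tau_star_tendsto:
  assumes w: "good \<omega>" and neq: "\<And>k. R k \<omega> \<noteq> S 2 (Suc k) \<omega>"
  shows "(\<lambda>K. tau_star M S X F f2 g cost' t0 s n K \<omega>) \<longlonglongrightarrow> tau n \<omega>"
proof -
  have wM: "\<omega> \<in> space M" using w by simp
  let ?R = "\<lambda>K i. R_star M S X F f2 g cost' t0 s K i \<omega>"
  let ?i = "stop_index n \<omega>"
  note i = stop_index[OF wM, of n]
  have lim: "(\<lambda>K. ?R K i) \<longlonglongrightarrow> R i \<omega>" for i
  proof (cases "T i \<omega> \<le> t0")
    case True
    have "(\<lambda>K. r_star M (X 2 1) (F 2) f2 (g 2) (cost' 2) (K - i) (L i \<omega>) (T i \<omega> - s) (t0 - T i \<omega>)) \<longlonglongrightarrow> R i \<omega>"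
      using filterlim_compose[OF P2.r_star_tendsto[OF state_k[OF wM True]] filterlim_minus_const_nat_at_top[of i]] True
      by (simp add: R_def)
    moreover have "mass S X s (T i \<omega>) \<omega> - mass S X s s \<omega> = L i \<omega>"
      using good_mass[OF w order_refl good_T_Suc[OF w]] good_mass_s[OF w] by simp
    then have "r_star M (X 2 1) (F 2) f2 (g 2) (cost' 2) (K - i) (L i \<omega>) (T i \<omega> - s) (t0 - T i \<omega>) = ?R K i"
      if "i < K" for K using that True by (simp add: R_star_def Let_def)
    then have "\<forall>\<^sub>F K in sequentially. r_star M (X 2 1) (F 2) f2 (g 2) (cost' 2) (K - i) (L i \<omega>) (T i \<omega> - s) (t0 - T i \<omega>) = ?R K i"
      by (rule eventually_mono[OF eventually_gt_at_top[of i]])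
    ultimately show ?thesis by (rule Lim_transform_eventually)
  next
    case False
    then show ?thesis by (simp add: R_star_def R_def)
  qed
  have "\<forall>\<^sub>F K in sequentially. S 2 (Suc j) \<omega> < ?R K j" if "j \<in> {n..<?i}" for j
    using i(3)[of j] neq[of j] that by (intro order_tendstoD(1)[OF lim]) auto
  then have "\<forall>\<^sub>F K in sequentially. \<forall>j\<in>{n..<?i}. S 2 (Suc j) \<omega> < ?R K j"
    by (intro eventually_ball_finite) auto
  moreover have "\<forall>\<^sub>F K in sequentially. ?R K ?i < S 2 (Suc ?i) \<omega>"
    by (rule order_tendstoD(2)[OF lim i(2)])
  moreover have "\<forall>\<^sub>F K in sequentially. ?i \<le> K" by (rule eventually_ge_at_top)
  ultimately have "\<forall>\<^sub>F K in sequentially. T ?i \<omega> + ?R K ?i = tau_star M S X F f2 g cost' t0 s n K \<omega>"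
  proof eventually_elim
    case (elim K)
    have "(LEAST i. n \<le> i \<and> ?R K i < S 2 (i + 1) \<omega>) = ?i"
    proof (rule Least_equality)
      fix j assume j: "n \<le> j \<and> ?R K j < S 2 (j + 1) \<omega>"
      show "?i \<le> j"
      proof (rule ccontr)
        assume "\<not> ?i \<le> j"
        then have "S 2 (Suc j) \<omega> < ?R K j" using elim(1) j by auto
        then show False using j by simp
      qed
    qed (use i(1) elim(2) in simp)
    moreover have "\<exists>i. n \<le> i \<and> ?R K i < S 2 (i + 1) \<omega>" using i(1) elim(2) by auto
    ultimately have "eta M S X F f2 g cost' t0 s n K \<omega> = ?i"
      using elim(3) by (simp add: eta_def)
    then show ?case by (simp add: tau_star_def Let_def)
  qed
  moreover have "(\<lambda>K. T ?i \<omega> + ?R K ?i) \<longlonglongrightarrow> tau n \<omega>"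
    unfolding tau_def by (intro tendsto_intros lim)
  ultimately show ?thesis by (rule Lim_transform_eventually[rotated])
qed

subsection \<open>Optimality\<close>

abbreviation Fn where "Fn n \<equiv> FF.pre_sigma (T n)"
abbreviation gam_at where "gam_at n \<omega> \<equiv> gam (W0 \<omega>) (L n \<omega>) (T n \<omega>)"

text \<open>Without this, \<open>gam_at n\<close> could not be a version of the conditional
  expectation. The weights involved are known at \<open>T n\<close> because
  \<open>T i \<le> T n\<close> for \<open>i \<le> n\<close>.\<close>

lemma gam_at_Fn: "gam_at n \<in> borel_measurable (Fn n)"
proof -
  have sub: "sets F1 \<subseteq> sets (Fn n)"
  proof
    fix B assume B: "B \<in> sets F1"
    show "B \<in> sets (Fn n)"
    proof (rule FF.sets_pre_sigmaI[OF stopping_time_T])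
      fix t
      have "{\<omega> \<in> B. T n \<omega> \<le> t} = B \<inter> {\<omega> \<in> space M. T n \<omega> \<le> t}"
        using sets.sets_into_space[OF B] by (auto simp: space_F1)
      then show "{\<omega> \<in> B. T n \<omega> \<le> t} \<in> sets (FF t)"
        using B F1_FF[of t] FF_event_T[of n t] by (simp only:) (intro sets.Int; blast)
    qed
  qed
  have W: "W0 \<in> borel_measurable (Fn n)"
    using W0_F1 sub by (auto simp: measurable_def space_F1 FF.space_pre_sigma)
  have X: "X 2 i \<in> borel_measurable (Fn n)" if i: "i \<le> n" for i
  proof (rule measurableI)
    fix A :: "real set" assume A: "A \<in> sets borel"
    show "X 2 i -` A \<inter> space (Fn n) \<in> sets (Fn n)"
    proof (rule FF.sets_pre_sigmaI[OF stopping_time_T])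
      fix t
      have "{\<omega> \<in> X 2 i -` A \<inter> space (Fn n). T n \<omega> \<le> t} =
          {\<omega> \<in> space M. (i = 0 \<or> T i \<omega> \<le> t) \<and> X 2 i \<omega> \<in> A} \<inter> {\<omega> \<in> space M. T n \<omega> \<le> t}"
        using T_mono[OF _ i] by (auto simp: FF.space_pre_sigma intro: order_trans)
      also have "\<dots> \<in> sets (FF t)" by (intro sets.Int FF_event FF_event_T A) simp
      finally show "{\<omega> \<in> X 2 i -` A \<inter> space (Fn n). T n \<omega> \<le> t} \<in> sets (FF t)" .
    qed
  qed auto
  have L: "L n \<in> borel_measurable (Fn n)"
    unfolding L_def[abs_def] by (intro borel_measurable_sum X) auto
  show ?thesis
    by (intro gam_meas W L FF.measurable_stopping_time_pre_sigma stopping_time_T)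
qed

lemma subalgebra_Fn: "subalgebra M (Fn n)"
  using pre_sigma_subset by (simp add: subalgebra_def FF.space_pre_sigma)

lemma stopping_rulesD:
  assumes "\<sigma> \<in> stopping_rules_from M S X s n"
  shows "stopping_time FF \<sigma>" "\<sigma> \<in> borel_measurable M" "\<And>\<omega>. \<omega> \<in> space M \<Longrightarrow> s \<le> \<sigma> \<omega>" "AE \<omega> in M. T n \<omega> \<le> \<sigma> \<omega>"
proof -
  show "stopping_time FF \<sigma>" "\<And>\<omega>. \<omega> \<in> space M \<Longrightarrow> s \<le> \<sigma> \<omega>" "AE \<omega> in M. T n \<omega> \<le> \<sigma> \<omega>"
    using assms by (auto simp: stopping_rules_from_def stopping_rules_def)
  then show "\<sigma> \<in> borel_measurable M"
    by (intro measurable_stopping_time[of FF]) (auto dest: subsetD[OF FF_subset])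
qed

lemma expectation_U_base:
  assumes \<sigma>: "\<sigma> \<in> borel_measurable M" "\<And>\<omega>. \<omega> \<in> space M \<Longrightarrow> s \<le> \<sigma> \<omega>" "AE \<omega> in M. T n \<omega> \<le> \<sigma> \<omega>"
    and A: "A \<in> sets (Fn n)"
  shows "(\<integral>\<omega>. indicator A \<omega> * U \<sigma> n \<omega> \<partial>M) = (\<integral>\<omega>. indicator A \<omega> * gam_at n \<omega> \<partial>M)"
proof (rule integral_cong_AE)
  show "AE \<omega> in M. indicator A \<omega> * U \<sigma> n \<omega> = indicator A \<omega> * gam_at n \<omega>"
    using \<sigma>(3) by eventually_elim (auto simp: U_def)
  note [measurable] = U_measurable[OF \<sigma>(1,2)] measurable_from_subalg[OF subalgebra_Fn gam_at_Fn]
  have [measurable]: "A \<in> sets M" using A pre_sigma_subset by blast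
  show "(\<lambda>\<omega>. indicator A \<omega> * U \<sigma> n \<omega>) \<in> borel_measurable M" "(\<lambda>\<omega>. indicator A \<omega> * gam_at n \<omega>) \<in> borel_measurable M"
    by measurable
qed

text \<open>On every event known at the \<open>n\<close>-th catch, the integral of \<open>U\<close>
  does not increase from one catch to the next, because no wait beats the continuation value. It
  starts at the integral of \<open>gam_at n\<close> and tends to that of the payoff.\<close>

lemma expectation_payoff_le:
  assumes \<sigma>: "\<sigma> \<in> stopping_rules_from M S X s n" and A: "A \<in> sets (Fn n)"
  shows "(\<integral>\<omega>. indicator A \<omega> * Z (\<sigma> \<omega>) \<omega> \<partial>M) \<le> (\<integral>\<omega>. indicator A \<omega> * gam_at n \<omega> \<partial>M)"
proof -
  note \<sigma>' = stopping_rulesD[OF \<sigma>]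
  define P where "P k \<rho> \<longleftrightarrow> \<rho> \<in> borel_measurable (past k) \<and>
    (\<forall>\<omega>\<in>space M. ereal (T k \<omega>) \<le> \<rho> \<omega> \<and> (T k \<omega> \<le> \<sigma> \<omega> \<longrightarrow> \<sigma> \<omega> < T (Suc k) \<omega> \<longrightarrow> \<rho> \<omega> = ereal (\<sigma> \<omega>)) \<and>
      (T (Suc k) \<omega> \<le> \<sigma> \<omega> \<longrightarrow> ereal (T (Suc k) \<omega>) \<le> \<rho> \<omega>))" for k \<rho>
  have "\<exists>\<rho>. P k \<rho>" for k
  proof -
    have "{\<omega> \<in> space M. ereal (\<sigma> \<omega>) \<le> ereal t} \<in> sets (FF t)" for t
      using \<sigma>'(1) by (simp add: stopping_time_def pred_def)
    then obtain \<rho> where "\<rho> \<in> borel_measurable (past k)"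
      and "\<And>\<omega>. \<omega> \<in> space M \<Longrightarrow> ereal (T k \<omega>) \<le> \<rho> \<omega>"
      and "\<And>\<omega>. \<omega> \<in> space M \<Longrightarrow> ereal (T k \<omega>) \<le> ereal (\<sigma> \<omega>) \<Longrightarrow> ereal (\<sigma> \<omega>) < ereal (T (Suc k) \<omega>) \<Longrightarrow> \<rho> \<omega> = ereal (\<sigma> \<omega>)"
      and "\<And>\<omega>. \<omega> \<in> space M \<Longrightarrow> ereal (T (Suc k) \<omega>) \<le> ereal (\<sigma> \<omega>) \<Longrightarrow> ereal (T (Suc k) \<omega>) \<le> \<rho> \<omega>"
      by (rule stopping_time_between_catches[where k = k]) (rule that)
    then show ?thesis unfolding P_def by (intro exI[of _ \<rho>]) auto
  qed
  then have "\<forall>k. \<exists>\<rho>. P k \<rho>" by blast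
  from choice[OF this] obtain \<rho> where "\<forall>k. P k (\<rho> k)" ..
  then have \<rho>: "\<And>k. \<rho> k \<in> borel_measurable (past k)"
    "\<And>k \<omega>. \<omega> \<in> space M \<Longrightarrow> ereal (T k \<omega>) \<le> \<rho> k \<omega>"
    "\<And>k \<omega>. n \<le> k \<Longrightarrow> \<omega> \<in> space M \<Longrightarrow> T k \<omega> \<le> \<sigma> \<omega> \<Longrightarrow> \<sigma> \<omega> < T (Suc k) \<omega> \<Longrightarrow> \<rho> k \<omega> = ereal (\<sigma> \<omega>)"
    "\<And>k \<omega>. n \<le> k \<Longrightarrow> \<omega> \<in> space M \<Longrightarrow> T (Suc k) \<omega> \<le> \<sigma> \<omega> \<Longrightarrow> ereal (T (Suc k) \<omega>) \<le> \<rho> k \<omega>"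
    by (simp_all add: P_def)
  let ?E = "\<lambda>k. \<integral>\<omega>. indicator A \<omega> * U \<sigma> k \<omega> \<partial>M"
  have step: "?E (Suc k) \<le> ?E k" if k: "n \<le> k" for k
  proof -
    obtain A' where A': "A' \<in> sets (past k)" "?E (Suc k) - ?E k =
     (\<integral>\<omega>. indicator A' \<omega> * (mean_after_next (W0 \<omega>) (L k \<omega>) (T k \<omega>) (\<rho> k \<omega>) - gam_at k \<omega>) \<partial>M)"
      by (rule expectation_U_step[OF \<sigma>'(2-4) \<rho> A k]; (assumption | (rule that; assumption)))
    have "0 \<le> (\<integral>\<omega>. - (indicator A' \<omega> * (mean_after_next (W0 \<omega>) (L k \<omega>) (T k \<omega>) (\<rho> k \<omega>) - gam_at k \<omega>)) \<partial>M)"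
    proof (rule integral_nonneg_AE, rule AE_I2)
      fix \<omega> assume w: "\<omega> \<in> space M"
      have "mean_after_next (W0 \<omega>) (L k \<omega>) (T k \<omega>) (\<rho> k \<omega>) \<le> gam_at k \<omega>"
        using w by (intro mean_after_next_le W0_bound W0_lower L_nonneg T_ge_s \<rho>(2))
      then show "0 \<le> - (indicator A' \<omega> * (mean_after_next (W0 \<omega>) (L k \<omega>) (T k \<omega>) (\<rho> k \<omega>) - gam_at k \<omega>))"
        by (simp add: indicator_def)
    qed
    then show ?thesis using A'(2) by simp
  qed
  have "?E k \<le> ?E n" if "n \<le> k" for k
    using that
  proof (induction k rule: dec_induct)
    case (step k)
    then show ?case using \<open>n \<le> k\<close> \<open>\<And>k. n \<le> k \<Longrightarrow> ?E (Suc k) \<le> ?E k\<close>[of k] by linarith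
  qed simp
  moreover have "?E \<longlonglongrightarrow> (\<integral>\<omega>. indicator A \<omega> * Z (\<sigma> \<omega>) \<omega> \<partial>M)"
    using A pre_sigma_subset by (intro tendsto_expectation_U \<sigma>') auto
  ultimately have "(\<integral>\<omega>. indicator A \<omega> * Z (\<sigma> \<omega>) \<omega> \<partial>M) \<le> ?E n"
    by (intro LIMSEQ_le_const2[of ?E]) auto
  then show ?thesis using expectation_U_base[OF \<sigma>'(2-4) A] by simp
qed

lemma tau_stopping_rule: "tau n \<in> stopping_rules_from M S X s n"
  using stopping_time_tau tau_ge T_ge_s by (force simp: stopping_rules_from_def stopping_rules_def intro: order_trans)

lemma expectation_payoff_tau:
  assumes A: "A \<in> sets (Fn n)"
  shows "(\<integral>\<omega>. indicator A \<omega> * Z (tau n \<omega>) \<omega> \<partial>M) = (\<integral>\<omega>. indicator A \<omega> * gam_at n \<omega> \<partial>M)"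
proof -
  note \<tau> = stopping_rulesD[OF tau_stopping_rule[of n]]
  define \<rho> where "\<rho> k \<omega> = ereal (T k \<omega> + R k \<omega>)" for k \<omega>
  have \<rho>: "\<And>k. \<rho> k \<in> borel_measurable (past k)"
    "\<And>k \<omega>. \<omega> \<in> space M \<Longrightarrow> ereal (T k \<omega>) \<le> \<rho> k \<omega>"
    "\<And>k \<omega>. n \<le> k \<Longrightarrow> \<omega> \<in> space M \<Longrightarrow> T k \<omega> \<le> tau n \<omega> \<Longrightarrow> tau n \<omega> < T (Suc k) \<omega> \<Longrightarrow> \<rho> k \<omega> = ereal (tau n \<omega>)"
    "\<And>k \<omega>. n \<le> k \<Longrightarrow> \<omega> \<in> space M \<Longrightarrow> T (Suc k) \<omega> \<le> tau n \<omega> \<Longrightarrow> ereal (T (Suc k) \<omega>) \<le> \<rho> k \<omega>"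
    using tau_between R_nonneg unfolding \<rho>_def[abs_def]
    by (auto intro!: borel_measurable_ereal borel_measurable_add past_T R_past)
  let ?E = "\<lambda>k. \<integral>\<omega>. indicator A \<omega> * U (tau n) k \<omega> \<partial>M"
  have step: "?E (Suc k) = ?E k" if k: "n \<le> k" for k
  proof -
    obtain A' where A': "A' \<in> sets (past k)" "?E (Suc k) - ?E k =
     (\<integral>\<omega>. indicator A' \<omega> * (mean_after_next (W0 \<omega>) (L k \<omega>) (T k \<omega>) (\<rho> k \<omega>) - gam_at k \<omega>) \<partial>M)"
      by (rule expectation_U_step[OF \<tau>(2-4) \<rho> A k]; (assumption | (rule that; assumption)))
    have "(\<integral>\<omega>. indicator A' \<omega> * (mean_after_next (W0 \<omega>) (L k \<omega>) (T k \<omega>) (\<rho> k \<omega>) - gam_at k \<omega>) \<partial>M) =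
        (\<integral>\<omega>. 0 \<partial>M)"
    proof (rule Bochner_Integration.integral_cong[OF refl])
      fix \<omega> assume w: "\<omega> \<in> space M"
      have "mean_after_next (W0 \<omega>) (L k \<omega>) (T k \<omega>) (\<rho> k \<omega>) = gam_at k \<omega>"
        unfolding \<rho>_def R_def by (rule mean_after_next_optimal[OF L_nonneg[OF w] T_ge_s[OF w]])
      then show "indicator A' \<omega> * (mean_after_next (W0 \<omega>) (L k \<omega>) (T k \<omega>) (\<rho> k \<omega>) - gam_at k \<omega>) = 0" by simp
    qed
    then show ?thesis using A'(2) by simp
  qed
  have "?E k = ?E n" if "n \<le> k" for k
    using that by (induction k rule: dec_induct) (simp_all add: step)
  then have "\<forall>\<^sub>F k in sequentially. ?E k = ?E n"
    by (rule eventually_mono[OF eventually_ge_at_top[of n]])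
  then have "?E \<longlonglongrightarrow> ?E n" by (rule tendsto_eventually)
  moreover have "?E \<longlonglongrightarrow> (\<integral>\<omega>. indicator A \<omega> * Z (tau n \<omega>) \<omega> \<partial>M)"
    using A pre_sigma_subset by (intro tendsto_expectation_U \<tau>) auto
  ultimately have "(\<integral>\<omega>. indicator A \<omega> * Z (tau n \<omega>) \<omega> \<partial>M) = ?E n"
    by (rule LIMSEQ_unique[rotated])
  then show ?thesis using expectation_U_base[OF \<tau>(2-4) A] by simp
qed

lemma integrable_payoff:
  assumes "\<sigma> \<in> stopping_rules_from M S X s n"
  shows "integrable M (\<lambda>\<omega>. Z (\<sigma> \<omega>) \<omega>)"
proof -
  note \<sigma> = stopping_rulesD[OF assms]
  obtain B where B: "\<forall>\<sigma> k \<omega>. \<omega> \<in> space M \<and> s \<le> \<sigma> \<omega> \<longrightarrow> \<bar>Z (\<sigma> \<omega>) \<omega>\<bar> \<le> B \<and> \<bar>U \<sigma> k \<omega>\<bar> \<le> B"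
    using payoff_U_bound ..
  show ?thesis
  proof (rule integrable_const_bound[of _ B])
    show "AE \<omega> in M. norm (Z (\<sigma> \<omega>) \<omega>) \<le> B"
    proof (rule AE_I2)
      fix \<omega> assume "\<omega> \<in> space M"
      then show "norm (Z (\<sigma> \<omega>) \<omega>) \<le> B" using B \<sigma>(3) by simp
    qed
  qed (rule payoff_measurable[OF \<sigma>(2,3)])
qed

lemma integrable_gam_at: "integrable M (gam_at n)"
proof -
  obtain B where B: "\<And>w l t. \<bar>w\<bar> \<le> G 1 + \<bar>cost 1 s\<bar> \<Longrightarrow> \<bar>pay w l t\<bar> \<le> B"
    "\<And>w l t. \<bar>w\<bar> \<le> G 1 + \<bar>cost 1 s\<bar> \<Longrightarrow> \<bar>gam w l t\<bar> \<le> B" by (rule pay_gam_bound) (rule that)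
  show ?thesis
    using B(2)[OF W0_bound] measurable_from_subalg[OF subalgebra_Fn gam_at_Fn]
    by (intro integrable_const_bound[of _ B]) auto
qed

lemma cond_exp_tau:
  "AE \<omega> in M. real_cond_exp M (Fn n) (\<lambda>\<omega>. Z (tau n \<omega>) \<omega>) \<omega> = gam_at n \<omega>"
proof -
  interpret finite_measure_subalgebra M "Fn n" by unfold_locales (rule subalgebra_Fn)
  show ?thesis
    using expectation_payoff_tau
    by (intro real_cond_exp_charact integrable_payoff[OF tau_stopping_rule] integrable_gam_at gam_at_Fn)
      (simp add: set_lebesgue_integral_def)
qed

lemma cond_exp_le:
  assumes \<sigma>: "\<sigma> \<in> stopping_rules_from M S X s n"
  shows "AE \<omega> in M. real_cond_exp M (Fn n) (\<lambda>\<omega>. Z (\<sigma> \<omega>) \<omega>) \<omega> \<le> gam_at n \<omega>"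
proof -
  interpret sub: finite_measure_subalgebra M "Fn n" by unfold_locales (rule subalgebra_Fn)
  let ?c = "real_cond_exp M (Fn n) (\<lambda>\<omega>. Z (\<sigma> \<omega>) \<omega>)"
  \<comment> \<open>The bound is tested on the event on which the claim fails. There the difference
    is positive but its integral is at most 0, so the event is null.\<close>
  define A where "A = {\<omega> \<in> space (Fn n). gam_at n \<omega> < ?c \<omega>}"
  have A: "A \<in> sets (Fn n)"
    unfolding A_def using gam_at_Fn[of n] by (intro borel_measurable_less borel_measurable_cond_exp)
  then have AM: "A \<in> sets M" using pre_sigma_subset by blast
  note ic = sub.real_cond_exp_int(1)[OF integrable_payoff[OF \<sigma>]]
  have i1: "integrable M (\<lambda>\<omega>. indicator A \<omega> * ?c \<omega>)" "integrable M (\<lambda>\<omega>. indicator A \<omega> * gam_at n \<omega>)"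
    using integrable_mult_indicator[OF AM ic] integrable_mult_indicator[OF AM integrable_gam_at[of n]] by simp_all
  have "(\<integral>\<omega>. indicator A \<omega> * Z (\<sigma> \<omega>) \<omega> \<partial>M) = (\<integral>\<omega>. indicator A \<omega> * ?c \<omega> \<partial>M)"
    using sub.real_cond_exp_intA[OF integrable_payoff[OF \<sigma>] A] by (simp add: set_lebesgue_integral_def)
  then have "(\<integral>\<omega>. indicator A \<omega> * ?c \<omega> - indicator A \<omega> * gam_at n \<omega> \<partial>M) \<le> 0"
    using expectation_payoff_le[OF \<sigma> A] i1 by simp
  moreover have nn: "AE \<omega> in M. 0 \<le> indicator A \<omega> * ?c \<omega> - indicator A \<omega> * gam_at n \<omega>"
    by (rule AE_I2) (auto simp: A_def indicator_def)
  ultimately have "(\<integral>\<omega>. indicator A \<omega> * ?c \<omega> - indicator A \<omega> * gam_at n \<omega> \<partial>M) = 0"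
    using integral_nonneg_AE[OF nn] by linarith
  then have "AE \<omega> in M. indicator A \<omega> * ?c \<omega> - indicator A \<omega> * gam_at n \<omega> = 0"
    using i1 nn by (subst (asm) integral_nonneg_eq_0_iff_AE) auto
  then show ?thesis
    using AE_space by eventually_elim (auto simp: A_def FF.space_pre_sigma indicator_def not_less split: if_splits)
qed

end

theorem theorem4:
  fixes M :: "'a measure"
    and S X :: "nat \<Rightarrow> nat \<Rightarrow> 'a \<Rightarrow> real"
    and F H g cost cost' :: "nat \<Rightarrow> real \<Rightarrow> real"
    and G C :: "nat \<Rightarrow> real"
    and f2 :: "real \<Rightarrow> real"
    and t0 s :: real
    and n :: nat
  assumes "fishing_model M S X F H g G cost cost' C t0"
    and "0 \<le> s"
    and "F 2 t0 < 1"
    and "\<And>x. 0 \<le> f2 x"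
    and "\<And>k. 1 \<le> k \<Longrightarrow> distributed M lborel (S 2 k) (\<lambda>x. ennreal (f2 x))"
  shows "\<exists>\<tau>.
      (AE \<omega> in M. (\<lambda>K. tau_star M S X F f2 g cost' t0 s n K \<omega>) \<longlonglongrightarrow> \<tau> \<omega>) \<and>
      (AE \<omega> in M. arrival S s 2 n \<omega> \<le> t0 \<longrightarrow> \<tau> \<omega> \<le> t0) \<and>
      \<tau> \<in> stopping_rules_from M S X s n \<and>
      (\<forall>\<sigma> \<in> stopping_rules_from M S X s n. AE \<omega> in M.
         real_cond_exp M (filt2_at (space M) S X s n) (\<lambda>\<omega>. payoff S X g cost C t0 s (\<sigma> \<omega>) \<omega>) \<omega>
         \<le> real_cond_exp M (filt2_at (space M) S X s n) (\<lambda>\<omega>. payoff S X g cost C t0 s (\<tau> \<omega>) \<omega>) \<omega>) \<and>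
      (AE \<omega> in M.
         real_cond_exp M (filt2_at (space M) S X s n) (\<lambda>\<omega>. payoff S X g cost C t0 s (\<tau> \<omega>) \<omega>) \<omega>
         = gamma M X F f2 g cost cost' C t0 s (mass S X s s \<omega>)
             (mass S X s (arrival S s 2 n \<omega>) \<omega>) (arrival S s 2 n \<omega>))"
proof -
  interpret fishing_model M S X F H g G cost cost' C t0 by fact
  interpret fishing_change M S X F H g G cost cost' C t0 f2 s
    by unfold_locales (use assms in auto)
  show ?thesis
  proof (intro exI[of _ "tau n"] conjI ballI)
    show "AE \<omega> in M. (\<lambda>K. tau_star M S X F f2 g cost' t0 s n K \<omega>) \<longlonglongrightarrow> tau n \<omega>"
      using AE_good AE_R_neq by eventually_elim (simp add: tau_star_tendsto)
    \<comment> \<open>The condition is unavoidable: every admissible rule stops no earlier than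
      \<open>T n\<close>, up to a null set.\<close>
    show "AE \<omega> in M. T n \<omega> \<le> t0 \<longrightarrow> tau n \<omega> \<le> t0"
      by (rule AE_I2) (simp add: tau_le_t0)
    show "tau n \<in> stopping_rules_from M S X s n" by (rule tau_stopping_rule)
    show "AE \<omega> in M. real_cond_exp M (filt2_at (space M) S X s n) (\<lambda>\<omega>. Z (\<sigma> \<omega>) \<omega>) \<omega>
         \<le> real_cond_exp M (filt2_at (space M) S X s n) (\<lambda>\<omega>. Z (tau n \<omega>) \<omega>) \<omega>"
      if "\<sigma> \<in> stopping_rules_from M S X s n" for \<sigma>
      using cond_exp_le[OF that] cond_exp_tau[of n] unfolding filt2_at_def by eventually_elim simp
    show "AE \<omega> in M. real_cond_exp M (filt2_at (space M) S X s n) (\<lambda>\<omega>. Z (tau n \<omega>) \<omega>) \<omega>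
         = gamma M X F f2 g cost cost' C t0 s (mass S X s s \<omega>) (mass S X s (T n \<omega>) \<omega>) (T n \<omega>)"
      using cond_exp_tau[of n] AE_good unfolding filt2_at_def by eventually_elim (simp add: good_gamma)
  qed
qed

end
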